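(* Unless $\mathrm{P}=\mathrm{NP}$, for every $\epsilon\in(0,1)$ and every non-decreasing function $r$ with $r(n)=O(n^{1-\epsilon})$, there is no polynomial-time $r(\cdot)$-approximation algorithm for the Maximum Reachability Trip Temporalisation problem (mrtt), where $n$ is the number of nodes; i.e. no polynomial-time algorithm that, on every input trip network with $n$ nodes, returns a temporalisation whose temporal reachability is at least $1/r(n)$ times the maximum possible.
   Context: A weighted multidigraph $D=(V,E)$ has a finite node set $V$ and a finite multiset $E$ of edges $(u,v,w)$ with tail $u$, head $v$ and weight $w>0$. A walk is a sequence of edges $e_1,\dots,e_k$ where the head of $e_i$ equals the tail of $e_{i+1}$. A trip network is a pair $(D,\mathbb{T})$ where $\mathbb{T}$ is a finite multiset of walks in $D$, called trips; every node and edge of $D$ appears in some trip. A temporalisation $\tau$ assigns a real starting time $\tau(T)$ to each trip. For a trip $T=e_1,\dots,e_k$ with $e_i=(u_i,v_i,w_i)$, it induces temporal edges $(u_i,v_i,\tau(T)+\sum_{j<i}w_j,w_i)$ (tail, head, starting time, travel time). The induced temporal graph $G[D,\mathbb{T},\tau]$ has node set $V$ and all temporal edges induced by all trips (disjoint union). A temporal path from $u$ to $v$ is a sequence of temporal edges $f_1,\dots,f_k$ from $u$ to $v$, consecutive (head of $f_i$ = tail of $f_{i+1}$), with the starting time of $f_{i+1}$ at least the arrival time (starting time plus travel time) of $f_i$. $v$ is temporally reachable from $u$ if such a path exists (every node reaches itself). The temporal reachability ($\tau$-reachability) of the trip network is $\sum_{u\in V}|\{v: v \text{ temporally reachable from }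 u \text{ in } G[D,\mathbb{T},\tau]\}|$. The mrtt problem: given a trip network, find a temporalisation maximising its $\tau$-reachability. *)

theory Defs
  imports
    Complex_Main
    "HOL-Library.Multiset"
    "HOL-Library.Landau_Symbols"
    "HOL-Computational_Algebra.Polynomial"
begin

section \<open>Trip networks and their temporal reachability\<close>

type_synonym 'v edge = "'v \<times> 'v \<times> real"

definition tail :: "'v edge \<Rightarrow> 'v" where "tail e = fst e"
definition head :: "'v edge \<Rightarrow> 'v" where "head e = fst (snd e)"
definition weight :: "'v edge \<Rightarrow> real" where "weight e = snd (snd e)"

text \<open>The multiset of trips is given by an enumeration, so that equal trips can be told
  apart by their index; a temporalisation maps trip indices to starting times.\<close>

record 'v trip_network =
  nodes :: "'v set"
  edges :: "'v edge multiset"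
  trips :: "'v edge list list"

type_synonym temporalisation = "nat \<Rightarrow> real"

definition walk :: "'v edge multiset \<Rightarrow> 'v edge list \<Rightarrow> bool" where
  "walk E T \<longleftrightarrow> T \<noteq> [] \<and> set T \<subseteq> set_mset E \<and> successively (\<lambda>e e'. head e = tail e') T"

definition is_trip_network :: "'v trip_network \<Rightarrow> bool" where
  "is_trip_network N \<longleftrightarrow>
     finite (nodes N) \<and>
     (\<forall>e \<in># edges N. tail e \<in> nodes N \<and> head e \<in> nodes N \<and> weight e > 0) \<and>
     (\<forall>T \<in> set (trips N). walk (edges N) T) \<and>
     (\<forall>v \<in> nodes N. \<exists>T \<in> set (trips N). \<exists>e \<in> set T. v = tail e \<or> v = head e) \<and>
     (\<forall>e \<in># edges N. \<exists>T \<in> set (trips N). e \<in> set T)"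

text \<open>Tail, head, starting time, travel time.\<close>

type_synonym 'v temporal_edge = "'v \<times> 'v \<times> real \<times> real"

definition t_tail :: "'v temporal_edge \<Rightarrow> 'v" where "t_tail f = fst f"
definition t_head :: "'v temporal_edge \<Rightarrow> 'v" where "t_head f = fst (snd f)"
definition t_start :: "'v temporal_edge \<Rightarrow> real" where "t_start f = fst (snd (snd f))"
definition t_travel :: "'v temporal_edge \<Rightarrow> real" where "t_travel f = snd (snd (snd f))"
definition t_arrival :: "'v temporal_edge \<Rightarrow> real" where "t_arrival f = t_start f + t_travel f"

definition induced_edges :: "real \<Rightarrow> 'v edge list \<Rightarrow> 'v temporal_edge list" where
  "induced_edges s T =
     map (\<lambda>i. (tail (T ! i), head (T ! i), s + (\<Sum>j<i. weight (T ! j)), weight (T ! i)))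
       [0..<length T]"

definition temporal_edges :: "'v trip_network \<Rightarrow> temporalisation \<Rightarrow> 'v temporal_edge multiset" where
  "temporal_edges N \<tau> = (\<Sum>i<length (trips N). mset (induced_edges (\<tau> i) (trips N ! i)))"

definition temporal_path ::
    "'v temporal_edge multiset \<Rightarrow> 'v \<Rightarrow> 'v temporal_edge list \<Rightarrow> 'v \<Rightarrow> bool" where
  "temporal_path F u fs v \<longleftrightarrow>
     fs \<noteq> [] \<and> set fs \<subseteq> set_mset F \<and> t_tail (hd fs) = u \<and> t_head (last fs) = v \<and>
     successively (\<lambda>f f'. t_head f = t_tail f' \<and> t_start f' \<ge> t_arrival f) fs"

definition temporally_reachable :: "'v temporal_edge multiset \<Rightarrow> 'v \<Rightarrow> 'v \<Rightarrow> bool" where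
  "temporally_reachable F u v \<longleftrightarrow> u = v \<or> (\<exists>fs. temporal_path F u fs v)"

definition temporal_reachability :: "'v trip_network \<Rightarrow> temporalisation \<Rightarrow> nat" where
  "temporal_reachability N \<tau> =
     (\<Sum>u \<in> nodes N. card {v \<in> nodes N. temporally_reachable (temporal_edges N \<tau>) u v})"

definition max_reachability :: "'v trip_network \<Rightarrow> nat" where
  "max_reachability N = Max (range (temporal_reachability N))"


section \<open>Turing machines, P and NP\<close>

text \<open>Deterministic multi-tape machines with two-way infinite tapes. The non-halting states
  are \<open>0, \<dots>, states M - 1\<close>, with initial state \<open>0\<close>; the halting state is \<open>states M\<close>. The tape
  symbols are \<open>0, \<dots>, symbols M - 1\<close>: \<open>0\<close> is the blank, \<open>1\<close> and \<open>2\<close> represent the bits.\<close>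

datatype move = MoveLeft | Stay | MoveRight

record tm =
  tapes :: nat
  states :: nat
  symbols :: nat
  delta :: "nat \<Rightarrow> nat list \<Rightarrow> nat \<times> (nat \<times> move) list"

definition is_tm :: "tm \<Rightarrow> bool" where
  "is_tm M \<longleftrightarrow> tapes M \<ge> 2 \<and> symbols M \<ge> 3 \<and>
     (\<forall>q < states M. \<forall>ss. length ss = tapes M \<and> (\<forall>s \<in> set ss. s < symbols M) \<longrightarrow>
        (case delta M q ss of (q', as) \<Rightarrow>
           q' \<le> states M \<and> length as = tapes M \<and> (\<forall>(s', m) \<in> set as. s' < symbols M)))"

text \<open>Tape contents and head position.\<close>

type_synonym tape = "(int \<Rightarrow> nat) \<times> int"
type_synonym config = "nat \<times> tape list"

definition read_tape :: "tape \<Rightarrow> nat" where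
  "read_tape T = fst T (snd T)"

fun move_head :: "move \<Rightarrow> int \<Rightarrow> int" where
  "move_head MoveLeft h = h - 1"
| "move_head Stay h = h"
| "move_head MoveRight h = h + 1"

definition act :: "nat \<times> move \<Rightarrow> tape \<Rightarrow> tape" where
  "act a T = ((fst T)(snd T := fst a), move_head (snd a) (snd T))"

definition tm_step :: "tm \<Rightarrow> config \<Rightarrow> config" where
  "tm_step M c =
     (if fst c = states M then c
      else (case delta M (fst c) (map read_tape (snd c)) of
              (q', as) \<Rightarrow> (q', map2 act as (snd c))))"

definition bit_symbol :: "bool \<Rightarrow> nat" where
  "bit_symbol b = (if b then 2 else 1)"

definition input_tape :: "bool list \<Rightarrow> tape" where
  "input_tape x =
     ((\<lambda>i. if 0 \<le> i \<and> i < int (length x) then bit_symbol (x ! nat i) else 0), 0)"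

definition init_config :: "tm \<Rightarrow> bool list \<Rightarrow> config" where
  "init_config M x = (0, input_tape x # replicate (tapes M - 1) (\<lambda>_. 0, 0))"

definition tape_output :: "tape \<Rightarrow> bool list \<Rightarrow> bool" where
  "tape_output T y \<longleftrightarrow>
     (\<forall>i < length y. fst T (int i) = bit_symbol (y ! i)) \<and> fst T (int (length y)) = 0"

text \<open>On input \<open>x\<close> (on tape 0), \<open>M\<close> halts after at most \<open>t\<close> steps with output \<open>y\<close> (on tape 1).
  A halted configuration is a fixed point of \<open>tm_step\<close>.\<close>

definition outputs_within :: "tm \<Rightarrow> nat \<Rightarrow> bool list \<Rightarrow> bool list \<Rightarrow> bool" where
  "outputs_within M t x y \<longleftrightarrow>
     (let c = (tm_step M ^^ t) (init_config M x)
      in fst c = states M \<and> tape_output (snd c ! 1) y)"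

definition P_class :: "bool list set set" where
  "P_class = {L. \<exists>M p. is_tm M \<and>
     (\<forall>x. outputs_within M (poly (p :: nat poly) (length x)) x [x \<in> L])}"


subsection \<open>Prefix-free encodings as bit strings\<close>

definition enc_list :: "('a \<Rightarrow> bool list) \<Rightarrow> 'a list \<Rightarrow> bool list" where
  "enc_list f xs = concat (map (\<lambda>x. True # f x) xs) @ [False]"

definition enc_string :: "bool list \<Rightarrow> bool list" where
  "enc_string = enc_list (\<lambda>b. [b])"

definition enc_pair :: "bool list \<Rightarrow> bool list \<Rightarrow> bool list" where
  "enc_pair x y = enc_string x @ enc_string y"

definition NP_class :: "bool list set set" where
  "NP_class = {L. \<exists>V \<in> P_class. \<exists>q :: nat poly.
     \<forall>x. x \<in> L \<longleftrightarrow> (\<exists>y. length y \<le> poly q (length x) \<and> enc_pair x y \<in> V)}"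

text \<open>Binary digits, least significant first.\<close>

fun binary :: "nat \<Rightarrow> bool list" where
  "binary n = (if n = 0 then [] else odd n # binary (n div 2))"

declare binary.simps [simp del]

definition enc_nat :: "nat \<Rightarrow> bool list" where
  "enc_nat n = enc_string (binary n)"

definition enc_int :: "int \<Rightarrow> bool list" where
  "enc_int k = (k < 0) # enc_nat (nat \<bar>k\<bar>)"

definition enc_rat :: "rat \<Rightarrow> bool list" where
  "enc_rat q = (case quotient_of q of (a, b) \<Rightarrow> enc_int a @ enc_int b)"


section \<open>The approximation problem\<close>

text \<open>An input consists of the number \<open>n\<close> of nodes, which are \<open>0, \<dots>, n - 1\<close>, the edges and the
  trips; weights are rational numbers, written in binary.\<close>

type_synonym rat_edge = "nat \<times> nat \<times> rat"
type_synonym mrtt_input = "nat \<times> rat_edge list \<times> rat_edge list list"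

definition real_edge :: "rat_edge \<Rightarrow> nat edge" where
  "real_edge = (\<lambda>(u, v, w). (u, v, of_rat w))"

definition network_of :: "mrtt_input \<Rightarrow> nat trip_network" where
  "network_of = (\<lambda>(n, E, Ts).
     \<lparr> nodes = {..<n}, edges = mset (map real_edge E), trips = map (map real_edge) Ts \<rparr>)"

definition enc_edge :: "rat_edge \<Rightarrow> bool list" where
  "enc_edge = (\<lambda>(u, v, w). enc_nat u @ enc_nat v @ enc_rat w)"

definition enc_input :: "mrtt_input \<Rightarrow> bool list" where
  "enc_input = (\<lambda>(n, E, Ts).
     enc_nat n @ enc_list enc_edge E @ enc_list (enc_list enc_edge) Ts)"

text \<open>The output lists the (rational) starting times of the trips. The maximum in
  \<^const>\<open>max_reachability\<close> ranges over all real temporalisations.\<close>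

definition poly_time_approximation :: "(nat \<Rightarrow> real) \<Rightarrow> tm \<Rightarrow> bool" where
  "poly_time_approximation r M \<longleftrightarrow> is_tm M \<and>
     (\<exists>p :: nat poly. \<forall>I. is_trip_network (network_of I) \<longrightarrow>
        (\<exists>ts :: rat list.
           length ts = length (trips (network_of I)) \<and>
           outputs_within M (poly p (length (enc_input I))) (enc_input I) (enc_list enc_rat ts) \<and>
           real (temporal_reachability (network_of I) (\<lambda>i. of_rat (ts ! i)))
             \<ge> 1 / r (card (nodes (network_of I))) * real (max_reachability (network_of I))))"

end

theory Submission
  imports Defs
begin

text \<open>
  Suppose that \<open>M\<close> approximates the problem, and let \<open>L\<close> be in NP. The computation of a verifier
  on an input \<open>x\<close> and a certificate of fixed length is described by variables (the control state
  and the stack symbols at each time) and clauses that forbid simultaneous values of at most three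
  variables. From these a trip network is built in which one node can reach another temporally iff
  there is an accepting computation: a path first walks, for each variable, along a chain of one of
  its values, then takes a bridge, and then crosses all clauses. A clause is crossed with the first
  edge of a trip whose last edge lies on the chain of one of the forbidden values, so it can only be
  crossed if the path did not use that chain. With \<open>K\<close> sources and \<open>K\<close> sinks attached to the ends,
  where \<open>K\<close> is a large power of the number of the other nodes, the two cases differ by a factor of
  more than \<open>r(n)\<close>. So if \<open>x\<close> is in \<open>L\<close>, the temporalisation returned by \<open>M\<close> lets a source reach a
  sink, and comparing its starting times with that of the bridge yields a certificate; it remains to
  run the verifier on it. Hence \<open>L\<close> is in P.

  Polynomial time is dealt with in a class of string functions that is closed under composition and
  bounded recursion on strings and whose members are computed by structured programs on finitely
  many stacks. A stack is a Turing machine tape, so these programs decide languages in P; conversely,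
  configurations of a Turing machine can be iterated within the class, so that it contains the
  functions computed by \<open>M\<close> and by the verifier. The clauses describe the computation of a stack
  program, because the content of a stack relative to its top changes only locally.
\<close>

section \<open>Programs on stacks\<close>

datatype prog =
    Skip
  | Push nat bool
  | Seq prog prog
  | Loop nat "bool \<Rightarrow> prog"

type_synonym store = "nat \<Rightarrow> bool list"

text \<open>\<open>Loop k B\<close> pops symbols \<open>c\<close> off the stack \<open>k\<close> and runs \<open>B c\<close> after each of them, until the
  stack is empty.\<close>

inductive exec_within :: "prog \<Rightarrow> store \<Rightarrow> nat \<Rightarrow> store \<Rightarrow> bool" where
  Skip: "exec_within Skip \<sigma> (Suc t) \<sigma>"
| Push: "exec_within (Push k c) \<sigma> (Suc t) (\<sigma>(k := c # \<sigma> k))"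
| Seq: "exec_within P \<sigma> t \<sigma>' \<Longrightarrow> exec_within Q \<sigma>' t' \<sigma>'' \<Longrightarrow>
    exec_within (Seq P Q) \<sigma> (Suc (t + t')) \<sigma>''"
| Loop_Nil: "\<sigma> k = [] \<Longrightarrow> exec_within (Loop k B) \<sigma> (Suc t) \<sigma>"
| Loop_Cons: "\<sigma> k = c # w \<Longrightarrow> exec_within (B c) (\<sigma>(k := w)) t \<sigma>' \<Longrightarrow>
    exec_within (Loop k B) \<sigma>' t' \<sigma>'' \<Longrightarrow> exec_within (Loop k B) \<sigma> (Suc (t + t')) \<sigma>''"

lemma exec_within_mono: "exec_within P \<sigma> t \<sigma>' \<Longrightarrow> t \<le> s \<Longrightarrow> exec_within P \<sigma> s \<sigma>'"
proof (induction arbitrary: s rule: exec_within.induct)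
  case (Seq P \<sigma> t \<sigma>' Q t' \<sigma>'')
  then obtain r where "s = Suc (t + r)" "t' \<le> r"
    using le_Suc_ex[of "Suc (t + t')" s] by (metis add.assoc add_Suc le_add1)
  then show ?case using Seq by (auto intro: exec_within.Seq)
next
  case (Loop_Cons \<sigma> k c w B t \<sigma>' t' \<sigma>'')
  then obtain r where "s = Suc (t + r)" "t' \<le> r"
    using le_Suc_ex[of "Suc (t + t')" s] by (metis add.assoc add_Suc le_add1)
  then show ?case using Loop_Cons exec_within.Loop_Cons by blast
qed (auto dest!: Suc_le_D intro: exec_within.intros)

lemma exec_within_length: "exec_within P \<sigma> t \<sigma>' \<Longrightarrow> length (\<sigma>' k) \<le> length (\<sigma> k) + t"
proof (induction arbitrary: k rule: exec_within.induct)
  case (Seq P \<sigma> t \<sigma>' Q t' \<sigma>'')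
  show ?case using Seq.IH(1)[of k] Seq.IH(2)[of k] by linarith
next
  case (Loop_Cons \<sigma> j c w B t \<sigma>' t' \<sigma>'')
  have "length ((\<sigma>(j := w)) k) \<le> length (\<sigma> k)" using Loop_Cons.hyps(1) by auto
  then show ?case using Loop_Cons.IH(1)[of k] Loop_Cons.IH(2)[of k] by linarith
qed auto

lemma exec_within_Skip: "exec_within Skip \<sigma> 1 \<sigma>"
  unfolding One_nat_def by (rule exec_within.Skip)

lemma exec_within_Push: "\<sigma>' = \<sigma>(k := c # \<sigma> k) \<Longrightarrow> exec_within (Push k c) \<sigma> 1 \<sigma>'"
  unfolding One_nat_def by (simp only: exec_within.Push)

lemma exec_within_Loop:
  assumes step: "\<And>u c v. w = u @ c # v \<Longrightarrow>
      exec_within (B c) ((F u)(k := v)) t ((F (u @ [c]))(k := v))"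
  shows "exec_within (Loop k B) ((F [])(k := w)) (length w * Suc t + 1) ((F w)(k := []))"
proof -
  have "w = u @ v \<Longrightarrow> exec_within (Loop k B) ((F u)(k := v)) (length v * Suc t + 1) ((F w)(k := []))"
    for u v
  proof (induction v arbitrary: u)
    case Nil
    then show ?case by (simp add: exec_within.Loop_Nil)
  next
    case (Cons c v)
    have "exec_within (B c) (((F u)(k := c # v))(k := v)) t ((F (u @ [c]))(k := v))"
      using step[OF Cons.prems] by simp
    moreover have "exec_within (Loop k B) ((F (u @ [c]))(k := v)) (length v * Suc t + 1)
        ((F w)(k := []))"
      by (rule Cons.IH) (simp add: Cons.prems)
    ultimately have "exec_within (Loop k B) ((F u)(k := c # v)) (Suc (t + (length v * Suc t + 1)))
        ((F w)(k := []))"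
      by (intro exec_within.Loop_Cons) simp_all
    then show ?case by (rule exec_within_mono) simp
  qed
  from this[of "[]" w] show ?thesis by simp
qed

definition pour :: "nat \<Rightarrow> nat \<Rightarrow> prog" where
  "pour r d = Loop r (Push d)"

definition pour_both :: "nat \<Rightarrow> nat \<Rightarrow> nat \<Rightarrow> prog" where
  "pour_both r d d' = Loop r (\<lambda>c. Seq (Push d c) (Push d' c))"

definition clear :: "nat \<Rightarrow> prog" where
  "clear r = Loop r (\<lambda>c. Skip)"

definition move_via :: "nat \<Rightarrow> nat \<Rightarrow> nat \<Rightarrow> prog" where
  "move_via h r d = Seq (pour r h) (pour h d)"

primrec clear_range :: "nat \<Rightarrow> nat \<Rightarrow> prog" where
  "clear_range b 0 = Skip"
| "clear_range b (Suc n) = Seq (clear_range b n) (clear (b + n))"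

lemma exec_within_pour:
  assumes "r \<noteq> d" "\<sigma>' = \<sigma>(r := [], d := rev (\<sigma> r) @ \<sigma> d)"
  shows "exec_within (pour r d) \<sigma> (2 * length (\<sigma> r) + 1) \<sigma>'"
proof -
  let ?F = "\<lambda>u. \<sigma>(d := rev u @ \<sigma> d)"
  have "exec_within (Loop r (Push d)) ((?F [])(r := \<sigma> r)) (length (\<sigma> r) * Suc 1 + 1)
      ((?F (\<sigma> r))(r := []))"
    by (intro exec_within_Loop exec_within_Push) (use assms(1) in \<open>auto simp: fun_eq_iff\<close>)
  moreover have "(?F [])(r := \<sigma> r) = \<sigma>" "(?F (\<sigma> r))(r := []) = \<sigma>'" using assms by auto
  ultimately have "exec_within (pour r d) \<sigma> (length (\<sigma> r) * Suc 1 + 1) \<sigma>'" by (simp only: pour_def)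
  then show ?thesis by (rule exec_within_mono) simp
qed

lemma exec_within_pour_both:
  assumes "distinct [r, d, d']" "\<sigma>' = \<sigma>(r := [], d := rev (\<sigma> r) @ \<sigma> d, d' := rev (\<sigma> r) @ \<sigma> d')"
  shows "exec_within (pour_both r d d') \<sigma> (4 * length (\<sigma> r) + 1) \<sigma>'"
proof -
  let ?F = "\<lambda>u. \<sigma>(d := rev u @ \<sigma> d, d' := rev u @ \<sigma> d')"
  have "exec_within (Loop r (\<lambda>c. Seq (Push d c) (Push d' c))) ((?F [])(r := \<sigma> r))
      (length (\<sigma> r) * Suc (Suc (1 + 1)) + 1) ((?F (\<sigma> r))(r := []))"
    by (intro exec_within_Loop exec_within.Seq[OF exec_within_Push[OF refl] exec_within_Push])
      (use assms(1) in \<open>auto simp: fun_eq_iff\<close>)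
  moreover have "(?F [])(r := \<sigma> r) = \<sigma>" "(?F (\<sigma> r))(r := []) = \<sigma>'" using assms by auto
  ultimately have "exec_within (pour_both r d d') \<sigma> (length (\<sigma> r) * Suc (Suc (1 + 1)) + 1) \<sigma>'"
    by (simp only: pour_both_def)
  then show ?thesis by (rule exec_within_mono) simp
qed

lemma exec_within_move_via:
  assumes "distinct [h, r, d]" "\<sigma> h = []" "\<sigma>' = \<sigma>(r := [], d := \<sigma> r @ \<sigma> d)"
  shows "exec_within (move_via h r d) \<sigma> (4 * length (\<sigma> r) + 3) \<sigma>'"
proof -
  let ?s = "\<sigma>(r := [], h := rev (\<sigma> r))"
  have "exec_within (pour r h) \<sigma> (2 * length (\<sigma> r) + 1) ?s"
    by (rule exec_within_pour) (use assms in auto)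
  moreover have "exec_within (pour h d) ?s (2 * length (?s h) + 1) \<sigma>'"
    by (rule exec_within_pour) (use assms in \<open>auto simp: fun_eq_iff\<close>)
  ultimately have "exec_within (move_via h r d) \<sigma>
      (Suc (2 * length (\<sigma> r) + 1 + (2 * length (?s h) + 1))) \<sigma>'"
    unfolding move_via_def by (rule exec_within.Seq)
  then show ?thesis by (rule exec_within_mono) simp
qed

lemma exec_within_clear:
  assumes "\<sigma>' = \<sigma>(r := [])"
  shows "exec_within (clear r) \<sigma> (2 * length (\<sigma> r) + 1) \<sigma>'"
proof -
  have "exec_within (Loop r (\<lambda>c. Skip)) (\<sigma>(r := \<sigma> r)) (length (\<sigma> r) * Suc 1 + 1) (\<sigma>(r := []))"
    by (intro exec_within_Loop exec_within_Skip)
  then have "exec_within (clear r) \<sigma> (length (\<sigma> r) * Suc 1 + 1) \<sigma>'" by (simp add: clear_def assms)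
  then show ?thesis by (rule exec_within_mono) simp
qed

lemma exec_within_clear_range:
  assumes "\<And>k. b \<le> k \<Longrightarrow> k < b + n \<Longrightarrow> length (\<sigma> k) \<le> L"
  shows "exec_within (clear_range b n) \<sigma> (n * (2 * L + 2) + 1) 
    (\<lambda>k. if k \<in> {b..<b + n} then [] else \<sigma> k)"
  using assms
proof (induction n)
  case 0
  then show ?case by (simp add: exec_within.Skip)
next
  case (Suc n)
  let ?s = "\<lambda>k. if k \<in> {b..<b + n} then [] else \<sigma> k"
  have "exec_within (clear_range b (Suc n)) \<sigma>
      (Suc (n * (2 * L + 2) + 1 + (2 * length (?s (b + n)) + 1)))
      (\<lambda>k. if k \<in> {b..<b + Suc n} then [] else \<sigma> k)"
    unfolding clear_range.simps
    by (rule exec_within.Seq[OF Suc.IH exec_within_clear])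
      (use Suc.prems in \<open>auto simp: fun_eq_iff\<close>)
  moreover have "length (?s (b + n)) \<le> L" using Suc.prems[of "b + n"] by simp
  ultimately show ?case by (elim exec_within_mono) simp
qed


section \<open>Polynomial-time functions on strings\<close>

definition arg :: "nat \<Rightarrow> bool list list \<Rightarrow> bool list" where
  "arg i e = (if i < length e then e ! i else [])"

lemma arg_Cons_0 [simp]: "arg 0 (w # e) = w"
  and arg_Cons_Suc [simp]: "arg (Suc i) (w # e) = arg i e"
  and arg_tl [simp]: "arg i (tl e) = arg (Suc i) e"
  by (auto simp: arg_def nth_tl)

lemma arg_numeral [simp]: "arg (numeral i) (w # e) = arg (pred_numeral i) e"
  by (simp add: numeral_eq_Suc)

text \<open>Because of the summand 2, a sum of two powers of the size is at most a power of the size.\<close>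

definition arg_size :: "bool list list \<Rightarrow> nat" where
  "arg_size e = sum_list (map length e) + 2"

lemma arg_size_Cons [simp]: "arg_size (w # e) = length w + arg_size e"
  by (simp add: arg_size_def)

lemma two_le_arg_size: "2 \<le> arg_size e"
  by (simp add: arg_size_def)

lemma length_arg_le_arg_size: "length (arg i e) \<le> arg_size e"
  by (auto simp: arg_def arg_size_def intro: le_trans[OF member_le_sum_list[of _ "map length e"]])

definition poly_bounded :: "nat \<Rightarrow> (bool list list \<Rightarrow> nat) \<Rightarrow> bool" where
  "poly_bounded m T \<longleftrightarrow> (\<exists>c. \<forall>e. length e = m \<longrightarrow> T e \<le> arg_size e ^ c)"

lemma poly_bounded_mono:
  "poly_bounded m T \<Longrightarrow> (\<And>e. length e = m \<Longrightarrow> S e \<le> T e) \<Longrightarrow> poly_bounded m S"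
  unfolding poly_bounded_def by (meson le_trans)

lemma poly_bounded_arg_size: "poly_bounded m arg_size"
  unfolding poly_bounded_def by (intro exI[of _ 1]) simp

lemma poly_bounded_length_arg: "poly_bounded m (\<lambda>e. length (arg i e))"
  by (rule poly_bounded_mono[OF poly_bounded_arg_size]) (rule length_arg_le_arg_size)

lemma poly_bounded_const: "poly_bounded m (\<lambda>e. k)"
proof -
  have "k \<le> arg_size e ^ k" for e
    using le_trans[OF less_imp_le[OF less_exp] power_mono[OF two_le_arg_size]] by simp
  then show ?thesis unfolding poly_bounded_def by blast
qed

lemma poly_bounded_mult:
  assumes "poly_bounded m S" "poly_bounded m T" shows "poly_bounded m (\<lambda>e. S e * T e)"
proof -
  obtain c d where "\<forall>e. length e = m \<longrightarrow> S e \<le> arg_size e ^ c"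
      "\<forall>e. length e = m \<longrightarrow> T e \<le> arg_size e ^ d"
    using assms unfolding poly_bounded_def by blast
  then have "\<forall>e. length e = m \<longrightarrow> S e * T e \<le> arg_size e ^ (c + d)"
    by (auto simp: power_add intro: mult_mono)
  then show ?thesis unfolding poly_bounded_def by blast
qed

lemma poly_bounded_add:
  assumes "poly_bounded m S" "poly_bounded m T" shows "poly_bounded m (\<lambda>e. S e + T e)"
proof -
  obtain c d where cd: "\<And>e. length e = m \<Longrightarrow> S e \<le> arg_size e ^ c"
      "\<And>e. length e = m \<Longrightarrow> T e \<le> arg_size e ^ d"
    using assms unfolding poly_bounded_def by blast
  have "S e + T e \<le> arg_size e ^ Suc (c + d)" if e: "length e = m" for e
  proof -
    have "1 \<le> arg_size e" using two_le_arg_size[of e] by simp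
    then have "arg_size e ^ c \<le> arg_size e ^ (c + d)" "arg_size e ^ d \<le> arg_size e ^ (c + d)"
      by (auto intro: power_increasing)
    then have "S e + T e \<le> 2 * arg_size e ^ (c + d)" using cd[OF e] by linarith
    also have "\<dots> \<le> arg_size e * arg_size e ^ (c + d)"
      using two_le_arg_size by (rule mult_right_mono) simp
    finally show ?thesis by simp
  qed
  then show ?thesis unfolding poly_bounded_def by blast
qed

lemma poly_bounded_Suc: "poly_bounded m S \<Longrightarrow> poly_bounded m (\<lambda>e. Suc (S e))"
  using poly_bounded_add[OF _ poly_bounded_const[of m 1]] by simp

lemma poly_bounded_power: "poly_bounded m S \<Longrightarrow> poly_bounded m (\<lambda>e. S e ^ k)"
  by (induction k) (simp_all add: poly_bounded_mult poly_bounded_const)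

lemmas poly_bounded_intros = poly_bounded_arg_size poly_bounded_length_arg poly_bounded_const
  poly_bounded_add poly_bounded_mult poly_bounded_power poly_bounded_Suc

lemma poly_bounded_sum_list:
  "(\<And>g. g \<in> set gs \<Longrightarrow> poly_bounded m g) \<Longrightarrow> poly_bounded m (\<lambda>e. \<Sum>g\<leftarrow>gs. g e)"
  by (induction gs) (auto intro: poly_bounded_intros)

lemma poly_bounded_comp:
  assumes T: "poly_bounded n T" and g: "poly_bounded m (\<lambda>e. arg_size (g e))"
    and len: "\<And>e. length e = m \<Longrightarrow> length (g e) = n"
  shows "poly_bounded m (\<lambda>e. T (g e))"
proof -
  obtain c where "\<forall>e. length e = n \<longrightarrow> T e \<le> arg_size e ^ c"
    using T unfolding poly_bounded_def by blast
  with len show ?thesis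
    by (intro poly_bounded_mono[OF poly_bounded_power[OF g, of c]]) blast
qed

text \<open>The program reads its arguments from the stacks \<open>rs\<close>, pushes the result on the stack \<open>d\<close> and
  may use the stacks from \<open>b\<close> on as scratch space, provided that it leaves them empty.\<close>

definition registers :: "nat \<Rightarrow> nat list \<Rightarrow> nat \<Rightarrow> nat \<Rightarrow> bool" where
  "registers m rs d b \<longleftrightarrow> length rs = m \<and> (\<forall>r\<in>set rs. r < b \<and> r \<noteq> d) \<and> d < b"

definition computes_within ::
    "nat list \<Rightarrow> nat \<Rightarrow> nat \<Rightarrow> (bool list list \<Rightarrow> bool list) \<Rightarrow> prog \<Rightarrow> (bool list list \<Rightarrow> nat) \<Rightarrow> bool"
  where "computes_within rs d b f P T \<longleftrightarrow> (\<forall>\<sigma>. (\<forall>k\<ge>b. \<sigma> k = []) \<longrightarrow>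
     exec_within P \<sigma> (T (map \<sigma> rs)) (\<sigma>(d := f (map \<sigma> rs) @ \<sigma> d)))"

definition polytime :: "nat \<Rightarrow> (bool list list \<Rightarrow> bool list) \<Rightarrow> bool" where
  "polytime m f \<longleftrightarrow> (\<forall>rs d b. registers m rs d b \<longrightarrow>
     (\<exists>P T. poly_bounded m T \<and> computes_within rs d b f P T))"

lemma polytimeI:
  assumes "\<And>rs d b. registers m rs d b \<Longrightarrow> \<exists>P T. poly_bounded m T \<and> computes_within rs d b f P T"
  shows "polytime m f"
  using assms by (simp add: polytime_def)

lemma polytimeE:
  assumes "polytime m f" "registers m rs d b"
  obtains P T where "poly_bounded m T" "\<And>\<sigma>. \<forall>k\<ge>b. \<sigma> k = [] \<Longrightarrow>
    exec_within P \<sigma> (T (map \<sigma> rs)) (\<sigma>(d := f (map \<sigma> rs) @ \<sigma> d))"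
  using assms unfolding polytime_def computes_within_def by meson

definition computes_scratch ::
    "nat list \<Rightarrow> nat \<Rightarrow> (bool list list \<Rightarrow> bool list) \<Rightarrow> prog \<Rightarrow> (bool list list \<Rightarrow> nat) \<Rightarrow> bool"
  where "computes_scratch rs b f P T \<longleftrightarrow> (\<forall>\<sigma>. (\<forall>k\<ge>b. \<sigma> k = []) \<longrightarrow>
     exec_within P \<sigma> (T (map \<sigma> rs)) (\<sigma>(b := f (map \<sigma> rs))))"

lemma computes_scratchD:
  "computes_scratch rs b f P T \<Longrightarrow> \<forall>k\<ge>b. \<sigma> k = [] \<Longrightarrow>
    exec_within P \<sigma> (T (map \<sigma> rs)) (\<sigma>(b := f (map \<sigma> rs)))"
  by (simp add: computes_scratch_def)

lemma polytime_scratchE: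
  assumes "polytime m f" "length rs = m" "\<forall>r\<in>set rs. r < b"
  obtains P T where "poly_bounded m T" "computes_scratch rs b f P T"
proof -
  have "registers m rs b (Suc b)" using assms(2,3) by (auto simp: registers_def)
  with assms(1) obtain P T where T: "poly_bounded m T" and P: "\<And>\<sigma>. \<forall>k\<ge>Suc b. \<sigma> k = [] \<Longrightarrow>
      exec_within P \<sigma> (T (map \<sigma> rs)) (\<sigma>(b := f (map \<sigma> rs) @ \<sigma> b))"
    by (rule polytimeE) blast
  have "exec_within P \<sigma> (T (map \<sigma> rs)) (\<sigma>(b := f (map \<sigma> rs)))" if "\<forall>k\<ge>b. \<sigma> k = []" for \<sigma>
    using P[of \<sigma>] that by simp
  then have "computes_scratch rs b f P T" by (simp add: computes_scratch_def)
  with T show thesis by (rule that)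
qed

lemma polytime_cong:
  assumes "polytime m f" "\<And>e. length e = m \<Longrightarrow> f e = g e"
  shows "polytime m g"
proof (rule polytimeI)
  fix rs d b assume r: "registers m rs d b"
  then have "f (map \<sigma> rs) = g (map \<sigma> rs)" for \<sigma> :: store
    by (intro assms(2)) (simp add: registers_def)
  with polytimeE[OF assms(1) r] show "\<exists>P T. poly_bounded m T \<and> computes_within rs d b g P T"
    unfolding computes_within_def by metis
qed

lemma poly_bounded_length:
  assumes "polytime m f" shows "poly_bounded m (\<lambda>e. length (f e))"
proof -
  have "registers m [1..<Suc m] 0 (Suc m)" by (auto simp: registers_def)
  with assms obtain P T where T: "poly_bounded m T" and
    P: "\<And>\<sigma>. \<forall>k\<ge>Suc m. \<sigma> k = [] \<Longrightarrow>
        exec_within P \<sigma> (T (map \<sigma> [1..<Suc m])) (\<sigma>(0 := f (map \<sigma> [1..<Suc m]) @ \<sigma> 0))"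
    by (rule polytimeE) blast
  have "length (f e) \<le> T e" if e: "length e = m" for e
  proof -
    define \<sigma> :: store where "\<sigma> k = arg k ([] # e)" for k
    have "map \<sigma> [1..<Suc m] = e"
      by (rule nth_equalityI) (auto simp: \<sigma>_def arg_def e simp del: upt_Suc)
    moreover have "\<forall>k\<ge>Suc m. \<sigma> k = []" by (simp add: \<sigma>_def arg_def e)
    ultimately have "exec_within P \<sigma> (T e) (\<sigma>(0 := f e @ \<sigma> 0))" using P[of \<sigma>] by simp
    from exec_within_length[OF this, of 0] show ?thesis by (simp add: \<sigma>_def)
  qed
  with T show ?thesis by (rule poly_bounded_mono)
qed

lemma polytime_const: "polytime m (\<lambda>e. w)"
proof (rule polytimeI)
  fix rs d b
  have "\<exists>P. \<forall>\<sigma>. exec_within P \<sigma> (2 * length w + 1) (\<sigma>(d := w @ \<sigma> d))"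
  proof (induction w)
    case Nil
    show ?case using exec_within_Skip by (intro exI[of _ Skip]) auto
  next
    case (Cons c w)
    then obtain P where P: "\<And>\<sigma>. exec_within P \<sigma> (2 * length w + 1) (\<sigma>(d := w @ \<sigma> d))" by blast
    have "exec_within (Seq P (Push d c)) \<sigma> (Suc (2 * length w + 1 + 1)) (\<sigma>(d := (c # w) @ \<sigma> d))"
      for \<sigma>
      by (rule exec_within.Seq[OF P exec_within_Push]) auto
    moreover have "Suc (2 * length w + 1 + 1) = 2 * length (c # w) + 1" by simp
    ultimately show ?case by metis
  qed
  then show "\<exists>P T. poly_bounded m T \<and> computes_within rs d b (\<lambda>e. w) P T"
    unfolding computes_within_def using poly_bounded_const by metis
qed

lemma polytime_arg: "polytime m (arg i)"
proof (cases "i < m")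
  case False
  then show ?thesis by (intro polytime_cong[OF polytime_const[of m "[]"]]) (simp add: arg_def)
next
  case True
  show ?thesis
  proof (rule polytimeI)
    fix rs d b assume r: "registers m rs d b"
    let ?r = "rs ! i" and ?P = "Seq (pour (rs ! i) b) (pour_both b (rs ! i) d)"
    let ?T = "\<lambda>e. Suc (2 * length (arg i e) + 1 + (4 * length (arg i e) + 1))"
    have rb: "?r < b" "?r \<noteq> d" "d < b" and i: "i < length rs"
      using r True by (auto simp: registers_def)
    have "exec_within ?P \<sigma> (?T (map \<sigma> rs)) (\<sigma>(d := arg i (map \<sigma> rs) @ \<sigma> d))"
      if \<sigma>: "\<forall>k\<ge>b. \<sigma> k = []" for \<sigma>
    proof -
      let ?s = "\<sigma>(?r := [], b := rev (\<sigma> ?r))"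
      have "exec_within (pour ?r b) \<sigma> (2 * length (\<sigma> ?r) + 1) ?s"
        by (rule exec_within_pour) (use rb \<sigma> in auto)
      moreover have "exec_within (pour_both b ?r d) ?s (4 * length (?s b) + 1) (\<sigma>(d := \<sigma> ?r @ \<sigma> d))"
        by (rule exec_within_pour_both) (use rb \<sigma> in \<open>auto simp: fun_eq_iff\<close>)
      ultimately have "exec_within ?P \<sigma> (Suc (2 * length (\<sigma> ?r) + 1 + (4 * length (?s b) + 1)))
          (\<sigma>(d := \<sigma> ?r @ \<sigma> d))"
        by (rule exec_within.Seq)
      then show ?thesis using i by (simp add: arg_def)
    qed
    moreover have "poly_bounded m ?T" by (intro poly_bounded_intros)
    ultimately show "\<exists>P T. poly_bounded m T \<and> computes_within rs d b (arg i) P T"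
      unfolding computes_within_def by blast
  qed
qed

lemma polytime_append:
  assumes "polytime m f" "polytime m g" shows "polytime m (\<lambda>e. f e @ g e)"
proof (rule polytimeI)
  fix rs d b assume r: "registers m rs d b"
  obtain P T where T: "poly_bounded m T" and P: "\<And>\<sigma>. \<forall>k\<ge>b. \<sigma> k = [] \<Longrightarrow>
      exec_within P \<sigma> (T (map \<sigma> rs)) (\<sigma>(d := f (map \<sigma> rs) @ \<sigma> d))"
    using assms(1) r by (rule polytimeE) blast
  obtain P' T' where T': "poly_bounded m T'" and P': "\<And>\<sigma>. \<forall>k\<ge>b. \<sigma> k = [] \<Longrightarrow>
      exec_within P' \<sigma> (T' (map \<sigma> rs)) (\<sigma>(d := g (map \<sigma> rs) @ \<sigma> d))"
    using assms(2) r by (rule polytimeE) blast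
  have "exec_within (Seq P' P) \<sigma> (Suc (T' (map \<sigma> rs) + T (map \<sigma> rs)))
      (\<sigma>(d := (f (map \<sigma> rs) @ g (map \<sigma> rs)) @ \<sigma> d))" if \<sigma>: "\<forall>k\<ge>b. \<sigma> k = []" for \<sigma>
  proof -
    let ?s = "\<sigma>(d := g (map \<sigma> rs) @ \<sigma> d)"
    have args: "map ?s rs = map \<sigma> rs" using r by (auto simp: registers_def)
    have "\<forall>k\<ge>b. ?s k = []" using \<sigma> r by (auto simp: registers_def)
    from exec_within.Seq[OF P'[OF \<sigma>] P[of ?s, OF this, unfolded args]] show ?thesis by simp
  qed
  moreover have "poly_bounded m (\<lambda>e. Suc (T' e + T e))" by (intro poly_bounded_intros T T')
  ultimately show "\<exists>P T. poly_bounded m T \<and> computes_within rs d b (\<lambda>e. f e @ g e) P T"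
    unfolding computes_within_def by blast
qed


subsection \<open>Composition\<close>

definition load :: "nat \<Rightarrow> bool list list \<Rightarrow> store \<Rightarrow> store" where
  "load b ws \<sigma> k = (if k \<in> {b..<b + length ws} then ws ! (k - b) else \<sigma> k)"

lemma load_Nil: "load b [] \<sigma> = \<sigma>"
  by (simp add: load_def fun_eq_iff)

lemma load_snoc: "(load b ws \<sigma>)(b + length ws := w) = load b (ws @ [w]) \<sigma>"
  by (auto simp: load_def fun_eq_iff nth_append)

lemma map_load_below: "\<forall>r\<in>set rs. r < b \<Longrightarrow> map (load b ws \<sigma>) rs = map \<sigma> rs"
  by (auto simp: load_def)

lemma map_load_range: "map (load b ws \<sigma>) [b..<b + length ws] = ws"
  by (rule nth_equalityI) (auto simp: load_def)

lemma ex_prog_load: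
  assumes "\<And>g. g \<in> set gs \<Longrightarrow> polytime m g" "length rs = m" "\<forall>r\<in>set rs. r < b"
  shows "\<exists>P T. poly_bounded m T \<and> (\<forall>\<sigma>. (\<forall>k\<ge>b. \<sigma> k = []) \<longrightarrow>
    exec_within P \<sigma> (T (map \<sigma> rs)) (load b (map (\<lambda>g. g (map \<sigma> rs)) gs) \<sigma>))"
  using assms
proof (induction gs rule: rev_induct)
  case Nil
  show ?case using poly_bounded_const[of m 1] exec_within_Skip
    by (intro exI[of _ Skip] exI[of _ "\<lambda>_. 1"]) (simp add: load_Nil)
next
  case (snoc g gs)
  then obtain P T where T: "poly_bounded m T" and P: "\<And>\<sigma>. \<forall>k\<ge>b. \<sigma> k = [] \<Longrightarrow>
      exec_within P \<sigma> (T (map \<sigma> rs)) (load b (map (\<lambda>g. g (map \<sigma> rs)) gs) \<sigma>)"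
    by auto
  let ?d = "b + length gs"
  have "polytime m g" "\<forall>r\<in>set rs. r < ?d" using snoc.prems by auto
  with snoc.prems(2) obtain P' T' where T': "poly_bounded m T'"
    and P': "computes_scratch rs ?d g P' T'"
    by (metis polytime_scratchE)
  have "exec_within (Seq P P') \<sigma> (Suc (T (map \<sigma> rs) + T' (map \<sigma> rs)))
      (load b (map (\<lambda>g. g (map \<sigma> rs)) (gs @ [g])) \<sigma>)" if \<sigma>: "\<forall>k\<ge>b. \<sigma> k = []" for \<sigma>
  proof -
    let ?ws = "map (\<lambda>g. g (map \<sigma> rs)) gs"
    have args: "map (load b ?ws \<sigma>) rs = map \<sigma> rs" by (rule map_load_below) (rule snoc.prems(3))
    have "\<forall>k\<ge>?d. load b ?ws \<sigma> k = []" using \<sigma> by (simp add: load_def)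
    from computes_scratchD[OF P' this, unfolded args]
    have "exec_within P' (load b ?ws \<sigma>) (T' (map \<sigma> rs)) (load b (?ws @ [g (map \<sigma> rs)]) \<sigma>)"
      by (simp add: load_snoc[of b ?ws, unfolded length_map])
    from exec_within.Seq[OF P[OF \<sigma>] this] show ?thesis by simp
  qed
  moreover have "poly_bounded m (\<lambda>e. Suc (T e + T' e))" by (intro poly_bounded_intros T T')
  ultimately show ?case by (intro exI[of _ "Seq P P'"] exI[of _ "\<lambda>e. Suc (T e + T' e)"]) blast
qed

lemma exec_within_load_call:
  assumes scratch: "\<forall>k\<ge>b. \<sigma> k = []" and d: "d < b"
    and P: "exec_within P \<sigma> t (load b ws \<sigma>)"
    and P': "exec_within P' (load b ws \<sigma>) t' ((load b ws \<sigma>)(d := w @ \<sigma> d))"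
  shows "exec_within (Seq P (Seq P' (clear_range b (length ws)))) \<sigma>
    (Suc (t + Suc (t' + (length ws * (2 * arg_size ws + 2) + 1)))) (\<sigma>(d := w @ \<sigma> d))"
proof -
  let ?s = "(load b ws \<sigma>)(d := w @ \<sigma> d)"
  have "length (?s k) \<le> arg_size ws" if "b \<le> k" "k < b + length ws" for k
    using that d length_arg_le_arg_size[of "k - b" ws]
    by (auto simp: load_def arg_def split: if_splits)
  then have "exec_within (clear_range b (length ws)) ?s (length ws * (2 * arg_size ws + 2) + 1)
      (\<lambda>k. if k \<in> {b..<b + length ws} then [] else ?s k)"
    by (rule exec_within_clear_range)
  moreover have "(\<lambda>k. if k \<in> {b..<b + length ws} then [] else ?s k) = \<sigma>(d := w @ \<sigma> d)"
    using scratch d by (auto simp: fun_eq_iff load_def)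
  ultimately show ?thesis by (metis exec_within.Seq[OF P exec_within.Seq[OF P']])
qed

lemma polytime_comp:
  assumes f: "polytime (length gs) f" and gs: "\<And>g. g \<in> set gs \<Longrightarrow> polytime m g"
  shows "polytime m (\<lambda>e. f (map (\<lambda>g. g e) gs))"
proof (rule polytimeI)
  fix rs d b assume r: "registers m rs d b"
  then have rb: "length rs = m" "\<forall>r\<in>set rs. r < b" "d < b" by (auto simp: registers_def)
  let ?n = "length gs" and ?M = "\<lambda>e. map (\<lambda>g. g e) gs"
  obtain P T where T: "poly_bounded m T" and P: "\<And>\<sigma>. \<forall>k\<ge>b. \<sigma> k = [] \<Longrightarrow>
      exec_within P \<sigma> (T (map \<sigma> rs)) (load b (?M (map \<sigma> rs)) \<sigma>)"
    using ex_prog_load[OF gs rb(1,2)] by blast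
  have "registers ?n [b..<b + ?n] d (b + ?n)" using rb(3) by (auto simp: registers_def)
  with f obtain P' T' where T': "poly_bounded ?n T'" and P': "\<And>\<sigma>. \<forall>k\<ge>b + ?n. \<sigma> k = [] \<Longrightarrow>
      exec_within P' \<sigma> (T' (map \<sigma> [b..<b + ?n])) (\<sigma>(d := f (map \<sigma> [b..<b + ?n]) @ \<sigma> d))"
    by (rule polytimeE) blast
  let ?T = "\<lambda>e. Suc (T e + Suc (T' (?M e) + (?n * (2 * arg_size (?M e) + 2) + 1)))"
  have "exec_within (Seq P (Seq P' (clear_range b ?n))) \<sigma> (?T (map \<sigma> rs))
      (\<sigma>(d := f (?M (map \<sigma> rs)) @ \<sigma> d))"
    if \<sigma>: "\<forall>k\<ge>b. \<sigma> k = []" for \<sigma>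
  proof -
    let ?ws = "?M (map \<sigma> rs)"
    have "map (load b ?ws \<sigma>) [b..<b + ?n] = ?ws" using map_load_range[of b ?ws \<sigma>] by simp
    moreover have "\<forall>k\<ge>b + ?n. load b ?ws \<sigma> k = []" "load b ?ws \<sigma> d = \<sigma> d"
      using \<sigma> rb(3) by (auto simp: load_def)
    ultimately have "exec_within P' (load b ?ws \<sigma>) (T' ?ws) ((load b ?ws \<sigma>)(d := f ?ws @ \<sigma> d))"
      using P'[of "load b ?ws \<sigma>"] by simp
    from exec_within_load_call[OF \<sigma> rb(3) P[OF \<sigma>] this] show ?thesis by simp
  qed
  moreover have "poly_bounded m ?T"
  proof -
    have "arg_size (?M e) = (\<Sum>g\<leftarrow>map (\<lambda>g e. length (g e)) gs. g e) + 2" for e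
      by (simp add: arg_size_def o_def)
    then have "poly_bounded m (\<lambda>e. arg_size (?M e))"
      by (simp only:)
        (intro poly_bounded_intros poly_bounded_sum_list, auto intro: poly_bounded_length gs)
    with poly_bounded_comp[OF T' this] show ?thesis by (intro poly_bounded_intros T) auto
  qed
  ultimately show "\<exists>P T. poly_bounded m T \<and> computes_within rs d b (\<lambda>e. f (?M e)) P T"
    unfolding computes_within_def by blast
qed

lemma polytime_comp1: "polytime 1 (\<lambda>e. F (arg 0 e)) \<Longrightarrow> polytime m f \<Longrightarrow> polytime m (\<lambda>e. F (f e))"
  using polytime_comp[of "[f]" "\<lambda>e. F (arg 0 e)" m] by simp

lemma polytime_comp2:
  "polytime 2 (\<lambda>e. F (arg 0 e) (arg 1 e)) \<Longrightarrow> polytime m f \<Longrightarrow> polytime m g \<Longrightarrow>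
    polytime m (\<lambda>e. F (f e) (g e))"
  using polytime_comp[of "[f, g]" "\<lambda>e. F (arg 0 e) (arg 1 e)" m] by (auto simp: numeral_2_eq_2)

lemma polytime_tl_args:
  assumes "polytime m f" shows "polytime (Suc m) (\<lambda>e. f (tl e))"
proof -
  let ?gs = "map (\<lambda>i. arg (Suc i)) [0..<m]"
  have "polytime (Suc m) (\<lambda>e. f (map (\<lambda>g. g e) ?gs))"
    by (rule polytime_comp) (use assms polytime_arg in auto)
  then show ?thesis
    by (rule polytime_cong) (auto intro!: arg_cong[of _ _ f] nth_equalityI simp: nth_tl arg_def)
qed

subsection \<open>Bounded recursion\<close>

text \<open>While the stack \<open>b + 1\<close> holds what is left of the reversed recursion argument, the stacks \<open>b\<close>
  and \<open>b + 2\<close> hold the suffix \<open>s\<close> that has been treated and the value at \<open>s\<close>.\<close>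

definition rec_step :: "nat \<Rightarrow> (bool \<Rightarrow> prog) \<Rightarrow> bool \<Rightarrow> prog" where
  "rec_step b G c =
      Seq (G c) (Seq (clear (b + 2)) (Seq (move_via (b + 4) (b + 3) (b + 2)) (Push b c)))"

definition rec_prog :: "nat \<Rightarrow> nat \<Rightarrow> prog \<Rightarrow> prog \<Rightarrow> (bool \<Rightarrow> prog) \<Rightarrow> prog" where
  "rec_prog b d N Z G = Seq N (Seq (pour b (b + 1)) (Seq Z (Seq (Loop (b + 1) (rec_step b G))
     (Seq (clear b) (move_via (b + 1) (b + 2) d)))))"

lemma exec_within_rec_step:
  assumes scratch: "\<forall>k\<ge>b. \<sigma> k = []"
    and G: "exec_within (G c) (\<sigma>(b := s, b + 1 := v, b + 2 := w)) t
        (\<sigma>(b := s, b + 1 := v, b + 2 := w, b + 3 := w'))"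
  shows "exec_within (rec_step b G c) (\<sigma>(b := s, b + 1 := v, b + 2 := w))
      (t + 2 * length w + 4 * length w' + 8)
    (\<sigma>(b := c # s, b + 1 := v, b + 2 := w'))"
proof -
  let ?s1 = "\<sigma>(b := s, b + 1 := v, b + 2 := w, b + 3 := w')"
  let ?s2 = "\<sigma>(b := s, b + 1 := v, b + 3 := w')"
  let ?s3 = "\<sigma>(b := s, b + 1 := v, b + 2 := w')"
  have clear: "exec_within (clear (b + 2)) ?s1 (2 * length (?s1 (b + 2)) + 1) ?s2"
    by (rule exec_within_clear) (use scratch in \<open>auto simp: fun_eq_iff\<close>)
  have move: "exec_within (move_via (b + 4) (b + 3) (b + 2)) ?s2 (4 * length (?s2 (b + 3)) + 3) ?s3"
    by (rule exec_within_move_via) (use scratch in \<open>auto simp: fun_eq_iff\<close>)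
  have push: "exec_within (Push b c) ?s3 1 (\<sigma>(b := c # s, b + 1 := v, b + 2 := w'))"
    by (rule exec_within_Push) (auto simp: fun_eq_iff)
  show ?thesis
    unfolding rec_step_def
    by (rule exec_within_mono[OF exec_within.Seq[OF G
      exec_within.Seq[OF clear exec_within.Seq[OF move push]]]]) simp
qed

lemma exec_within_rec_loop:
  assumes scratch: "\<forall>k\<ge>b. \<sigma> k = []"
    and G: "\<And>c s v. length s < length x \<Longrightarrow> exec_within (G c) (\<sigma>(b := s, b + 1 := v, b + 2 := R s)) t
        (\<sigma>(b := s, b + 1 := v, b + 2 := R s, b + 3 := R (c # s)))"
    and bound: "\<And>s. length s \<le> length x \<Longrightarrow> length (R s) \<le> u"
  shows "exec_within (Loop (b + 1) (rec_step b G)) (\<sigma>(b + 1 := rev x, b + 2 := R []))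
    (length x * (t + 6 * u + 9) + 1) (\<sigma>(b := x, b + 2 := R x))"
proof -
  let ?F = "\<lambda>v. \<sigma>(b := rev v, b + 2 := R (rev v))"
  have "exec_within (Loop (b + 1) (rec_step b G)) ((?F [])(b + 1 := rev x))
      (length (rev x) * Suc (t + 6 * u + 8) + 1) ((?F (rev x))(b + 1 := []))"
  proof (rule exec_within_Loop)
    fix v c v' assume v: "rev x = v @ c # v'"
    then have len: "length v < length x"
      by (metis length_append length_rev length_Cons less_add_Suc1 add_Suc_right)
    then have "length (R (rev v)) \<le> u" "length (R (c # rev v)) \<le> u" by (simp_all add: bound)
    moreover have "exec_within (rec_step b G c) (\<sigma>(b := rev v, b + 1 := v', b + 2 := R (rev v)))
        (t + 2 * length (R (rev v)) + 4 * length (R (c # rev v)) + 8)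
        (\<sigma>(b := c # rev v, b + 1 := v', b + 2 := R (c # rev v)))"
      by (rule exec_within_rec_step[OF scratch G]) (simp add: len)
    moreover have "\<sigma>(b := w, b + 1 := v', b + 2 := w') = \<sigma>(b := w, b + 2 := w', b + 1 := v')"
      for w w'
      by (simp add: fun_upd_twist)
    ultimately show "exec_within (rec_step b G c) ((?F v)(b + 1 := v')) (t + 6 * u + 8)
        ((?F (v @ [c]))(b + 1 := v'))"
      by (simp add: exec_within_mono)
  qed
  moreover have "(?F [])(b + 1 := rev x) = \<sigma>(b + 1 := rev x, b + 2 := R [])"
    "(?F (rev x))(b + 1 := []) = \<sigma>(b := x, b + 2 := R x)"
    using scratch by (auto simp: fun_eq_iff)
  moreover have "Suc (t + 6 * u + 8) = t + 6 * u + 9" by simp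
  ultimately show ?thesis by (simp only: length_rev)
qed

lemma exec_within_rec_prog:
  assumes scratch: "\<forall>k\<ge>b. \<sigma> k = []" and d: "d < b"
    and N: "exec_within N \<sigma> tN (\<sigma>(b := x))"
    and Z: "exec_within Z (\<sigma>(b + 1 := rev x)) tZ (\<sigma>(b + 1 := rev x, b + 2 := R []))"
    and G: "\<And>c s v. length s < length x \<Longrightarrow> exec_within (G c) (\<sigma>(b := s, b + 1 := v, b + 2 := R s)) tG
        (\<sigma>(b := s, b + 1 := v, b + 2 := R s, b + 3 := R (c # s)))"
    and bound: "\<And>s. length s \<le> length x \<Longrightarrow> length (R s) \<le> u"
  shows "exec_within (rec_prog b d N Z G) \<sigma> (tN + tZ + length x * (tG + 6 * u + 13) + 4 * u + 11)
      (\<sigma>(d := R x @ \<sigma> d))"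
proof -
  have reverse: "exec_within (pour b (b + 1)) (\<sigma>(b := x)) (2 * length ((\<sigma>(b := x)) b) + 1)
      (\<sigma>(b + 1 := rev x))"
    by (rule exec_within_pour) (use scratch in \<open>auto simp: fun_eq_iff\<close>)
  have loop: "exec_within (Loop (b + 1) (rec_step b G)) (\<sigma>(b + 1 := rev x, b + 2 := R []))
      (length x * (tG + 6 * u + 9) + 1) (\<sigma>(b := x, b + 2 := R x))"
    using G bound by (rule exec_within_rec_loop[OF scratch])
  let ?s = "\<sigma>(b := x, b + 2 := R x)"
  have clear: "exec_within (clear b) ?s (2 * length (?s b) + 1) (\<sigma>(b + 2 := R x))"
    by (rule exec_within_clear) (use scratch in \<open>auto simp: fun_eq_iff\<close>)
  let ?s' = "\<sigma>(b + 2 := R x)"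
  have move: "exec_within (move_via (b + 1) (b + 2) d) ?s' (4 * length (?s' (b + 2)) + 3)
      (\<sigma>(d := R x @ \<sigma> d))"
    by (rule exec_within_move_via) (use scratch d in \<open>auto simp: fun_eq_iff\<close>)
  note exec_within.Seq[OF N exec_within.Seq[OF reverse exec_within.Seq[OF Z
    exec_within.Seq[OF loop exec_within.Seq[OF clear move]]]]]
  then show ?thesis
    unfolding rec_prog_def
    by (rule exec_within_mono) (use bound[of x] in \<open>simp add: algebra_simps\<close>)
qed

lemma ex_rec_bounds:
  fixes R :: "bool list list \<Rightarrow> bool list \<Rightarrow> bool list" and T :: "bool \<Rightarrow> bool list list \<Rightarrow> nat"
  assumes n: "poly_bounded m (\<lambda>e. length (n e))" and T: "\<And>c. poly_bounded (Suc (Suc m)) (T c)"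
    and B: "poly_bounded (Suc m) B"
    and bound: "\<And>e s. length e = m \<Longrightarrow> length s \<le> length (n e) \<Longrightarrow> length (R e s) \<le> B (s # e)"
  obtains U V where "poly_bounded m U" "poly_bounded m V"
    "\<And>e s. length e = m \<Longrightarrow> length s \<le> length (n e) \<Longrightarrow> length (R e s) \<le> U e"
    "\<And>c e s. length e = m \<Longrightarrow> length s \<le> length (n e) \<Longrightarrow> T c (R e s # s # e) \<le> V e"
proof -
  obtain i where i: "\<And>e. length e = Suc m \<Longrightarrow> B e \<le> arg_size e ^ i"
    using B unfolding poly_bounded_def by blast
  obtain j where j: "\<And>e. length e = Suc (Suc m) \<Longrightarrow> T False e + T True e \<le> arg_size e ^ j"
    using poly_bounded_add[OF T[of False] T[of True]] unfolding poly_bounded_def by blast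
  define U where "U e = (length (n e) + arg_size e) ^ i" for e
  define V where "V e = (U e + length (n e) + arg_size e) ^ j" for e
  have U: "length (R e s) \<le> U e" if "length e = m" "length s \<le> length (n e)" for e s
  proof -
    have "length (R e s) \<le> arg_size (s # e) ^ i" using bound[OF that] i[of "s # e"] that by simp
    also have "\<dots> \<le> U e" unfolding U_def by (rule power_mono) (use that in auto)
    finally show ?thesis .
  qed
  have "T c (R e s # s # e) \<le> V e" if "length e = m" "length s \<le> length (n e)" for c e s
  proof -
    have "T c (R e s # s # e) \<le> arg_size (R e s # s # e) ^ j"
      using j[of "R e s # s # e"] that by (cases c) auto
    also have "\<dots> \<le> V e" unfolding V_def by (rule power_mono) (use that U[OF that] in auto)
    finally show ?thesis .
  qed
  moreover have "poly_bounded m U" "poly_bounded m V"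
    unfolding V_def U_def by (intro poly_bounded_intros n)+
  ultimately show thesis using that U by blast
qed

lemma exec_within_rec_prog_args:
  assumes \<sigma>: "\<forall>k\<ge>b. \<sigma> k = []" and d: "d < b" and rs: "\<forall>r\<in>set rs. r < b" and e: "map \<sigma> rs = e"
    and N: "computes_scratch rs b n N TN" and Z: "computes_scratch rs (b + 2) z Z TZ"
    and G: "\<And>c. computes_scratch ((b + 2) # b # rs) (b + 3) (g c) (G c) (TG c)"
    and R: "R [] = z e" "\<And>c s. length s < length (n e) \<Longrightarrow> R (c # s) = g c (R s # s # e)"
    and u: "\<And>s. length s \<le> length (n e) \<Longrightarrow> length (R s) \<le> u"
    and v: "\<And>c s. length s \<le> length (n e) \<Longrightarrow> TG c (R s # s # e) \<le> v"
  shows "exec_within (rec_prog b d N Z G) \<sigma>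
    (TN e + TZ e + length (n e) * (v + 6 * u + 13) + 4 * u + 11) (\<sigma>(d := R (n e) @ \<sigma> d))"
proof (rule exec_within_rec_prog[OF \<sigma> d])
  have args: "map (\<sigma>(b := w, b + 1 := w', b + 2 := w'')) rs = e" "map (\<sigma>(b + 1 := w')) rs = e"
    for w w' w''
    using rs by (auto simp flip: e)
  show "exec_within N \<sigma> (TN e) (\<sigma>(b := n e))" using computes_scratchD[OF N \<sigma>] by (simp only: e)
  show "exec_within Z (\<sigma>(b + 1 := rev (n e))) (TZ e) (\<sigma>(b + 1 := rev (n e), b + 2 := R []))"
    using computes_scratchD[OF Z, of "\<sigma>(b + 1 := rev (n e))", unfolded args] \<sigma> R(1) by simp
  fix c and s w :: "bool list" assume s: "length s < length (n e)"
  let ?s = "\<sigma>(b := s, b + 1 := w, b + 2 := R s)"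
  have "map ?s ((b + 2) # b # rs) = R s # s # e" using args(1) by simp
  with computes_scratchD[OF G, of ?s c] \<sigma> R(2)[OF s, of c]
  have "exec_within (G c) ?s (TG c (R s # s # e)) (?s(b + 3 := R (c # s)))" by simp
  then show "exec_within (G c) ?s v (?s(b + 3 := R (c # s)))"
    by (rule exec_within_mono) (use v s in simp)
qed (rule u)

theorem polytime_rec:
  assumes n: "polytime m n" and z: "polytime m z" and g: "\<And>c. polytime (Suc (Suc m)) (g c)"
    and R_Nil: "\<And>e. length e = m \<Longrightarrow> R e [] = z e"
    and R_Cons: "\<And>e c s. length e = m \<Longrightarrow> length s < length (n e) \<Longrightarrow> R e (c # s) = g c (R e s # s # e)"
    and B: "poly_bounded (Suc m) B"
    and bound: "\<And>e s. length e = m \<Longrightarrow> length s \<le> length (n e) \<Longrightarrow> length (R e s) \<le> B (s # e)"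
  shows "polytime m (\<lambda>e. R e (n e))"
proof (rule polytimeI)
  fix rs d b assume "registers m rs d b"
  then have rs: "length rs = m" "\<forall>r\<in>set rs. r < b" and d: "d < b" by (auto simp: registers_def)
  obtain N TN where N: "poly_bounded m TN" "computes_scratch rs b n N TN"
    by (rule polytime_scratchE[OF n rs])
  obtain Z TZ where Z: "poly_bounded m TZ" "computes_scratch rs (b + 2) z Z TZ"
    by (rule polytime_scratchE[OF z rs(1), of "b + 2"]) (use rs(2) in \<open>auto intro: trans_less_add1\<close>)
  have "length ((b + 2) # b # rs) = Suc (Suc m)" "\<forall>r\<in>set ((b + 2) # b # rs). r < b + 3"
    using rs by auto
  then have "\<exists>P T. poly_bounded (Suc (Suc m)) T \<and>
      computes_scratch ((b + 2) # b # rs) (b + 3) (g c) P T" for c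
    by (rule polytime_scratchE[OF g]) blast
  then obtain G TG where TG: "\<And>c. poly_bounded (Suc (Suc m)) (TG c)"
    and G: "\<And>c. computes_scratch ((b + 2) # b # rs) (b + 3) (g c) (G c) (TG c)"
    by metis
  obtain U V where UV: "poly_bounded m U" "poly_bounded m V"
    and U: "\<And>e s. length e = m \<Longrightarrow> length s \<le> length (n e) \<Longrightarrow> length (R e s) \<le> U e"
    and V: "\<And>c e s. length e = m \<Longrightarrow> length s \<le> length (n e) \<Longrightarrow> TG c (R e s # s # e) \<le> V e"
    using bound by (rule ex_rec_bounds[OF poly_bounded_length[OF n] TG B]) (assumption | rule that)+
  let ?T = "\<lambda>e. TN e + TZ e + length (n e) * (V e + 6 * U e + 13) + 4 * U e + 11"
  have "exec_within (rec_prog b d N Z G) \<sigma> (?T (map \<sigma> rs))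
      (\<sigma>(d := R (map \<sigma> rs) (n (map \<sigma> rs)) @ \<sigma> d))" if "\<forall>k\<ge>b. \<sigma> k = []" for \<sigma>
  proof -
    have "length (map \<sigma> rs) = m" by (simp add: rs)
    then show ?thesis
      by (intro exec_within_rec_prog_args[OF that d rs(2) refl N(2) Z(2) G] R_Nil R_Cons U V)
  qed
  moreover have "poly_bounded m ?T"
    by (intro poly_bounded_intros poly_bounded_length[OF n] N(1) Z(1) UV)
  ultimately show "\<exists>P T. poly_bounded m T \<and> computes_within rs d b (\<lambda>e. R e (n e)) P T"
    unfolding computes_within_def by blast
qed


subsection \<open>Case distinction\<close>

lemma polytime_case:
  assumes n: "polytime m n" and z: "polytime m z" and g: "\<And>c. polytime (Suc m) (g c)"
  shows "polytime m (\<lambda>e. case n e of [] \<Rightarrow> z e | c # s \<Rightarrow> g c (s # e))"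
proof -
  let ?R = "\<lambda>e s. case s of [] \<Rightarrow> z e | c # s \<Rightarrow> g c (s # e)"
  obtain k where k: "\<And>e. length e = Suc m \<Longrightarrow> length (g False e) + length (g True e) \<le> arg_size e ^ k"
    using poly_bounded_add[OF g[THEN poly_bounded_length] g[THEN poly_bounded_length]]
    unfolding poly_bounded_def by blast
  have "length (?R e s) \<le> length (z (tl (s # e))) + arg_size (s # e) ^ k" if "length e = m" for e s
  proof (cases s)
    case (Cons c s')
    have "length (g c (s' # e)) \<le> arg_size (s' # e) ^ k" using k[of "s' # e"] that by (cases c) auto
    also have "\<dots> \<le> arg_size (s # e) ^ k" by (rule power_mono) (simp_all add: Cons)
    finally show ?thesis by (simp add: Cons)
  qed simp
  moreover have "poly_bounded (Suc m) (\<lambda>e. length (z (tl e)) + arg_size e ^ k)"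
    by (intro poly_bounded_intros poly_bounded_length polytime_tl_args z)
  ultimately show ?thesis
    by (intro polytime_rec[where R = ?R and g = "\<lambda>c e. g c (tl e)" and z = z]
        n z polytime_tl_args g) auto
qed

lemma polytime_Cons: "polytime m f \<Longrightarrow> polytime m (\<lambda>e. c # f e)"
  using polytime_append[OF polytime_const[of m "[c]"]] by fastforce

lemma polytime_tl:
  assumes "polytime m f" shows "polytime m (\<lambda>e. tl (f e))"
proof -
  have "polytime m (\<lambda>e. case f e of [] \<Rightarrow> [] | c # s \<Rightarrow> arg 0 (s # e))"
    by (rule polytime_case[where g = "\<lambda>c. arg 0"]) (intro assms polytime_const polytime_arg)+
  then show ?thesis by (rule polytime_cong) (auto split: list.splits)
qed

definition polytime_pred :: "nat \<Rightarrow> (bool list list \<Rightarrow> bool) \<Rightarrow> bool" where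
  "polytime_pred m Q \<longleftrightarrow> polytime m (\<lambda>e. [Q e])"

lemma polytime_if:
  assumes "polytime_pred m Q" "polytime m f" "polytime m g"
  shows "polytime m (\<lambda>e. if Q e then f e else g e)"
proof -
  let ?g = "\<lambda>c. if c then \<lambda>e. f (tl e) else (\<lambda>e. g (tl e))"
  have "polytime m (\<lambda>e. case [Q e] of [] \<Rightarrow> g e | c # s \<Rightarrow> ?g c (s # e))"
    by (rule polytime_case[where g = ?g])
      (auto intro: polytime_tl_args assms simp flip: polytime_pred_def)
  then show ?thesis by (rule polytime_cong) simp
qed

lemma polytime_pred_const: "polytime_pred m (\<lambda>e. c)"
  unfolding polytime_pred_def by (rule polytime_const)

lemma polytime_pred_if:
  "polytime_pred m P \<Longrightarrow> polytime_pred m Q \<Longrightarrow> polytime_pred m R \<Longrightarrow>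
    polytime_pred m (\<lambda>e. if P e then Q e else R e)"
  using polytime_if[of m P "\<lambda>e. [Q e]" "\<lambda>e. [R e]"]
  by (simp add: polytime_pred_def if_distrib[of "\<lambda>c. [c]"])

lemma polytime_pred_not: "polytime_pred m Q \<Longrightarrow> polytime_pred m (\<lambda>e. \<not> Q e)"
  using polytime_pred_if[OF _ polytime_pred_const[of m False] polytime_pred_const[of m True]]
  by (simp add: if_bool_eq_conj)

lemma polytime_pred_conj:
  "polytime_pred m P \<Longrightarrow> polytime_pred m Q \<Longrightarrow> polytime_pred m (\<lambda>e. P e \<and> Q e)"
  using polytime_pred_if[OF _ _ polytime_pred_const[of m False]] by (simp add: if_bool_eq_disj)

lemma polytime_pred_iff:
  "polytime_pred m P \<Longrightarrow> polytime_pred m Q \<Longrightarrow> polytime_pred m (\<lambda>e. P e = Q e)"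
proof -
  assume "polytime_pred m P" "polytime_pred m Q"
  then have "polytime_pred m (\<lambda>e. if P e then Q e else \<not> Q e)"
    by (intro polytime_pred_if polytime_pred_not)
  moreover have "(if P e then Q e else \<not> Q e) = (P e = Q e)" for e by simp
  ultimately show ?thesis by (simp only:)
qed

lemma polytime_pred_Nil:
  assumes "polytime m f" shows "polytime_pred m (\<lambda>e. f e = [])"
proof -
  have "polytime m (\<lambda>e. case f e of [] \<Rightarrow> [True] | c # s \<Rightarrow> [False])"
    by (intro polytime_case polytime_const assms)
  then show ?thesis unfolding polytime_pred_def by (rule polytime_cong) (auto split: list.splits)
qed

definition hd_bit :: "bool list \<Rightarrow> bool" where
  "hd_bit w = (case w of [] \<Rightarrow> False | c # _ \<Rightarrow> c)"

lemma hd_bit_simps [simp]: "hd_bit [] = False" "hd_bit (c # w) = c"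
  by (simp_all add: hd_bit_def)

lemma hd_bit_drop: "i < length w \<Longrightarrow> hd_bit (drop i w) = w ! i"
  by (simp add: Cons_nth_drop_Suc[symmetric])

lemma polytime_pred_hd_bit:
  assumes "polytime m f" shows "polytime_pred m (\<lambda>e. hd_bit (f e))"
proof -
  have "polytime m (\<lambda>e. case f e of [] \<Rightarrow> [False] | c # s \<Rightarrow> [c])"
    by (intro polytime_case polytime_const assms)
  then show ?thesis unfolding polytime_pred_def by (rule polytime_cong) (auto split: list.splits)
qed


subsection \<open>Unary numbers and loops\<close>

definition unary :: "nat \<Rightarrow> bool list" where
  "unary n = replicate n True"

lemma unary_simps [simp]: "unary 0 = []" "unary (Suc n) = True # unary n" "length (unary n) = n"
  by (simp_all add: unary_def)

lemma unary_add: "unary (m + n) = unary m @ unary n"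
  by (simp add: unary_def replicate_add)

definition polytime_nat :: "nat \<Rightarrow> (bool list list \<Rightarrow> nat) \<Rightarrow> bool" where
  "polytime_nat m h \<longleftrightarrow> polytime m (\<lambda>e. unary (h e))"

lemma poly_bounded_polytime_nat: "polytime_nat m f \<Longrightarrow> poly_bounded m f"
  using poly_bounded_length[of m "\<lambda>e. unary (f e)"] by (simp add: polytime_nat_def)

lemma polytime_nat_tl_args: "polytime_nat m f \<Longrightarrow> polytime_nat (Suc m) (\<lambda>e. f (tl e))"
  unfolding polytime_nat_def by (rule polytime_tl_args)

lemma polytime_nat_length:
  assumes "polytime m f" shows "polytime_nat m (\<lambda>e. length (f e))"
  unfolding polytime_nat_def
  by (rule polytime_rec[where n = f and z = "\<lambda>_. []" and
      g = "\<lambda>c e. True # arg 0 e" and B = arg_size])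
    (auto intro: assms polytime_const polytime_Cons polytime_arg poly_bounded_arg_size)

lemma polytime_nat_length_arg: "polytime_nat m (\<lambda>e. length (arg i e))"
  by (intro polytime_nat_length polytime_arg)

lemma polytime_nat_const: "polytime_nat m (\<lambda>e. k)"
  unfolding polytime_nat_def by (rule polytime_const)

lemma polytime_nat_add:
  "polytime_nat m f \<Longrightarrow> polytime_nat m g \<Longrightarrow> polytime_nat m (\<lambda>e. f e + g e)"
  unfolding polytime_nat_def unary_add by (rule polytime_append)

lemma polytime_nat_Suc: "polytime_nat m f \<Longrightarrow> polytime_nat m (\<lambda>e. Suc (f e))"
  using polytime_nat_add[OF _ polytime_nat_const[of m 1]] by simp

lemma polytime_nat_if:
  "polytime_pred m Q \<Longrightarrow> polytime_nat m f \<Longrightarrow> polytime_nat m g \<Longrightarrow>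
    polytime_nat m (\<lambda>e. if Q e then f e else g e)"
  unfolding polytime_nat_def if_distrib[of unary] by (rule polytime_if)

lemma polytime_funpow:
  assumes F: "polytime 1 (\<lambda>e. F (arg 0 e))" and len: "\<And>w. length (F w) \<le> length w"
    and n: "polytime_nat m n" and f: "polytime m f"
  shows "polytime m (\<lambda>e. (F ^^ n e) (f e))"
proof -
  have L: "length ((F ^^ k) w) \<le> length w" for k w
    by (induction k) (auto intro: le_trans[OF len])
  have "polytime m (\<lambda>e. (\<lambda>e s. (F ^^ length s) (f e)) e (unary (n e)))"
  proof (rule polytime_rec[where R = "\<lambda>e s. (F ^^ length s) (f e)" and z = f and g = "\<lambda>c e. F
      (arg 0 e)" and B = "\<lambda>e. length (f (tl e))"])
    show "polytime m (\<lambda>e. unary (n e))" using n by (simp add: polytime_nat_def)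
    show "polytime (Suc (Suc m)) (\<lambda>e. F (arg 0 e))" by (intro polytime_comp1[OF F] polytime_arg)
    show "poly_bounded (Suc m) (\<lambda>e. length (f (tl e)))"
      by (intro poly_bounded_length polytime_tl_args f)
  qed (use f L in auto)
  then show ?thesis by simp
qed

lemma polytime_drop:
  assumes "polytime_nat m n" "polytime m f" shows "polytime m (\<lambda>e. drop (n e) (f e))"
proof -
  have "polytime m (\<lambda>e. (tl ^^ n e) (f e))"
    by (rule polytime_funpow[OF polytime_tl[OF polytime_arg] _ assms]) simp
  moreover have "(tl ^^ k) w = drop k w" for k and w :: "bool list"
    by (induction k) (auto simp: drop_Suc tl_drop)
  ultimately show ?thesis by simp
qed

lemma polytime_nat_diff:
  "polytime_nat m f \<Longrightarrow> polytime_nat m g \<Longrightarrow> polytime_nat m (\<lambda>e. f e - g e)"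
  using polytime_drop[of m g "\<lambda>e. unary (f e)"] by (simp add: polytime_nat_def unary_def)

lemma polytime_pred_le:
  assumes "polytime_nat m f" "polytime_nat m g" shows "polytime_pred m (\<lambda>e. f e \<le> g e)"
  using polytime_pred_Nil[OF polytime_nat_diff[OF assms, unfolded polytime_nat_def]]
  by (simp add: unary_def)

lemma polytime_pred_less:
  "polytime_nat m f \<Longrightarrow> polytime_nat m g \<Longrightarrow> polytime_pred m (\<lambda>e. f e < g e)"
  unfolding not_le[symmetric] by (intro polytime_pred_not polytime_pred_le)

lemma polytime_pred_eq:
  "polytime_nat m f \<Longrightarrow> polytime_nat m g \<Longrightarrow> polytime_pred m (\<lambda>e. f e = g e)"
  unfolding eq_iff by (intro polytime_pred_conj polytime_pred_le)

lemma polytime_for: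
  assumes body: "polytime (Suc m) (\<lambda>e. body (length (arg 0 e)) (tl e))" and n: "polytime_nat m n"
  shows "polytime m (\<lambda>e. concat (map (\<lambda>i. body i e) [0..<n e]))"
proof -
  obtain k where k: "\<And>e. length e = Suc m \<Longrightarrow>
      length (body (length (arg 0 e)) (tl e)) \<le> arg_size e ^ k"
    using poly_bounded_length[OF body] unfolding poly_bounded_def by blast
  have bound: "length (concat (map (\<lambda>i. body i e) [0..<length s]))
      \<le> length s * arg_size (s # e) ^ k"
    if e: "length e = m" for e and s :: "bool list"
  proof -
    have "length (body i e) \<le> arg_size (s # e) ^ k" if "i < length s" for i
    proof -
      have "length (body i e) \<le> arg_size (unary i # e) ^ k" using k[of "unary i # e"] e by simp
      also have "\<dots> \<le> arg_size (s # e) ^ k" using that by (intro power_mono) auto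
      finally show ?thesis .
    qed
    then show ?thesis
      using sum_list_mono[of "[0..<length s]" "\<lambda>i. length (body i e)" "\<lambda>i. arg_size (s # e) ^ k"]
      by (simp add: length_concat o_def sum_list_triv)
  qed
  have "polytime m (\<lambda>e. (\<lambda>e s. concat (map (\<lambda>i. body i e) [0..<length s])) e (unary (n e)))"
  proof (rule polytime_rec[where R = "\<lambda>e s. concat (map (\<lambda>i. body i e) [0..<length s])" and
        z = "\<lambda>_. []" and g = "\<lambda>c e. arg 0 e @ body (length (arg 0 (tl e))) (tl (tl e))" and
        B = "\<lambda>e. length (arg 0 e) * arg_size e ^ k"])
    show "polytime m (\<lambda>e. unary (n e))" using n by (simp add: polytime_nat_def)
    show "polytime (Suc (Suc m)) (\<lambda>e. arg 0 e @ body (length (arg 0 (tl e))) (tl (tl e)))"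
      by (intro polytime_append polytime_arg polytime_tl_args[OF body])
    show "poly_bounded (Suc m) (\<lambda>e. length (arg 0 e) * arg_size e ^ k)"
      by (intro poly_bounded_intros)
  qed (use bound in \<open>auto intro: polytime_const\<close>)
  then show ?thesis by simp
qed

lemma concat_map_unary: "concat (map (\<lambda>i. unary (h i)) [0..<n]) = unary (\<Sum>i<n. h i)"
  by (induction n) (simp_all add: unary_add)

lemma polytime_nat_sum:
  "polytime_nat (Suc m) (\<lambda>e. h (length (arg 0 e)) (tl e)) \<Longrightarrow> polytime_nat m n \<Longrightarrow>
    polytime_nat m (\<lambda>e. \<Sum>i<n e. h i e)"
  using polytime_for[of m "\<lambda>i e. unary (h i e)" n] by (simp add: polytime_nat_def concat_map_unary)

lemma polytime_nat_mult:
  "polytime_nat m f \<Longrightarrow> polytime_nat m g \<Longrightarrow> polytime_nat m (\<lambda>e. f e * g e)"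
  using polytime_nat_sum[of m "\<lambda>i. g" f] polytime_nat_tl_args by simp

lemma polytime_nat_power: "polytime_nat m f \<Longrightarrow> polytime_nat m (\<lambda>e. f e ^ k)"
  by (induction k) (simp_all add: polytime_nat_mult polytime_nat_const)

lemma polytime_nat_poly: "polytime_nat m f \<Longrightarrow> polytime_nat m (\<lambda>e. poly p (f e))"
  by (induction p) (simp_all add: polytime_nat_mult polytime_nat_add polytime_nat_const)

lemma polytime_pred_all:
  assumes "polytime_pred (Suc m) (\<lambda>e. Q (length (arg 0 e)) (tl e))" "polytime_nat m n"
  shows "polytime_pred m (\<lambda>e. \<forall>i<n e. Q i e)"
proof -
  have "polytime_pred m (\<lambda>e. concat (map (\<lambda>i. if Q i e then [] else [True]) [0..<n e]) = [])"
    by (intro polytime_pred_Nil polytime_for polytime_if polytime_const assms)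
  moreover have "concat (map (\<lambda>i. if Q i e then [] else [True]) [0..<k]) = [] \<longleftrightarrow> (\<forall>i<k. Q i e)"
    for e k
    by (induction k) (auto simp: less_Suc_eq)
  ultimately show ?thesis by (simp only:)
qed

lemmas polytime_nat_intros = polytime_nat_const polytime_nat_length_arg polytime_nat_length
  polytime_nat_add polytime_nat_Suc polytime_nat_mult polytime_nat_diff polytime_nat_power
      polytime_nat_poly

lemmas polytime_intros = polytime_const polytime_arg polytime_append polytime_Cons polytime_tl
  polytime_drop polytime_if polytime_pred_const


subsection \<open>String functions\<close>

lemma polytime_rev: assumes "polytime m f" shows "polytime m (\<lambda>e. rev (f e))"
  by (rule polytime_rec[where n = f and z = "\<lambda>_. []" and g = "\<lambda>c e. arg 0 e @ [c]" and
      B = arg_size])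
    (auto intro: assms polytime_intros poly_bounded_arg_size)

lemma polytime_takeWhile: assumes "polytime m f" shows "polytime m (\<lambda>e. takeWhile Q (f e))"
proof (rule polytime_rec[where n = f and z = "\<lambda>_. []" and
      g = "\<lambda>c e. if Q c then c # arg 0 e else []" and B = arg_size])
  show "length (takeWhile Q s) \<le> arg_size (s # e)" for e s
    using length_takeWhile_le[of Q s] by (simp add: trans_le_add1)
  show "polytime (Suc (Suc m)) (\<lambda>e. if Q c then c # arg 0 e else [])" for c
    by (intro polytime_intros)
qed (auto intro: assms polytime_intros poly_bounded_arg_size)

lemma polytime_dropWhile: assumes "polytime m f" shows "polytime m (\<lambda>e. dropWhile Q (f e))"
proof (rule polytime_rec[where n = f and z = "\<lambda>_. []" and g = "\<lambda>c e. if Q c then arg 0 e else c #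
    arg 1 e" and B = arg_size])
  show "length (dropWhile Q s) \<le> arg_size (s # e)" for e s
    using length_dropWhile_le[of Q s] by (simp add: trans_le_add1)
  show "polytime (Suc (Suc m)) (\<lambda>e. if Q c then arg 0 e else c # arg 1 e)" for c
    by (intro polytime_intros)
qed (auto intro: assms polytime_intros poly_bounded_arg_size)

lemma polytime_zeros: assumes "polytime m f" shows "polytime m (\<lambda>e. replicate (length (f e)) False)"
  by (rule polytime_rec[where n = f and z = "\<lambda>_. []" and g = "\<lambda>c e. False # arg 0 e" and
      B = arg_size])
    (auto intro: assms polytime_intros poly_bounded_arg_size)

lemma enc_string_simps [simp]: "enc_string [] = [False]"
  "enc_string (c # s) = True # c # enc_string s"
  by (simp_all add: enc_string_def enc_list_def)

lemma length_enc_string [simp]: "length (enc_string s) = 2 * length s + 1"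
  by (induction s) auto

lemma polytime_enc_string: assumes "polytime m f" shows "polytime m (\<lambda>e. enc_string (f e))"
proof (rule polytime_rec[where n = f and z = "\<lambda>_. [False]" and g = "\<lambda>c e. True # c # arg 0 e" and
      B = "\<lambda>e. 2 * length (arg 0 e) + 1"])
  show "poly_bounded (Suc m) (\<lambda>e. 2 * length (arg 0 e) + 1)" by (intro poly_bounded_intros)
qed (auto intro!: assms polytime_Cons polytime_intros)

fun increment :: "bool list \<Rightarrow> bool list" where
  "increment [] = [True]"
| "increment (False # s) = True # s"
| "increment (True # s) = False # increment s"

lemma length_increment: "length (increment s) \<le> length s + 1"
  by (induction s rule: increment.induct) auto

lemma polytime_increment: assumes "polytime m f" shows "polytime m (\<lambda>e. increment (f e))"
proof (rule polytime_rec[where n = f and z = "\<lambda>_. [True]" and B = arg_size and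
      g = "\<lambda>c e. if c then False # arg 0 e else True # arg 1 e"])
  show "length (increment s) \<le> arg_size (s # e)" for e s
    using length_increment[of s] two_le_arg_size[of e] by simp
  show "increment (c # s) =
      (if c then False # arg 0 (increment s # s # e) else True # arg 1 (increment s # s # e))"
    for e c s by (cases c) auto
  show "polytime (Suc (Suc m)) (\<lambda>e. if c then False # arg 0 e else True # arg 1 e)" for c
    by (intro polytime_intros)
qed (auto intro: assms polytime_intros poly_bounded_arg_size)

lemma binary_0 [simp]: "binary 0 = []"
  by (simp add: binary.simps)

lemma binary_double: "n > 0 \<Longrightarrow> binary (2 * n) = False # binary n"
  and binary_Suc_double: "binary (Suc (2 * n)) = True # binary n"
  by (subst binary.simps, simp)+

lemma binary_Suc: "binary (Suc n) = increment (binary n)"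
proof (induction n rule: less_induct)
  case (less n)
  show ?case
  proof (cases "even n")
    case True
    then obtain k where "n = 2 * k" by (elim evenE)
    then show ?thesis
      using binary_Suc_double[of 0]
    by (cases "k = 0") (simp_all add: binary_double binary_Suc_double)
  next
    case False
    then obtain k where k: "n = Suc (2 * k)" by (auto elim: oddE)
    then have "binary (Suc k) = increment (binary k)" by (intro less) simp
    then show ?thesis using binary_double[of "Suc k"] by (simp add: k binary_Suc_double)
  qed
qed

lemma length_binary: "length (binary n) \<le> n"
  by (induction n) (use length_increment in \<open>auto simp: binary_Suc intro: le_trans\<close>)

lemma polytime_enc_nat: assumes "polytime_nat m f" shows "polytime m (\<lambda>e. enc_nat (f e))"
proof -
  have "polytime m (\<lambda>e. (\<lambda>e s. binary (length s)) e (unary (f e)))"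
  proof (rule polytime_rec[where R = "\<lambda>e s. binary (length s)" and z = "\<lambda>_. []" and
        g = "\<lambda>c e. increment (arg 0 e)" and B = arg_size])
    show "length (binary (length s)) \<le> arg_size (s # e)" for e and s :: "bool list"
      using length_binary[of "length s"] by simp
  qed (use assms in \<open>auto intro: polytime_increment polytime_intros poly_bounded_arg_size
      simp: polytime_nat_def binary_Suc\<close>)
  then show ?thesis unfolding enc_nat_def by (intro polytime_enc_string) simp
qed

definition enc_nats :: "nat list \<Rightarrow> bool list" where
  "enc_nats ns = concat (map (\<lambda>k. unary k @ [False]) ns)"

lemma enc_nats_simps [simp]: "enc_nats [] = []" "enc_nats (k # ns) = unary k @ False # enc_nats ns"
  "enc_nats (ms @ ns) = enc_nats ms @ enc_nats ns"
  by (simp_all add: enc_nats_def)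

lemma enc_nats_concat: "enc_nats (concat xss) = concat (map enc_nats xss)"
  by (induction xss) auto

lemma length_enc_nats: "length (enc_nats ns) = sum_list ns + length ns"
  by (induction ns) auto

definition nth_block :: "bool list \<Rightarrow> nat \<Rightarrow> nat" where
  "nth_block w i = length (takeWhile id (((\<lambda>w. tl (dropWhile id w)) ^^ i) w))"

lemma nth_block_enc_nats: "i < length ns \<Longrightarrow> nth_block (enc_nats ns) i = ns ! i"
proof (induction ns arbitrary: i)
  case (Cons k ns)
  have "dropWhile id (unary k @ False # s) = False # s"
      "takeWhile id (unary k @ False # s) = unary k" for s
    by (simp_all add: unary_def dropWhile_append3 takeWhile_tail)
  then show ?case using Cons
    by (cases i) (simp_all add: nth_block_def funpow_Suc_right del: funpow.simps(2))
qed simp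

lemma polytime_nat_nth_block:
  assumes "polytime m f" "polytime_nat m n" shows "polytime_nat m (\<lambda>e. nth_block (f e) (n e))"
proof -
  have "length (tl (dropWhile id w)) \<le> length w" for w :: "bool list"
    using length_dropWhile_le[of id w] by simp
  then show ?thesis
    unfolding nth_block_def
    by (intro polytime_nat_length polytime_takeWhile polytime_funpow[OF polytime_tl[OF
          polytime_dropWhile[OF polytime_arg]]] assms)
qed

definition skip_item :: "bool list \<Rightarrow> bool list" where
  "skip_item w = (if hd_bit w then drop 2 w else w)"

definition skip_string :: "bool list \<Rightarrow> bool list" where
  "skip_string w = tl ((skip_item ^^ length w) w)"

definition decode_string :: "bool list \<Rightarrow> bool list" where
  "decode_string w = concat (map (\<lambda>i.
     if hd_bit ((skip_item ^^ i) w) then [hd_bit (tl ((skip_item ^^ i) w))] else [])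
     [0..<length w])"

lemma skip_item_funpow: "(skip_item ^^ i) (enc_string x @ r) = enc_string (drop i x) @ r"
proof (induction i)
  case (Suc i)
  then show ?case
    by (cases "i < length x") (simp_all add: skip_item_def Cons_nth_drop_Suc[symmetric])
qed simp

lemma skip_string_enc_string [simp]: "skip_string (enc_string x @ r) = r"
  by (simp add: skip_string_def skip_item_funpow) (simp add: skip_item_def)

lemma concat_map_nth_if:
  "length x \<le> n \<Longrightarrow> concat (map (\<lambda>i. if i < length x then [x ! i] else []) [0..<n]) = x"
proof (induction n)
  case (Suc n)
  show ?case
  proof (cases "length x \<le> n")
    case False
    then have len: "length x = Suc n" using Suc.prems by simp
    have "map (\<lambda>i. if i < length x then [x ! i] else []) [0..<Suc n] =
        map (\<lambda>i. [x ! i]) [0..<Suc n]"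
      by (rule map_cong) (auto simp: len)
    then show ?thesis using map_nth[of x] by (simp only: concat_map_singleton len)
  qed (use Suc in simp)
qed simp

lemma decode_string_enc_string [simp]: "decode_string (enc_string x @ r) = x"
proof -
  let ?w = "enc_string x @ r"
  have "(if hd_bit ((skip_item ^^ i) ?w) then [hd_bit (tl ((skip_item ^^ i) ?w))] else []) =
      (if i < length x then [x ! i] else [])" for i
    by (cases "i < length x") (simp_all add: skip_item_funpow Cons_nth_drop_Suc[symmetric])
  then show ?thesis
    unfolding decode_string_def by (simp only: concat_map_nth_if) (simp add: concat_map_nth_if)
qed

lemma polytime_skip_item_funpow:
  "polytime_nat m n \<Longrightarrow> polytime m f \<Longrightarrow> polytime m (\<lambda>e. (skip_item ^^ n e) (f e))"
proof (rule polytime_funpow)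
  show "polytime 1 (\<lambda>e. skip_item (arg 0 e))"
    unfolding skip_item_def by (intro polytime_intros polytime_pred_hd_bit polytime_nat_const)
qed (simp add: skip_item_def)

lemma polytime_skip_string: "polytime m f \<Longrightarrow> polytime m (\<lambda>e. skip_string (f e))"
  unfolding skip_string_def by (intro polytime_tl polytime_skip_item_funpow polytime_nat_length)

lemma length_skip_string: "length (skip_string w) \<le> length w"
proof -
  have "length ((skip_item ^^ k) w) \<le> length w" for k
    by (induction k) (auto simp: skip_item_def)
  from this[of "length w"] show ?thesis by (simp add: skip_string_def)
qed

lemma polytime_decode_string: "polytime m f \<Longrightarrow> polytime m (\<lambda>e. decode_string (f e))"
proof (rule polytime_comp1[of decode_string])
  show "polytime 1 (\<lambda>e. decode_string (arg 0 e))"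
    unfolding decode_string_def
    by (intro polytime_for polytime_if polytime_pred_hd_bit[unfolded polytime_pred_def]
          polytime_pred_hd_bit polytime_nat_length_arg polytime_tl polytime_const; unfold arg_tl;
        intro polytime_skip_item_funpow polytime_nat_length_arg polytime_arg)
qed


subsection \<open>Comparing rational numbers\<close>

fun bin_val :: "bool list \<Rightarrow> nat" where
  "bin_val [] = 0"
| "bin_val (c # s) = of_bool c + 2 * bin_val s"

lemma bin_val_binary [simp]: "bin_val (binary n) = n"
proof (induction n rule: less_induct)
  case (less n)
  show ?case
  proof (cases "n = 0")
    case False
    then have "bin_val (binary (n div 2)) = n div 2" by (intro less) simp
    then show ?thesis using False by (subst binary.simps) (simp add: of_bool_def; presburger)
  qed simp
qed

lemma bin_val_append: "bin_val (s @ t) = bin_val s + 2 ^ length s * bin_val t"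
  by (induction s) auto

lemma bin_val_zeros [simp]: "bin_val (replicate n False) = 0"
  by (induction n) auto

lemma bin_val_less: "bin_val s < 2 ^ length s"
  by (induction s) (auto simp: of_bool_def)

lemma bin_val_take_Suc: "bin_val (take (Suc n) y) =
    bin_val (take n y) + 2 ^ n * of_bool (hd_bit (drop n y))"
  by (cases "n < length y") (simp_all add: take_Suc_conv_app_nth bin_val_append hd_bit_drop)

text \<open>Recursion on suffixes meets the end of a string first. Addition and comparison therefore run
  through the reversed first number \<open>s\<close>; the first symbol of \<open>add_rev y s\<close> is the carry.\<close>

fun add_rev :: "bool list \<Rightarrow> bool list \<Rightarrow> bool list" where
  "add_rev y [] = [False]"
| "add_rev y (c # s) = (let a = hd_bit (add_rev y s); d = hd_bit (drop (length s) y) in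
     (if c = d then c else a) # ((c = d) = a) # tl (add_rev y s))"

definition bin_add :: "bool list \<Rightarrow> bool list \<Rightarrow> bool list" where
  "bin_add x y = rev (add_rev y (rev (x @ replicate (length y) False)))"

lemma length_add_rev: "length (add_rev y s) = length s + 1"
  by (induction s) (auto simp: Let_def)

lemma bin_val_add_rev: "bin_val (rev (add_rev y s)) = bin_val (rev s) + bin_val (take (length s) y)"
proof (induction s)
  case (Cons c s)
  obtain a t where "add_rev y s = a # t" "length t = length s"
    using length_add_rev[of y s] by (cases "add_rev y s") auto
  then show ?case using Cons
    by (auto simp: bin_val_append bin_val_take_Suc Let_def algebra_simps split: if_splits)
qed simp

lemma bin_val_add: "bin_val (bin_add x y) = bin_val x + bin_val y"
  by (simp add: bin_add_def bin_val_add_rev bin_val_append)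

lemma length_bin_add: "length (bin_add x y) = length x + length y + 1"
  by (simp add: bin_add_def length_add_rev)

lemma polytime_bin_add:
  assumes "polytime m f" "polytime m g" shows "polytime m (\<lambda>e. bin_add (f e) (g e))"
proof (rule polytime_comp2[OF _ assms])
  let ?d = "\<lambda>e. hd_bit (drop (length (arg 1 e)) (arg 3 e))"
  have "polytime 2 (\<lambda>e. add_rev (arg 1 e) (rev (arg 0 e @ replicate (length (arg 1 e)) False)))"
  proof (rule polytime_rec[where R = "\<lambda>e. add_rev (arg 1 e)" and z = "\<lambda>_.
      [False]" and B = arg_size and
        g = "\<lambda>c e. (if ?d e = c then [c] else [hd_bit (arg 0 e)]) @
            [(?d e = c) = hd_bit (arg 0 e)] @ tl (arg 0 e)"])
    show "polytime (Suc (Suc 2)) (\<lambda>e. (if ?d e = c then [c] else [hd_bit (arg 0 e)]) @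
        [(?d e = c) = hd_bit (arg 0 e)] @ tl (arg 0 e))" for c
      unfolding polytime_pred_def[symmetric]
      by (intro polytime_append polytime_if polytime_tl polytime_const polytime_arg
            polytime_pred_def[THEN iffD1] polytime_pred_iff polytime_pred_hd_bit polytime_pred_const
            polytime_drop polytime_nat_length_arg)
    show "length (add_rev (arg 1 e) s) \<le> arg_size (s # e)" for e s
      using two_le_arg_size[of e] by (simp add: length_add_rev)
    show "polytime 2 (\<lambda>e. rev (arg 0 e @ replicate (length (arg 1 e)) False))"
      by (intro polytime_rev polytime_append polytime_zeros polytime_arg)
  qed (auto simp: Let_def intro: poly_bounded_arg_size polytime_const)
  then show "polytime 2 (\<lambda>e. bin_add (arg 0 e) (arg 1 e))"
    unfolding bin_add_def by (rule polytime_rev)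
qed

fun bin_mult :: "bool list \<Rightarrow> bool list \<Rightarrow> bool list" where
  "bin_mult y [] = []"
| "bin_mult y (c # s) = bin_add (False # bin_mult y s) (if c then y else [])"

lemma bin_val_mult: "bin_val (bin_mult y s) = bin_val y * bin_val s"
  by (induction s) (auto simp: bin_val_add algebra_simps)

lemma length_bin_mult: "length (bin_mult y s) \<le> length s * (length y + 2)"
  by (induction s) (auto simp: length_bin_add)

lemma polytime_bin_mult:
  assumes "polytime m f" "polytime m g" shows "polytime m (\<lambda>e. bin_mult (f e) (g e))"
proof (rule polytime_comp2[OF _ assms])
  show "polytime 2 (\<lambda>e. bin_mult (arg 0 e) (arg 1 e))"
  proof (rule polytime_rec[where R = "\<lambda>e. bin_mult (arg 0 e)" and n = "arg 1" and z = "\<lambda>_. []" and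
        B = "\<lambda>e. length (arg 0 e) * (length (arg 1 e) + 2)" and
        g = "\<lambda>c e. bin_add (False # arg 0 e) (if c then arg 2 e else [])"])
    show "polytime (Suc (Suc 2)) (\<lambda>e. bin_add (False # arg 0 e) (if c then arg 2 e else []))" for c
      by (intro polytime_bin_add polytime_intros)
    show "poly_bounded (Suc 2) (\<lambda>e. length (arg 0 e) * (length (arg 1 e) + 2))"
      by (intro poly_bounded_intros)
  qed (use length_bin_mult in \<open>auto intro: polytime_intros\<close>)
qed

lemma bin_val_rev_Cons_less_take_iff:
  "bin_val (rev (c # s)) < bin_val (take (length (c # s)) y) \<longleftrightarrow>
    (if hd_bit (drop (length s) y) = c then bin_val (rev s) < bin_val (take (length s) y) else \<not> c)"
proof -
  have "bin_val (rev s) < 2 ^ length s" using bin_val_less[of "rev s"] by simp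
  moreover have "bin_val (take (length s) y) < 2 ^ length s"
    by (rule less_le_trans[OF bin_val_less]) simp
  ultimately show ?thesis by (cases c) (auto simp: bin_val_append bin_val_take_Suc)
qed

lemma polytime_pred_bin_val_less:
  assumes "polytime m f" "polytime m g" shows "polytime_pred m (\<lambda>e. bin_val (f e) < bin_val (g e))"
  unfolding polytime_pred_def
proof (rule polytime_comp2[OF _ assms])
  let ?d = "\<lambda>e. hd_bit (drop (length (arg 1 e)) (arg 3 e))"
  have "polytime 2 (\<lambda>e. (\<lambda>s. [bin_val (rev s) < bin_val (take (length s) (arg 1 e))])
      (rev (arg 0 e @ replicate (length (arg 1 e)) False)))"
  proof (rule polytime_rec[where R = "\<lambda>e s. [bin_val (rev s)
      < bin_val (take (length s) (arg 1 e))]" and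
        z = "\<lambda>_. [False]" and B = "\<lambda>_. 1" and g = "\<lambda>c e. if ?d e = c then arg 0 e else [\<not> c]"])
    show "polytime (Suc (Suc 2)) (\<lambda>e. if ?d e = c then arg 0 e else [\<not> c])" for c
      by (intro polytime_if polytime_const polytime_arg polytime_pred_iff polytime_pred_hd_bit
            polytime_pred_const polytime_drop polytime_nat_length_arg)
    show "[bin_val (rev (c # s)) < bin_val (take (length (c # s)) (arg 1 e))] =
        (\<lambda>e. if ?d e = c then arg 0 e else [\<not> c])
            ([bin_val (rev s) < bin_val (take (length s) (arg 1 e))] # s # e)"
      for e c s unfolding bin_val_rev_Cons_less_take_iff by (simp add: numeral_3_eq_3)
    show "polytime 2 (\<lambda>e. rev (arg 0 e @ replicate (length (arg 1 e)) False))"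
      by (intro polytime_rev polytime_append polytime_zeros polytime_arg)
  qed (auto intro: polytime_const poly_bounded_const)
  then show "polytime 2 (\<lambda>e. [bin_val (arg 0 e) < bin_val (arg 1 e)])"
    by (simp add: bin_val_append)
qed

definition numer :: "bool list \<Rightarrow> bool list" where
  "numer w = decode_string (tl w)"

definition denom :: "bool list \<Rightarrow> bool list" where
  "denom w = decode_string (tl (skip_string (tl w)))"

definition enc_less :: "bool list \<Rightarrow> bool list \<Rightarrow> bool" where
  "enc_less v w = (if hd_bit v
     then if hd_bit w then bin_val (bin_mult (numer w) (denom v))
         < bin_val (bin_mult (numer v) (denom w)) else True
     else if hd_bit w then False
       else bin_val (bin_mult (numer v) (denom w)) < bin_val (bin_mult (numer w) (denom v)))"

lemma enc_less_enc_rat: "enc_less (enc_rat p @ r) (enc_rat q @ r') \<longleftrightarrow> p < q"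
proof -
  obtain a b c d where ab: "quotient_of p = (a, b)" and cd: "quotient_of q = (c, d)"
    by (meson surj_pair)
  have pos: "b > 0" "d > 0" using quotient_of_denom_pos ab cd by auto
  have v: "hd_bit (enc_rat p @ r) \<longleftrightarrow> a < 0" "bin_val (numer (enc_rat p @ r)) = nat \<bar>a\<bar>"
      "bin_val (denom (enc_rat p @ r)) = nat b"
    and w: "hd_bit (enc_rat q @ r') \<longleftrightarrow> c < 0" "bin_val (numer (enc_rat q @ r')) = nat \<bar>c\<bar>"
      "bin_val (denom (enc_rat q @ r')) = nat d"
    using pos by (simp_all add: enc_rat_def ab cd enc_int_def enc_nat_def numer_def denom_def)
  have prod: "nat x * nat y < nat u * nat z \<longleftrightarrow> x * y < u * z" if "0 \<le> x" "0 \<le> y"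
      "0 \<le> u" for x y u z :: int
    using that nat_less_eq_zless[of "x * y" "u * z"] by (simp add: nat_mult_distrib)
  have "p < q \<longleftrightarrow> a * d < c * b" using rat_less_code[of p q] ab cd by (simp add: mult.commute)
  moreover have "a * d < 0 \<longleftrightarrow> a < 0" "c * b < 0 \<longleftrightarrow> c < 0" using pos by (simp_all add: mult_less_0_iff)
  ultimately show ?thesis
    using prod[of "- c" b "- a" d] prod[of a d c b] pos
    unfolding enc_less_def bin_val_mult v w by (smt (verit) mult_minus_left nat_0_le)
qed

lemma polytime_pred_enc_less:
  "polytime m f \<Longrightarrow> polytime m g \<Longrightarrow> polytime_pred m (\<lambda>e. enc_less (f e) (g e))"
  unfolding enc_less_def numer_def denom_def
  by (intro polytime_pred_if polytime_pred_hd_bit polytime_pred_const polytime_pred_bin_val_less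
        polytime_bin_mult polytime_decode_string polytime_tl polytime_skip_string)

definition skip_rat :: "bool list \<Rightarrow> bool list" where
  "skip_rat w = skip_string (tl (skip_string (tl (tl w))))"

definition nth_rat :: "bool list \<Rightarrow> nat \<Rightarrow> bool list" where
  "nth_rat w i = tl ((skip_rat ^^ i) w)"

lemma skip_rat_enc_rat: "skip_rat (True # enc_rat q @ r) = r"
  by (cases "quotient_of q") (simp add: skip_rat_def enc_rat_def enc_int_def enc_nat_def)

lemma skip_rat_funpow: "i \<le> length ts \<Longrightarrow>
  (skip_rat ^^ i) (enc_list enc_rat ts) = enc_list enc_rat (drop i ts)"
proof (induction i)
  case (Suc i)
  then have "drop i ts = ts ! i # drop (Suc i) ts" by (simp add: Cons_nth_drop_Suc)
  then show ?case using Suc skip_rat_enc_rat[of "ts ! i"] by (simp add: enc_list_def)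
qed simp

lemma nth_rat_enc_list:
  "i < length ts \<Longrightarrow> nth_rat (enc_list enc_rat ts) i = enc_rat (ts ! i) @
      enc_list enc_rat (drop (Suc i) ts)"
  by (simp add: nth_rat_def skip_rat_funpow) (simp add: enc_list_def Cons_nth_drop_Suc[symmetric])

lemma polytime_nth_rat:
  assumes "polytime m f" "polytime_nat m n" shows "polytime m (\<lambda>e. nth_rat (f e) (n e))"
proof -
  have "polytime 1 (\<lambda>e. skip_rat (arg 0 e))"
    unfolding skip_rat_def by (intro polytime_skip_string polytime_tl polytime_arg)
  moreover have "length (skip_rat w) \<le> length w" for w
    using length_skip_string[of "tl (skip_string (tl (tl w)))"] length_skip_string[of "tl (tl w)"]
    by (simp add: skip_rat_def)
  ultimately show ?thesis unfolding nth_rat_def by (intro polytime_tl polytime_funpow assms)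
qed


section \<open>Stack machines\<close>

datatype stack_op = Nop | PushOp bool | PopOp

fun apply_op :: "stack_op \<Rightarrow> bool list \<Rightarrow> bool list" where
  "apply_op Nop w = w"
| "apply_op (PushOp c) w = c # w"
| "apply_op PopOp w = tl w"

lemma length_apply_op: "length (apply_op p w) \<le> Suc (length w)"
  by (cases p) auto

definition peek :: "bool list \<Rightarrow> bool option" where
  "peek w = (case w of [] \<Rightarrow> None | c # _ \<Rightarrow> Some c)"

lemma peek_simps [simp]: "peek [] = None" "peek (c # w) = Some c"
  by (simp_all add: peek_def)

record 'q stack_machine =
  stack_of :: "'q \<Rightarrow> nat"
  op_of :: "'q \<Rightarrow> stack_op"
  next_of :: "'q \<Rightarrow> bool option \<Rightarrow> 'q"

definition sm_step :: "'q stack_machine \<Rightarrow> 'q \<times> store \<Rightarrow> 'q \<times> store" where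
  "sm_step S = (\<lambda>(q, \<sigma>). (next_of S q (peek (\<sigma> (stack_of S q))),
     \<sigma>(stack_of S q := apply_op (op_of S q) (\<sigma> (stack_of S q)))))"

locale finite_stack_machine =
  fixes N Q :: nat and S :: "nat stack_machine" and h :: nat
  assumes halt_less: "h < Q" and op_of_halt: "op_of S h = Nop" and next_of_halt: "next_of S h a = h"
    and stack_of_less: "q < Q \<Longrightarrow> stack_of S q < N" and next_of_less: "q < Q \<Longrightarrow> next_of S q a < Q"
    and next_of_push: "q < Q \<Longrightarrow> op_of S q = PushOp c \<Longrightarrow> next_of S q a = next_of S q a'"
begin

lemma sm_halted: "(sm_step S ^^ t) (h, \<sigma>) = (h, \<sigma>)"
  by (induction t) (simp_all add: sm_step_def op_of_halt next_of_halt)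

end

lemma funpow_trans: "(f ^^ m) x = y \<Longrightarrow> (f ^^ n) y = z \<Longrightarrow> (f ^^ (m + n)) x = z"
  by (simp add: funpow_add add.commute[of m])


subsection \<open>Programs as stack machines\<close>

text \<open>The control state of a running program is the list of the programs still to be executed.
  Only finitely many such lists occur, because a loop re-creates its own continuation.\<close>

fun prog_stack :: "prog list \<Rightarrow> nat" where
  "prog_stack (Push k c # K) = k"
| "prog_stack (Loop k B # K) = k"
| "prog_stack K = 0"

fun prog_op :: "prog list \<Rightarrow> stack_op" where
  "prog_op (Push k c # K) = PushOp c"
| "prog_op (Loop k B # K) = PopOp"
| "prog_op K = Nop"

fun prog_next :: "prog list \<Rightarrow> bool option \<Rightarrow> prog list" where
  "prog_next [] a = []"
| "prog_next (Skip # K) a = K"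
| "prog_next (Push k c # K) a = K"
| "prog_next (Seq P Q # K) a = P # Q # K"
| "prog_next (Loop k B # K) a = (case a of None \<Rightarrow> K | Some c \<Rightarrow> B c # Loop k B # K)"

definition prog_machine :: "prog list stack_machine" where
  "prog_machine = \<lparr>stack_of = prog_stack, op_of = prog_op, next_of = prog_next\<rparr>"

lemma sm_step_prog_machine:
  "sm_step prog_machine (K, \<sigma>) = (prog_next K (peek (\<sigma> (prog_stack K))),
     \<sigma>(prog_stack K := apply_op (prog_op K) (\<sigma> (prog_stack K))))"
  by (simp add: sm_step_def prog_machine_def)

lemma prog_next_push: "prog_op K = PushOp c \<Longrightarrow> prog_next K a = prog_next K a'"
  by (cases K rule: prog_op.cases) auto

lemma exec_within_imp_prog_machine:
  "exec_within P \<sigma> t \<sigma>' \<Longrightarrow> \<exists>s\<le>t. (sm_step prog_machine ^^ s) (P # K, \<sigma>) = (K, \<sigma>')"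
proof (induction arbitrary: K rule: exec_within.induct)
  case (Seq P \<sigma> t \<sigma>' Q t' \<sigma>'')
  from Seq.IH(1)[of "Q # K"] Seq.IH(2)[of K] obtain s s' where
    s: "s \<le> t" "(sm_step prog_machine ^^ s) (P # Q # K, \<sigma>) = (Q # K, \<sigma>')" and
    s': "s' \<le> t'" "(sm_step prog_machine ^^ s') (Q # K, \<sigma>') = (K, \<sigma>'')" by blast
  have "(sm_step prog_machine ^^ 1) (Seq P Q # K, \<sigma>) = (P # Q # K, \<sigma>)"
    by (simp add: sm_step_prog_machine)
  from funpow_trans[OF this funpow_trans[OF s(2) s'(2)]] show ?case
    using s(1) s'(1) by (intro exI[of _ "1 + (s + s')"]) simp
next
  case (Loop_Cons \<sigma> k c w B t \<sigma>' t' \<sigma>'')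
  from Loop_Cons.IH(1)[of "Loop k B # K"] Loop_Cons.IH(2)[of K] obtain s s' where
    s: "s \<le> t" "(sm_step prog_machine ^^ s) (B c # Loop k B # K, \<sigma>(k := w)) = (Loop k B # K, \<sigma>')"
    and
    s': "s' \<le> t'" "(sm_step prog_machine ^^ s') (Loop k B # K, \<sigma>') = (K, \<sigma>'')" by blast
  have "(sm_step prog_machine ^^ 1) (Loop k B # K, \<sigma>) = (B c # Loop k B # K, \<sigma>(k := w))"
    using Loop_Cons.hyps(1) by (simp add: sm_step_prog_machine)
  from funpow_trans[OF this funpow_trans[OF s(2) s'(2)]] show ?case
    using s(1) s'(1) by (intro exI[of _ "1 + (s + s')"]) simp
qed (auto simp: sm_step_prog_machine fun_upd_idem intro!: exI[of _ "1::nat"])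

primrec continuations :: "prog \<Rightarrow> prog list \<Rightarrow> prog list set" where
  "continuations Skip = (\<lambda>K. {Skip # K})"
| "continuations (Push k c) = (\<lambda>K. {Push k c # K})"
| "continuations (Seq P Q) =
    (\<lambda>K. insert (Seq P Q # K) (continuations P (Q # K) \<union> continuations Q K))"
| "continuations (Loop k B) = (\<lambda>K. insert (Loop k B # K) (\<Union>c. continuations (B c) (Loop k B # K)))"

lemma finite_continuations: "finite (continuations P K)"
  by (induction P arbitrary: K) auto

lemma continuations_start: "P # K \<in> continuations P K"
  by (cases P) auto

lemma continuations_next:
  "K' \<in> continuations P K \<Longrightarrow> prog_next K' a \<in> insert K (continuations P K)"
proof (induction P arbitrary: K)
  case (Seq P Q)
  then show ?case using continuations_start[of P "Q # K"] continuations_start[of Q K] by fastforce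
next
  case (Loop k B)
  show ?case
  proof (cases "K' = Loop k B # K")
    case True
    then show ?thesis using continuations_start by (auto split: option.splits)
  next
    case False
    then obtain c where "K' \<in> continuations (B c) (Loop k B # K)" using Loop.prems by auto
    then have "prog_next K' a \<in> insert (Loop k B # K) (continuations (B c) (Loop k B # K))"
      using Loop.IH[of "B c"] by blast
    then show ?thesis by auto
  qed
qed auto

primrec stack_bound :: "prog \<Rightarrow> nat" where
  "stack_bound Skip = 0"
| "stack_bound (Push k c) = Suc k"
| "stack_bound (Seq P Q) = max (stack_bound P) (stack_bound Q)"
| "stack_bound (Loop k B) = max (Suc k) (max (stack_bound (B False)) (stack_bound (B True)))"

lemma continuations_stack:
  "K' \<in> continuations P K \<Longrightarrow> stack_bound P \<le> N \<Longrightarrow> 0 < N \<Longrightarrow> prog_stack K' < N"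
proof (induction P arbitrary: K)
  case (Loop k B)
  have "stack_bound (B c) \<le> N" for c using Loop.prems(2) by (cases c) auto
  then show ?case using Loop.prems by (auto intro: Loop.IH[OF rangeI])
qed auto

lemma ex_numbering_from:
  assumes "finite C" "a \<in> C"
  obtains \<phi> :: "'a \<Rightarrow> nat" where "bij_betw \<phi> C {..<card C}" "\<phi> a = 0"
proof -
  obtain f :: "'a \<Rightarrow> nat" where f: "bij_betw f (C - {a}) {0..<card (C - {a})}"
    using ex_bij_betw_finite_nat assms(1) by blast
  have C: "C = insert a (C - {a})" "card C = Suc (card (C - {a}))"
    using assms card_Suc_Diff1[OF assms] by auto
  let ?\<phi> = "\<lambda>x. if x = a then 0 else Suc (f x)"
  have "?\<phi> ` C = insert 0 (Suc ` f ` (C - {a}))" using assms(2) by (auto simp: image_iff)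
  also have "\<dots> = {..<card C}"
    using f C(2) by (simp add: bij_betw_def lessThan_Suc_eq_insert_0 atLeast0LessThan)
  finally have "bij_betw ?\<phi> C {..<card C}"
    using f by (auto simp: bij_betw_def inj_on_def)
  then show thesis by (rule that) simp
qed

theorem finite_stack_machine_of_prog:
  assumes "stack_bound P \<le> N" "0 < N"
  obtains Q S h where "finite_stack_machine N Q S h"
    "\<And>\<sigma> t \<sigma>'. exec_within P \<sigma> t \<sigma>' \<Longrightarrow> (sm_step S ^^ t) (0, \<sigma>) = (h, \<sigma>')"
proof -
  define C where "C = insert [] (continuations P [])"
  have C: "finite C" "[P] \<in> C" "[] \<in> C"
    by (simp_all add: C_def finite_continuations continuations_start)
  obtain \<phi> where \<phi>: "bij_betw \<phi> C {..<card C}" "\<phi> [P] = 0"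
    using ex_numbering_from[OF C(1,2)] by blast
  define K where "K = inv_into C \<phi>"
  have K: "K q \<in> C" "\<phi> (K q) = q" if "q < card C" for q
    using that \<phi>(1) unfolding K_def bij_betw_def by (simp_all add: inv_into_into f_inv_into_f)
  have K_\<phi>: "K (\<phi> L) = L" and \<phi>_less: "\<phi> L < card C" if "L \<in> C" for L
    using that \<phi>(1) unfolding K_def bij_betw_def by auto
  have next_in: "prog_next L a \<in> C" if "L \<in> C" for L a
    using that continuations_next[of L P "[]" a] by (auto simp: C_def)
  define S where "S = \<lparr>stack_of = \<lambda>q. prog_stack (K q), op_of = \<lambda>q. prog_op (K q),
      next_of = \<lambda>q a. \<phi> (prog_next (K q) a)\<rparr>"
  interpret S: finite_stack_machine N "card C" S "\<phi> []"
  proof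
    show "next_of S q a = next_of S q a'" if "op_of S q = PushOp c" for q a a' c
      using that prog_next_push[of "K q" c a a'] by (simp add: S_def)
    show "stack_of S q < N" if "q < card C" for q
      using K(1)[OF that] continuations_stack[OF _ assms, of "K q" "[]"] assms(2)
      by (auto simp: S_def C_def)
  qed (auto simp: S_def K_\<phi> C \<phi>_less next_in K(1))
  have step: "sm_step S (\<phi> L, \<sigma>) = (\<phi> (prog_next L (peek (\<sigma> (prog_stack L)))),
      \<sigma>(prog_stack L := apply_op (prog_op L) (\<sigma> (prog_stack L))))" if "L \<in> C" for L \<sigma>
    using that by (simp add: sm_step_def S_def K_\<phi>)
  have simulate: "L \<in> C \<Longrightarrow> (sm_step prog_machine ^^ t) (L, \<sigma>) = (L', \<sigma>') \<Longrightarrow>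
      (sm_step S ^^ t) (\<phi> L, \<sigma>) = (\<phi> L', \<sigma>')" for t L L' \<sigma> \<sigma>'
    by (induction t arbitrary: L \<sigma>)
      (auto simp: funpow_Suc_right sm_step_prog_machine step next_in simp del: funpow.simps(2))
  have "(sm_step S ^^ t) (0, \<sigma>) = (\<phi> [], \<sigma>')" if exec: "exec_within P \<sigma> t \<sigma>'" for \<sigma> t \<sigma>'
  proof -
    obtain s where s: "s \<le> t" "(sm_step prog_machine ^^ s) ([P], \<sigma>) = ([], \<sigma>')"
      using exec_within_imp_prog_machine[OF exec, of "[]"] by blast
    from funpow_trans[OF simulate[OF C(2) s(2)] S.sm_halted[of "t - s"]] show ?thesis
      using s(1) by (simp add: \<phi>(2))
  qed
  with S.finite_stack_machine_axioms show thesis by (rule that)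
qed


subsection \<open>Stack machines as Turing machines\<close>

definition cell :: "bool list \<Rightarrow> nat \<Rightarrow> nat" where
  "cell w i = (if i < length w then bit_symbol (w ! i) else 0)"

lemma cell_simps [simp]: "cell [] i = 0" "cell (c # w) 0 = bit_symbol c"
  "cell (c # w) (Suc i) = cell w i"
  by (auto simp: cell_def)

lemma cell_tl: "cell (tl w) i = cell w (Suc i)"
  by (cases w) auto

lemma bit_symbol_less [simp]: "bit_symbol c < 3"
  by (simp add: bit_symbol_def)

lemma bit_symbol_eq_iff [simp]: "bit_symbol c = bit_symbol d \<longleftrightarrow> c = d" "bit_symbol c \<noteq> 0"
  by (auto simp: bit_symbol_def)

lemma cell_less: "cell w i < 3"
  by (simp add: cell_def)

definition symbol_bit :: "nat \<Rightarrow> bool option" where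
  "symbol_bit s = (if s = 0 then None else Some (s = 2))"

lemma symbol_bit_cell: "symbol_bit (cell w 0) = peek w"
  by (cases w) (auto simp: symbol_bit_def bit_symbol_def)

definition tape_holds :: "tape \<Rightarrow> bool list \<Rightarrow> bool" where
  "tape_holds T w \<longleftrightarrow> (\<forall>i::nat. fst T (snd T + int i) = cell w i)"

lemma read_tape_holds: "tape_holds T w \<Longrightarrow> read_tape T = cell w 0"
  by (auto simp: tape_holds_def read_tape_def dest: spec[of _ 0])

lemma act_read_Stay [simp]: "act (read_tape T, Stay) T = T"
  by (simp add: act_def read_tape_def)

lemma tape_holds_push:
  assumes "tape_holds T w"
  shows "tape_holds (act (bit_symbol c, Stay) (act (read_tape T, MoveLeft) T)) (c # w)"
  unfolding tape_holds_def
proof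
  fix i
  show "fst (act (bit_symbol c, Stay) (act (read_tape T, MoveLeft) T))
       (snd (act (bit_symbol c, Stay) (act (read_tape T, MoveLeft) T)) + int i) = cell (c # w) i"
    using assms[unfolded tape_holds_def, rule_format, of "i - 1"]
    by (cases i) (auto simp: act_def read_tape_def)
qed

lemma tape_holds_pop:
  assumes "tape_holds T w"
  shows "tape_holds (act (0, MoveRight) T) (tl w)"
  unfolding tape_holds_def
proof
  fix i
  show "fst (act (0, MoveRight) T) (snd (act (0, MoveRight) T) + int i) = cell (tl w) i"
    using assms[unfolded tape_holds_def, rule_format, of "Suc i"]
    by (simp add: cell_tl act_def algebra_simps)
qed

lemma tm_halted: "fst c = states M \<Longrightarrow> (tm_step M ^^ t) c = c"
  by (induction t) (auto simp: tm_step_def)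

text \<open>Tape 1 is reserved for the output.\<close>

definition tape_of :: "nat \<Rightarrow> nat" where
  "tape_of k = (if k = 0 then 0 else Suc k)"

lemma tape_of_eq_iff [simp]: "tape_of k = tape_of l \<longleftrightarrow> k = l" "tape_of k \<noteq> Suc 0"
  by (auto simp: tape_of_def)

lemma tape_of_less: "k < n \<Longrightarrow> tape_of k < Suc n"
  by (auto simp: tape_of_def)

context finite_stack_machine
begin

text \<open>One step of the stack machine takes two steps of the Turing machine, because a push first moves
  the head to the left and then writes. The state \<open>2 * q\<close> is \<open>q\<close> before the first of them. The last
  step copies the top of stack 1 to the output tape.\<close>

definition first_action :: "nat \<Rightarrow> nat \<Rightarrow> nat \<Rightarrow> nat \<times> move" where
  "first_action q j s =
      (s, if j = tape_of (stack_of S q) \<and> (\<exists>c. op_of S q = PushOp c) then MoveLeft else Stay)"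

definition second_action :: "nat \<Rightarrow> nat \<Rightarrow> nat \<Rightarrow> nat \<times> move" where
  "second_action q j s = (if j = tape_of (stack_of S q) then
     (case op_of S q of Nop \<Rightarrow> (s, Stay) | PushOp c \<Rightarrow> (bit_symbol c, Stay) | PopOp \<Rightarrow> (0, MoveRight))
     else (s, Stay))"

definition turing_machine :: tm where
  "turing_machine = \<lparr>tapes = Suc N, states = 2 * Q, symbols = 3, delta = (\<lambda>p ss.
     if p = 2 * h then (2 * Q, map (\<lambda>j. (ss ! (if j = 1 then tape_of 1 else j), Stay)) [0..<Suc N])
     else if even p then (Suc p, map (\<lambda>j. first_action (p div 2) j (ss ! j)) [0..<Suc N])
     else (2 * next_of S (p div 2) (symbol_bit (ss ! tape_of (stack_of S (p div 2)))),
       map (\<lambda>j. second_action (p div 2) j (ss ! j)) [0..<Suc N]))\<rparr>"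

lemma turing_machine_simps [simp]:
  "tapes turing_machine = Suc N" "states turing_machine = 2 * Q" "symbols turing_machine = 3"
  by (simp_all add: turing_machine_def)

lemma is_tm_turing_machine:
  assumes "1 < N" shows "is_tm turing_machine"
proof -
  have "case delta turing_machine p ss of (q', as) \<Rightarrow>
      q' \<le> 2 * Q \<and> length as = Suc N \<and> (\<forall>(s', m)\<in>set as. s' < 3)"
    if "p < 2 * Q" "length ss = Suc N" and ss: "\<forall>s\<in>set ss. s < 3" for p ss
  proof -
    have "ss ! j < 3" if "j < Suc N" for j using ss \<open>length ss = Suc N\<close> that by simp
    moreover have "tape_of 1 < Suc N" using assms by (rule tape_of_less)
    moreover have "next_of S (p div 2) a < Q" for a using that(1) by (intro next_of_less) simp
    ultimately show ?thesis using that(1)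
      by (auto simp: turing_machine_def first_action_def second_action_def less_imp_le
        split: stack_op.splits simp del: upt_Suc)
  qed
  then show ?thesis using assms by (auto simp: is_tm_def)
qed

lemma tm_step_turing_machine:
  "p < 2 * Q \<Longrightarrow> delta turing_machine p (map read_tape ts) =
      (p', map (\<lambda>j. f j (map read_tape ts ! j)) [0..<Suc N]) \<Longrightarrow>
    length ts = Suc N \<Longrightarrow>
    tm_step turing_machine (p, ts) =
        (p', map (\<lambda>j. act (f j (read_tape (ts ! j))) (ts ! j)) [0..<Suc N])"
  by (auto simp: tm_step_def simp del: upt_Suc intro!: nth_equalityI)

lemma map_act_update:
  assumes "length ts = Suc N" "k < N" "\<And>j s. j \<noteq> tape_of k \<Longrightarrow> f j s = (s, Stay)"
  shows "map (\<lambda>j. act (f j (read_tape (ts ! j))) (ts ! j)) [0..<Suc N] =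
    ts[tape_of k := act (f (tape_of k) (read_tape (ts ! tape_of k))) (ts ! tape_of k)]"
  using assms tape_of_less[OF assms(2)]
  by (intro nth_equalityI) (auto simp: nth_list_update simp del: upt_Suc)

lemma tm_step_first:
  assumes "q < Q" "q \<noteq> h" "length ts = Suc N"
  shows "tm_step turing_machine (2 * q, ts) = (Suc (2 * q), let j = tape_of (stack_of S q) in
    ts[j := act (first_action q j (read_tape (ts ! j))) (ts ! j)])"
  unfolding Let_def using assms stack_of_less[OF assms(1)]
  by (subst map_act_update[symmetric]; (intro tm_step_turing_machine)?)
    (auto simp: turing_machine_def first_action_def simp del: upt_Suc)

lemma tm_step_second:
  assumes "q < Q" "length ts = Suc N"
  shows "tm_step turing_machine (Suc (2 * q), ts) = (let j = tape_of (stack_of S q) in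
    (2 * next_of S q (symbol_bit (read_tape (ts ! j))),
        ts[j := act (second_action q j (read_tape (ts ! j))) (ts ! j)]))"
proof -
  have "Suc (2 * q) \<noteq> 2 * h" by presburger
  then show ?thesis
    unfolding Let_def using assms stack_of_less[OF assms(1)]
      tape_of_less[OF stack_of_less[OF assms(1)]]
    by (subst map_act_update[symmetric]; (intro tm_step_turing_machine)?)
      (auto simp: turing_machine_def second_action_def simp del: upt_Suc)
qed

definition tapes_hold :: "tape list \<Rightarrow> store \<Rightarrow> bool" where
  "tapes_hold ts \<sigma> \<longleftrightarrow> length ts = Suc N \<and> (\<forall>k<N. tape_holds (ts ! tape_of k) (\<sigma> k)) \<and>
     ts ! 1 = (\<lambda>_. 0, 0)"

lemma tapes_hold_update:
  "tapes_hold ts \<sigma> \<Longrightarrow> k < N \<Longrightarrow> tape_holds T w \<Longrightarrow> tapes_hold (ts[tape_of k := T]) (\<sigma>(k := w))"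
  by (auto simp: tapes_hold_def nth_list_update tape_of_less)

lemma tm_two_steps:
  assumes q: "q < Q" "q \<noteq> h" and ts: "tapes_hold ts \<sigma>" and step: "sm_step S (q, \<sigma>) = (q', \<sigma>')"
  shows "\<exists>ts'. (tm_step turing_machine ^^ 2) (2 * q, ts) = (2 * q', ts') \<and> tapes_hold ts' \<sigma>'"
proof -
  define k where "k = stack_of S q"
  define T where "T = ts ! tape_of k"
  define T1 where "T1 = act (first_action q (tape_of k) (read_tape T)) T"
  define T2 where "T2 = act (second_action q (tape_of k) (read_tape T1)) T1"
  have k: "k < N" and len: "length ts = Suc N" and T: "tape_holds T (\<sigma> k)"
    using q(1) ts by (simp_all add: k_def T_def stack_of_less tapes_hold_def)
  have tk: "tape_of k < length ts" using k len by (simp add: tape_of_less)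
  have "tape_holds T2 (apply_op (op_of S q) (\<sigma> k)) \<and> next_of S q (symbol_bit (read_tape T1)) = q'"
  proof (cases "\<exists>c. op_of S q = PushOp c")
    case True
    then obtain c where c: "op_of S q = PushOp c" by blast
    have "q' = next_of S q (peek (\<sigma> k))" using step by (simp add: sm_step_def k_def)
    moreover have "T2 = act (bit_symbol c, Stay) (act (read_tape T, MoveLeft) T)"
      by (simp add: T2_def T1_def first_action_def second_action_def c k_def)
    ultimately show ?thesis using tape_holds_push[OF T, of c] next_of_push[OF q(1) c] c by auto
  next
    case False
    then have "T1 = T" by (auto simp: T1_def first_action_def)
    moreover have "next_of S q (symbol_bit (read_tape T)) = q'"
      using step by (simp add: sm_step_def read_tape_holds[OF T] symbol_bit_cell k_def)
    ultimately show ?thesis using False T tape_holds_pop[OF T]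
      by (cases "op_of S q") (auto simp: T2_def second_action_def k_def)
  qed
  moreover have "(tm_step turing_machine ^^ 2) (2 * q, ts) =
      (2 * next_of S q (symbol_bit (read_tape T1)), ts[tape_of k := T2])"
  proof -
    have "(tm_step turing_machine ^^ 2) c = tm_step turing_machine (tm_step turing_machine c)" for c
      by (simp add: numeral_2_eq_2)
    then show ?thesis using q len tk
      by (simp add: tm_step_first tm_step_second Let_def T2_def T1_def T_def flip: k_def)
  qed
  moreover have "\<sigma>' = \<sigma>(k := apply_op (op_of S q) (\<sigma> k))"
    using step by (simp add: sm_step_def k_def)
  ultimately show ?thesis using tapes_hold_update[OF ts k] by auto
qed

lemma tm_reaches_halt:
  "(sm_step S ^^ t) (q, \<sigma>) = (h, \<sigma>') \<Longrightarrow> q < Q \<Longrightarrow> tapes_hold ts \<sigma> \<Longrightarrow>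
    \<exists>t'\<le>2 * t. \<exists>ts'. (tm_step turing_machine ^^ t') (2 * q, ts) = (2 * h, ts') \<and> tapes_hold ts' \<sigma>'"
proof (induction t arbitrary: q \<sigma> ts)
  case (Suc t)
  show ?case
  proof (cases "q = h")
    case True
    then have "\<sigma>' = \<sigma>" using Suc.prems(1) sm_halted[of "Suc t"] by simp
    then show ?thesis using True Suc.prems(3) by (intro exI[of _ 0]) auto
  next
    case False
    obtain q1 \<sigma>1 where step: "sm_step S (q, \<sigma>) = (q1, \<sigma>1)" by (meson surj_pair)
    then have "q1 < Q" using Suc.prems(2) by (auto simp: sm_step_def next_of_less)
    moreover obtain ts1 where ts1: "(tm_step turing_machine ^^ 2) (2 * q, ts) = (2 * q1, ts1)"
        "tapes_hold ts1 \<sigma>1"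
      using tm_two_steps[OF Suc.prems(2) False Suc.prems(3) step] by blast
    moreover have "(sm_step S ^^ t) (q1, \<sigma>1) = (h, \<sigma>')"
      using Suc.prems(1) step by (simp add: funpow_Suc_right del: funpow.simps)
    ultimately obtain t' ts' where
      t': "t' \<le> 2 * t" "(tm_step turing_machine ^^ t') (2 * q1, ts1) = (2 * h, ts')"
          "tapes_hold ts' \<sigma>'"
      using Suc.IH by blast
    then show ?thesis using funpow_trans[OF ts1(1) t'(2)] by (intro exI[of _ "2 + t'"]) auto
  qed
qed auto

lemma turing_machine_outputs_within:
  assumes run: "(sm_step S ^^ t) (0, (\<lambda>_. [])(0 := x)) = (h, \<sigma>')" and out: "peek (\<sigma>' 1) = Some c"
    and N: "1 < N" and T: "2 * t + 1 \<le> T"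
  shows "outputs_within turing_machine T x [c]"
proof -
  have "tape_holds (input_tape x) x" "tape_holds (\<lambda>_. 0, 0) []"
    by (auto simp: tape_holds_def input_tape_def cell_def)
  then have "tapes_hold (input_tape x # replicate N (\<lambda>_. 0, 0)) ((\<lambda>_. [])(0 := x))"
    using N by (auto simp: tapes_hold_def tape_of_def)
  then obtain t' ts where t': "t' \<le> 2 * t" "tapes_hold ts \<sigma>'"
    "(tm_step turing_machine ^^ t') (2 * 0, input_tape x # replicate N (\<lambda>_. 0, 0)) = (2 * h, ts)"
    using tm_reaches_halt[OF run] halt_less by force
  let ?f = "\<lambda>j s. (if j = 1 then bit_symbol c else s, Stay)"
  have "tape_holds (ts ! tape_of 1) (\<sigma>' 1)" and len: "length ts = Suc N"
    and blank: "ts ! 1 = (\<lambda>_. 0, 0)"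
    using t'(2) N by (auto simp: tapes_hold_def)
  with out have "read_tape (ts ! tape_of 1) = bit_symbol c"
    by (cases "\<sigma>' 1") (auto simp: read_tape_holds)
  then have "map (\<lambda>j. (map read_tape ts ! (if j = 1 then tape_of 1 else j), Stay)) [0..<Suc N] =
      map (\<lambda>j. ?f j (map read_tape ts ! j)) [0..<Suc N]"
    using tape_of_less[OF N] by (intro map_cong) (auto simp: len)
  then have "delta turing_machine (2 * h) (map read_tape ts) =
      (2 * Q, map (\<lambda>j. ?f j (map read_tape ts ! j)) [0..<Suc N])"
    by (simp add: turing_machine_def del: upt_Suc)
  from tm_step_turing_machine[where f = ?f, OF _ this len] halt_less
  have "(tm_step turing_machine ^^ 1) (2 * h, ts) =
      (2 * Q, map (\<lambda>j. act (?f j (read_tape (ts ! j))) (ts ! j)) [0..<Suc N])" by simp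
  from funpow_trans[OF funpow_trans[OF t'(3) this] tm_halted, of "T - (t' + 1)"]
  have "(tm_step turing_machine ^^ T) (init_config turing_machine x) =
      (2 * Q, map (\<lambda>j. act (?f j (read_tape (ts ! j))) (ts ! j)) [0..<Suc N])"
    using t'(1) T by (simp add: init_config_def)
  moreover have "tape_output (act (bit_symbol c, Stay) (ts ! 1)) [c]"
    by (simp add: tape_output_def act_def blank[simplified])
  ultimately show ?thesis using N by (simp add: outputs_within_def del: upt_Suc)
qed

end

lemma polytime_pred_imp_P_class:
  assumes "polytime_pred 1 (\<lambda>e. arg 0 e \<in> L)"
  shows "L \<in> P_class"
proof -
  have "registers 1 [0] 1 2" by (simp add: registers_def)
  with assms obtain P T where T: "poly_bounded 1 T" and P: "\<And>\<sigma>. \<forall>k\<ge>2. \<sigma> k = [] \<Longrightarrow>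
      exec_within P \<sigma> (T (map \<sigma> [0])) (\<sigma>(1 := [arg 0 (map \<sigma> [0]) \<in> L] @ \<sigma> 1))"
    unfolding polytime_pred_def by (rule polytimeE) blast
  obtain Q S h where "finite_stack_machine (max 2 (stack_bound P)) Q S h" and
    run: "\<And>\<sigma> t \<sigma>'. exec_within P \<sigma> t \<sigma>' \<Longrightarrow> (sm_step S ^^ t) (0, \<sigma>) = (h, \<sigma>')"
    by (rule finite_stack_machine_of_prog[of P "max 2 (stack_bound P)"]) auto
  then interpret finite_stack_machine "max 2 (stack_bound P)" Q S h by simp
  obtain k where k: "\<And>e. length e = 1 \<Longrightarrow> T e \<le> arg_size e ^ k" using T
    unfolding poly_bounded_def by blast
  define p :: "nat poly" where "p = [:1:] + [:2:] * [:2, 1:] ^ k"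
  have "outputs_within turing_machine (poly p (length x)) x [x \<in> L]" for x
  proof (rule turing_machine_outputs_within)
    let ?\<sigma> = "(\<lambda>_. [])(0 := x)"
    have "exec_within P ?\<sigma> (T [x]) (?\<sigma>(1 := [x \<in> L]))" using P[of ?\<sigma>] by simp
    then show "(sm_step S ^^ T [x]) (0, ?\<sigma>) = (h, ?\<sigma>(1 := [x \<in> L]))" by (rule run)
    show "2 * T [x] + 1 \<le> poly p (length x)"
      using k[of "[x]"] by (simp add: p_def poly_power arg_size_def add.commute)
  qed simp_all
  moreover have "is_tm turing_machine" by (rule is_tm_turing_machine) simp
  ultimately show ?thesis unfolding P_class_def by blast
qed


section \<open>Simulating Turing machines\<close>

definition polytime_nats :: "nat \<Rightarrow> (bool list list \<Rightarrow> nat list) \<Rightarrow> bool" where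
  "polytime_nats m F \<longleftrightarrow> polytime m (\<lambda>e. enc_nats (F e))"

lemma polytime_nats_Nil: "polytime_nats m (\<lambda>e. [])"
  by (simp add: polytime_nats_def polytime_const)

lemma polytime_nats_Cons:
  "polytime_nat m h \<Longrightarrow> polytime_nats m F \<Longrightarrow> polytime_nats m (\<lambda>e. h e # F e)"
  by (simp add: polytime_nats_def polytime_nat_def polytime_append polytime_Cons)

lemma polytime_nats_append:
  "polytime_nats m F \<Longrightarrow> polytime_nats m G \<Longrightarrow> polytime_nats m (\<lambda>e. F e @ G e)"
  by (simp add: polytime_nats_def polytime_append)

lemma polytime_nats_concat:
  "(\<And>x. x \<in> set xs \<Longrightarrow> polytime_nats m (F x)) \<Longrightarrow> polytime_nats m (\<lambda>e. concat (map (\<lambda>x. F x e) xs))"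
  by (induction xs) (simp_all add: polytime_nats_Nil polytime_nats_append)

lemma polytime_nats_for:
  assumes "polytime_nats (Suc m) (\<lambda>e. F (length (arg 0 e)) (tl e))" "polytime_nat m n"
  shows "polytime_nats m (\<lambda>e. concat (map (\<lambda>i. F i e) [0..<n e]))"
  using polytime_for[of m "\<lambda>i e. enc_nats (F i e)"] assms
  by (simp add: polytime_nats_def enc_nats_concat o_def)

lemma polytime_nats_map_upt:
  assumes "polytime_nat (Suc m) (\<lambda>e. h (length (arg 0 e)) (tl e))" "polytime_nat m n"
  shows "polytime_nats m (\<lambda>e. map (\<lambda>i. h i e) [0..<n e])"
  using polytime_nats_for[OF polytime_nats_Cons[OF assms(1) polytime_nats_Nil] assms(2)]
  by (simp add: concat_map_singleton)

lemma polytime_finite_case: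
  assumes "polytime_nat m h" "\<And>a. a < k \<Longrightarrow> polytime m (f a)"
  shows "polytime m (\<lambda>e. if h e < k then f (h e) e else [])"
  using assms(2)
proof (induction k)
  case (Suc k)
  then have IH: "polytime m (\<lambda>e. if h e < k then f (h e) e else [])" by simp
  have "polytime m (\<lambda>e. if h e = k then f k e else if h e < k then f (h e) e else [])"
    by (intro polytime_if[OF _ _ IH] polytime_pred_eq polytime_nat_const assms(1) Suc.prems lessI)
  then show ?case by (rule polytime_cong) (auto simp: less_Suc_eq)
qed (simp add: polytime_const)

lemma polytime_finite_cases:
  assumes "\<And>h. h \<in> set hs \<Longrightarrow> polytime_nat m h"
    and "\<And>as. length as = length hs \<Longrightarrow> \<forall>a\<in>set as. a < k \<Longrightarrow> polytime m (f as)"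
  shows "polytime m (\<lambda>e. if \<forall>h\<in>set hs. h e < k then f (map (\<lambda>h. h e) hs) e else [])"
  using assms
proof (induction hs arbitrary: f)
  case (Cons h hs)
  have "polytime m (\<lambda>e. if \<forall>h\<in>set hs. h e < k then f (a # map (\<lambda>h. h e) hs) e else [])" if "a < k"
    for a
    by (rule Cons.IH) (use Cons.prems that in auto)
  then have "polytime m (\<lambda>e. if h e < k
      then (\<lambda>a e. if \<forall>h\<in>set hs. h e < k then f (a # map (\<lambda>h. h e) hs) e else []) (h e) e else [])"
    by (intro polytime_finite_case Cons.prems(1)) simp_all
  then show ?case by (rule polytime_cong) auto
qed simp

lemma polytime_nat_cell:
  assumes "polytime m f" "polytime_nat m n" shows "polytime_nat m (\<lambda>e. cell (f e) (n e))"
proof -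
  have "cell w i = (if i < length w then if hd_bit (drop i w) then 2 else 1 else 0)" for w i
    by (simp add: cell_def hd_bit_drop bit_symbol_def)
  then show ?thesis
    by (simp only:) (intro polytime_nat_if polytime_pred_less polytime_pred_hd_bit polytime_drop
        polytime_nat_length polytime_nat_const assms)
qed

lemma nth_concat_uniform:
  "\<forall>xs\<in>set xss. length xs = n \<Longrightarrow> j < length xss \<Longrightarrow> i < n \<Longrightarrow> concat xss ! (j * n + i) = xss ! j ! i"
proof (induction xss arbitrary: j)
  case (Cons xs xss)
  then show ?case by (cases j) (auto simp: nth_append)
qed simp

lemma concat_output_symbols:
  assumes out: "tape_output \<theta> y" and blank: "fst \<theta> (int T) = 0"
    and z: "\<And>i. i < T \<Longrightarrow> z i = fst \<theta> (int i)"
  shows "concat (map (\<lambda>i. if \<forall>k<Suc i. z k \<noteq> 0 then [z i = 2] else []) [0..<T]) = y"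
proof -
  have len: "length y \<le> T" using out blank by (force simp: tape_output_def not_le[symmetric])
  have cell: "z i = cell y i" if "i < T" "i \<le> length y" for i
    using out that by (auto simp: z tape_output_def cell_def le_less)
  have "(if \<forall>k<Suc i. z k \<noteq> 0 then [z i = 2] else []) = (if i < length y then [y ! i] else [])"
    if "i < T" for i
  proof (cases "i < length y")
    case True
    then have "\<forall>k<Suc i. z k \<noteq> 0" using that by (simp add: cell cell_def)
    then show ?thesis using True that by (simp add: cell cell_def bit_symbol_def)
  next
    case False
    then have "z (length y) = 0" using that by (simp add: cell cell_def)
    then have "\<not> (\<forall>k<Suc i. z k \<noteq> 0)" using False by (meson not_less less_Suc_eq_le)
    then show ?thesis using False by (simp only: if_False)
  qed
  then have "map (\<lambda>i. if \<forall>k<Suc i. z k \<noteq> 0 then [z i = 2] else []) [0..<T] =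
      map (\<lambda>i. if i < length y then [y ! i] else []) [0..<T]"
    by (intro map_cong refl) simp
  then show ?thesis using concat_map_nth_if[OF len] by (simp only:)
qed

context
  fixes M :: tm
  assumes M: "is_tm M"
begin

lemma tapes_ge: "2 \<le> tapes M" and symbols_ge: "3 \<le> symbols M"
  using M by (auto simp: is_tm_def)

text \<open>Cells at distance at least \<open>t\<close> from the origin have not been visited in the first \<open>t\<close> steps.\<close>

definition config_within :: "nat \<Rightarrow> config \<Rightarrow> bool" where
  "config_within t c \<longleftrightarrow> fst c \<le> states M \<and> length (snd c) = tapes M \<and> (\<forall>j<tapes M.
     \<bar>snd (snd c ! j)\<bar> \<le> int t \<and> (\<forall>i. fst (snd c ! j) i < symbols M) \<and>
     (0 < j \<longrightarrow> (\<forall>i. int t \<le> \<bar>i\<bar> \<longrightarrow> fst (snd c ! j) i = 0)))"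

lemma config_withinD:
  assumes "config_within t c"
  shows "fst c \<le> states M" "length (snd c) = tapes M"
    "j < tapes M \<Longrightarrow> \<bar>snd (snd c ! j)\<bar> \<le> int t" "j < tapes M \<Longrightarrow> fst (snd c ! j) i < symbols M"
  using assms unfolding config_within_def by blast+

lemma config_within_init: "config_within 0 (init_config M x)"
  using tapes_ge symbols_ge
  by (auto simp: config_within_def init_config_def nth_Cons' input_tape_def bit_symbol_def)

lemma read_tape_less: "config_within t c \<Longrightarrow> j < tapes M \<Longrightarrow> read_tape (snd c ! j) < symbols M"
  by (simp add: config_withinD read_tape_def)

lemma delta_read_tape:
  assumes "config_within t c" "fst c \<noteq> states M"
    "delta M (fst c) (map read_tape (snd c)) = (q', as)"
  shows "q' \<le> states M" "length as = tapes M" "\<And>j. j < tapes M \<Longrightarrow> fst (as ! j) < symbols M"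
proof -
  have len: "length (map read_tape (snd c)) = tapes M" and q: "fst c < states M"
    using config_withinD(1,2)[OF assms(1)] assms(2) by simp_all
  have "\<forall>s\<in>set (map read_tape (snd c)). s < symbols M"
    unfolding all_set_conv_all_nth len using len read_tape_less[OF assms(1)] by simp
  with M q len have "case delta M (fst c) (map read_tape (snd c)) of (q', as) \<Rightarrow>
      q' \<le> states M \<and> length as = tapes M \<and> (\<forall>(s', m)\<in>set as. s' < symbols M)"
    by (simp only: is_tm_def)
  then have as: "q' \<le> states M \<and> length as = tapes M \<and> (\<forall>(s', m)\<in>set as. s' < symbols M)"
    by (simp add: assms(3))
  then show "q' \<le> states M" "length as = tapes M" by auto
  show "fst (as ! j) < symbols M" if "j < tapes M" for j
    using as that nth_mem[of j as] by (cases "as ! j") auto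
qed

lemma config_within_step:
  assumes c: "config_within t c" shows "config_within (Suc t) (tm_step M c)"
proof (cases "fst c = states M")
  case True
  then show ?thesis using c by (fastforce simp: config_within_def tm_step_def)
next
  case False
  obtain q' as where d: "delta M (fst c) (map read_tape (snd c)) = (q', as)" by fastforce
  note as = delta_read_tape[OF c False d]
  have "\<bar>move_head m i\<bar> \<le> int (Suc t)" if "\<bar>i\<bar> \<le> int t" for m i
    using that by (cases m) auto
  then show ?thesis using c as False
    by (auto simp: config_within_def tm_step_def d act_def)
qed

lemma config_within_funpow: "config_within t ((tm_step M ^^ t) (init_config M x))"
  by (induction t) (simp_all add: config_within_init config_within_step)

definition window :: "nat \<Rightarrow> tape \<Rightarrow> nat list" where
  "window T = (\<lambda>(f, p). nat (p + int T) # map (\<lambda>i. f (int i - int T)) [0..<2 * T + 1])"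

definition snapshot :: "nat \<Rightarrow> config \<Rightarrow> nat list" where
  "snapshot T c = fst c # concat (map (window T) (snd c))"

definition head_in :: "nat \<Rightarrow> bool list \<Rightarrow> nat \<Rightarrow> nat" where
  "head_in T w j = nth_block w (Suc (j * (2 * T + 2)))"

definition cell_in :: "nat \<Rightarrow> bool list \<Rightarrow> nat \<Rightarrow> nat \<Rightarrow> nat" where
  "cell_in T w j i = nth_block w (Suc (j * (2 * T + 2) + Suc i))"

lemma length_window [simp]: "length (window T \<theta>) = 2 * T + 2"
  by (simp add: window_def split_beta)

lemma nth_snapshot_window:
  assumes "j < length (snd c)" "i < 2 * T + 2"
  shows "nth_block (enc_nats (snapshot T c)) (Suc (j * (2 * T + 2) + i)) = window T (snd c ! j) ! i"
proof -
  have "concat (map (window T) (snd c)) ! (j * (2 * T + 2) + i) = map (window T) (snd c) ! j ! i"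
    by (rule nth_concat_uniform) (use assms in auto)
  moreover have "j * (2 * T + 2) + i < length (concat (map (window T) (snd c)))"
  proof -
    have "j * (2 * T + 2) + i < Suc j * (2 * T + 2)" using assms(2) by simp
    also have "\<dots> \<le> length (snd c) * (2 * T + 2)" using assms(1) by (intro mult_le_mono1) simp
    finally show ?thesis by (simp add: length_concat o_def sum_list_triv)
  qed
  ultimately show ?thesis
    using assms(1) by (simp add: snapshot_def nth_block_enc_nats del: enc_nats_simps)
qed

lemma head_in_snapshot:
  "j < length (snd c) \<Longrightarrow> head_in T (enc_nats (snapshot T c)) j = nat (snd (snd c ! j) + int T)"
  using nth_snapshot_window[of j c 0 T] by (simp add: head_in_def window_def split_beta)

lemma cell_in_snapshot:
  "j < length (snd c) \<Longrightarrow> i < 2 * T + 1 \<Longrightarrow>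
    cell_in T (enc_nats (snapshot T c)) j i = fst (snd c ! j) (int i - int T)"
  using nth_snapshot_window[of j c "Suc i" T]
  by (simp add: cell_in_def window_def split_beta nth_append del: upt_Suc)

lemma state_in_snapshot: "nth_block (enc_nats (snapshot T c)) 0 = fst c"
  by (simp add: snapshot_def nth_block_enc_nats del: enc_nats_simps)

fun shift :: "move \<Rightarrow> nat \<Rightarrow> nat" where
  "shift MoveLeft i = i - 1"
| "shift Stay i = i"
| "shift MoveRight i = Suc i"

definition next_window :: "nat \<Rightarrow> bool list \<Rightarrow> nat \<Rightarrow> nat \<times> move \<Rightarrow> nat list" where
  "next_window T w j a = shift (snd a) (head_in T w j) #
     map (\<lambda>i. if i = head_in T w j then fst a else cell_in T w j i) [0..<2 * T + 1]"

definition next_snapshot :: "nat \<Rightarrow> bool list \<Rightarrow> nat \<Rightarrow> nat list \<Rightarrow> bool list" where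
  "next_snapshot T w q ss = (if q = states M then w else
     enc_nats (fst (delta M q ss) #
       concat (map (\<lambda>j. next_window T w j (snd (delta M q ss) ! j)) [0..<tapes M])))"

text \<open>The case distinction on the arguments of \<open>delta M\<close> has to be finite, so values that do not
  occur in snapshots are excluded.\<close>

definition step_snapshot :: "nat \<Rightarrow> bool list \<Rightarrow> bool list" where
  "step_snapshot T w =
     (let qs = nth_block w 0 # map (\<lambda>j. cell_in T w j (head_in T w j)) [0..<tapes M]
      in if \<forall>q\<in>set qs. q < states M + symbols M + 1 then next_snapshot T w (hd qs) (tl qs) else [])"

lemma window_act:
  assumes "\<bar>p\<bar> < int T" "head_in T w j = nat (p + int T)"
    "\<And>i. i < 2 * T + 1 \<Longrightarrow> cell_in T w j i = f (int i - int T)"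
  shows "window T (act a (f, p)) = next_window T w j a"
proof -
  have "nat (move_head (snd a) p + int T) = shift (snd a) (nat (p + int T))"
    using assms(1) by (cases "snd a") auto
  moreover have "(f(p := fst a)) (int i - int T) =
      (if i = nat (p + int T) then fst a else f (int i - int T))" for i
    using assms(1) by auto
  ultimately show ?thesis
    using assms(2,3) by (simp add: window_def act_def next_window_def del: upt_Suc)
qed

lemma cell_in_head:
  assumes c: "config_within t c" and t: "t < T" and j: "j < tapes M"
  shows "cell_in T (enc_nats (snapshot T c)) j (head_in T (enc_nats (snapshot T c)) j) =
      read_tape (snd c ! j)"
proof -
  have "\<bar>snd (snd c ! j)\<bar> \<le> int t" "j < length (snd c)"
    using config_withinD(2,3)[OF c] j by simp_all
  moreover from this have "0 \<le> snd (snd c ! j) + int T" "snd (snd c ! j) < int T"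
    using t by linarith+
  ultimately show ?thesis
    using cell_in_snapshot[of j c "nat (snd (snd c ! j) + int T)" T]
    by (simp add: head_in_snapshot read_tape_def)
qed

lemma snapshot_tm_step:
  assumes c: "config_within t c" and t: "t < T"
  defines "w \<equiv> enc_nats (snapshot T c)"
  shows "enc_nats (snapshot T (tm_step M c)) =
    next_snapshot T w (nth_block w 0) (map (\<lambda>j. cell_in T w j (head_in T w j)) [0..<tapes M])"
proof (cases "fst c = states M")
  case True
  then show ?thesis by (simp add: w_def next_snapshot_def tm_step_def state_in_snapshot)
next
  case False
  obtain q ts where qts: "c = (q, ts)" by fastforce
  have len: "length ts = tapes M" and heads: "\<And>j. j < tapes M \<Longrightarrow> \<bar>snd (ts ! j)\<bar> < int T"
    using config_withinD(2,3)[OF c] t by (force simp: qts intro: le_less_trans)+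
  have head: "head_in T w j = nat (snd (ts ! j) + int T)"
    and cells: "\<And>i. i < 2 * T + 1 \<Longrightarrow> cell_in T w j i = fst (ts ! j) (int i - int T)" if "j < tapes M"
      for j
    using that len by (simp_all add: w_def qts head_in_snapshot cell_in_snapshot)
  have "cell_in T w j (head_in T w j) = read_tape (ts ! j)" if "j < tapes M" for j
    using cell_in_head[OF c t that] by (simp add: w_def qts)
  then have read: "map (\<lambda>j. cell_in T w j (head_in T w j)) [0..<tapes M] = map read_tape ts"
    using len by (intro nth_equalityI) auto
  obtain q' as where d: "delta M q (map read_tape ts) = (q', as)" by fastforce
  have "length as = tapes M" using delta_read_tape(2)[OF c False] d by (simp add: qts)
  moreover have "window T (act (as ! j) (ts ! j)) = next_window T w j (as ! j)" if "j < tapes M"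
    for j
    using window_act[of "snd (ts ! j)" T w j "fst (ts ! j)"] heads[OF that] head[OF that]
        cells[OF that] by simp
  ultimately have "map (window T) (map2 act as ts) =
      map (\<lambda>j. next_window T w j (as ! j)) [0..<tapes M]"
    using len by (intro nth_equalityI) auto
  moreover have "nth_block w 0 = q" by (simp add: w_def qts state_in_snapshot)
  ultimately show ?thesis
    using False d read
    by (simp add: qts tm_step_def next_snapshot_def snapshot_def del: enc_nats_simps)
qed

lemma step_snapshot:
  assumes c: "config_within t c" and t: "t < T"
  shows "step_snapshot T (enc_nats (snapshot T c)) = enc_nats (snapshot T (tm_step M c))"
proof -
  have "read_tape (snd c ! j) < states M + symbols M + 1" if "j < tapes M" for j
    using read_tape_less[OF c that] by simp
  moreover have "fst c < states M + symbols M + 1" using config_withinD(1)[OF c] by simp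
  ultimately show ?thesis
    using cell_in_head[OF c t]
    by (simp add: step_snapshot_def snapshot_tm_step[OF c t] state_in_snapshot)
qed

lemma snapshot_init:
  "snapshot T (init_config M x) = 0 # concat (map (\<lambda>j. T #
     map (\<lambda>i. if j = 0 \<and> T \<le> i then cell x (i - T) else 0) [0..<2 * T + 1]) [0..<tapes M])"
proof -
  have "window T (input_tape x) = T # map (\<lambda>i. if T \<le> i then cell x (i - T) else 0) [0..<2 * T + 1]"
    by (auto simp: window_def input_tape_def cell_def nat_diff_distrib simp del: upt_Suc)
  then have "map (window T) (snd (init_config M x)) =
      map (\<lambda>j. T # map (\<lambda>i. if j = 0 \<and> T \<le> i then cell x (i - T) else 0) [0..<2 * T + 1])
          [0..<tapes M]"
    using tapes_ge
    by (intro nth_equalityI) (auto simp: init_config_def nth_Cons' window_def simp del: upt_Suc)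
  then show ?thesis by (simp add: snapshot_def) (simp add: init_config_def)
qed

lemma length_enc_snapshot:
  assumes "config_within t c" "t \<le> T"
  shows "length (enc_nats (snapshot T c))
      \<le> states M + 1 + tapes M * (2 * T + (2 * T + 1) * symbols M + (2 * T + 2))"
proof -
  have "sum_list (window T \<theta>) \<le> 2 * T + (2 * T + 1) * symbols M" if "\<theta> \<in> set (snd c)" for \<theta>
  proof -
    have "snd \<theta> \<le> int T" "\<And>i. fst \<theta> i \<le> symbols M"
      using that assms(2) config_withinD(2-4)[OF assms(1)]
      by (fastforce simp: in_set_conv_nth less_imp_le)+
    then show ?thesis
      using sum_list_mono[of "[0..<2 * T + 1]" "\<lambda>i. fst \<theta> (int i - int T)" "\<lambda>_. symbols M"]
      by (simp add: window_def split_beta sum_list_triv del: upt_Suc)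
  qed
  then have "sum_list (map (\<lambda>\<theta>. sum_list (window T \<theta>)) (snd c))
      \<le> length (snd c) * (2 * T + (2 * T + 1) * symbols M)"
    using sum_list_mono[of "snd c" "\<lambda>\<theta>. sum_list (window T \<theta>)"
        "\<lambda>_. 2 * T + (2 * T + 1) * symbols M"]
    by (simp add: sum_list_triv)
  moreover have "sum_list (concat xss) = sum_list (map sum_list xss)" for xss :: "nat list list"
    by (induction xss) auto
  ultimately show ?thesis using config_withinD(1,2)[OF assms(1)]
    by (simp add: snapshot_def length_enc_nats length_concat o_def sum_list_triv algebra_simps
      del: enc_nats_simps)
qed

lemma polytime_nat_head_in:
  "polytime_nat m T \<Longrightarrow> polytime m w \<Longrightarrow> polytime_nat m (\<lambda>e. head_in (T e) (w e) j)"
  unfolding head_in_def by (intro polytime_nat_nth_block polytime_nat_intros)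

lemma polytime_nat_cell_in:
  "polytime_nat m T \<Longrightarrow> polytime m w \<Longrightarrow> polytime_nat m i \<Longrightarrow>
    polytime_nat m (\<lambda>e. cell_in (T e) (w e) j (i e))"
  unfolding cell_in_def by (intro polytime_nat_nth_block polytime_nat_intros)

lemma polytime_next_snapshot:
  assumes T: "polytime_nat m T" and w: "polytime m w"
  shows "polytime m (\<lambda>e. next_snapshot (T e) (w e) q ss)"
proof -
  have "polytime_nats m (\<lambda>e. next_window (T e) (w e) j a)" for j a
    unfolding next_window_def
    by (cases "snd a")
      (simp_all del: upt_Suc, (intro polytime_nats_Cons polytime_nats_map_upt polytime_nat_if
        polytime_pred_eq polytime_nat_head_in polytime_nat_cell_in polytime_nat_intros
        polytime_nat_tl_args polytime_tl_args T w; assumption?)+)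
  then show ?thesis
    unfolding next_snapshot_def
    by (intro polytime_if polytime_pred_const w polytime_nats_def[THEN iffD1] polytime_nats_Cons
          polytime_nat_const polytime_nats_concat)
qed

lemma polytime_step_snapshot:
  assumes T: "polytime_nat m T" and w: "polytime m w"
  shows "polytime m (\<lambda>e. step_snapshot (T e) (w e))"
proof -
  let ?qs = "(\<lambda>e. nth_block (w e) 0) #
    map (\<lambda>j e. cell_in (T e) (w e) j (head_in (T e) (w e) j)) [0..<tapes M]"
  have "polytime m (\<lambda>e. if \<forall>h\<in>set ?qs. h e < states M + symbols M + 1
      then (\<lambda>qs e. next_snapshot (T e) (w e) (hd qs) (tl qs)) (map (\<lambda>h. h e) ?qs) e else [])"
    by (rule polytime_finite_cases)
      (auto intro: polytime_nat_nth_block polytime_nat_const polytime_next_snapshot T w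
        polytime_nat_cell_in[OF T w polytime_nat_head_in[OF T w]])
  then show ?thesis by (simp add: step_snapshot_def o_def cong: if_cong)
qed

lemma polytime_snapshot_run:
  assumes T: "polytime_nat m T" and g: "polytime m g"
  shows "polytime m (\<lambda>e. enc_nats (snapshot (T e) ((tm_step M ^^ T e) (init_config M (g e)))))"
proof -
  let ?R = "\<lambda>e s. enc_nats (snapshot (T e) ((tm_step M ^^ length s) (init_config M (g e))))"
  let ?z = "\<lambda>e. enc_nats (snapshot (T e) (init_config M (g e)))"
  let ?B = "\<lambda>e. states M + 1 + tapes M * (2 * T (tl e) + (2 * T (tl e) + 1) * symbols M +
      (2 * T (tl e) + 2))"
  have "polytime m (\<lambda>e. ?R e (unary (T e)))"
  proof (rule polytime_rec[where R = ?R and z = ?z and B = ?B and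
        g = "\<lambda>c e. step_snapshot (T (tl (tl e))) (arg 0 e)"])
    show "polytime m (\<lambda>e. unary (T e))" using T by (simp add: polytime_nat_def)
    show "polytime m ?z"
      unfolding snapshot_init polytime_nats_def[symmetric]
      by (intro polytime_nats_Cons polytime_nats_concat polytime_nats_map_upt polytime_nat_if
          polytime_pred_conj polytime_pred_const polytime_pred_le polytime_nat_cell
          polytime_nat_intros polytime_nat_tl_args T polytime_tl_args g)
    show "polytime (Suc (Suc m)) (\<lambda>e. step_snapshot (T (tl (tl e))) (arg 0 e))"
      by (intro polytime_step_snapshot polytime_nat_tl_args T polytime_arg)
    show "poly_bounded (Suc m) ?B"
      by (intro poly_bounded_intros poly_bounded_polytime_nat polytime_nat_tl_args T)
    show "?R e (c # s) = step_snapshot (T (tl (tl (?R e s # s # e)))) (arg 0 (?R e s # s # e))"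
      if "length s < length (unary (T e))" for e c s
      using step_snapshot[OF config_within_funpow[of "length s" "g e"], of "T e"] that by simp
    show "length (?R e s) \<le> ?B (s # e)" if "length s \<le> length (unary (T e))" for e s
      using length_enc_snapshot[OF config_within_funpow] that by simp
  qed simp
  then show ?thesis by simp
qed

theorem polytime_turing_machine:
  assumes g: "polytime m g"
    and out: "\<And>e. length e = m \<Longrightarrow> outputs_within M (poly p (length (g e))) (g e) (F e)"
  shows "polytime m F"
proof -
  let ?T = "\<lambda>e. poly p (length (g e))"
  let ?w = "\<lambda>e. enc_nats (snapshot (?T e) ((tm_step M ^^ ?T e) (init_config M (g e))))"
  let ?z = "\<lambda>e i. cell_in (?T e) (?w e) 1 (?T e + i)"
  have T: "polytime_nat m ?T" by (intro polytime_nat_intros g)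
  have w: "polytime m ?w" by (intro polytime_snapshot_run T g)
  have "polytime m (\<lambda>e.
      concat (map (\<lambda>i. if \<forall>k<Suc i. ?z e k \<noteq> 0 then [?z e i = 2] else []) [0..<?T e]))"
    unfolding polytime_pred_def[symmetric]
    by (intro polytime_for polytime_if polytime_pred_all polytime_pred_not polytime_pred_eq
        polytime_pred_eq[THEN polytime_pred_def[THEN iffD1]] polytime_nat_cell_in
        polytime_nat_tl_args T polytime_tl_args w polytime_const polytime_nat_intros polytime_arg)
  moreover have "concat (map (\<lambda>i. if \<forall>k<Suc i. ?z e k \<noteq> 0 then [?z e i = 2] else []) [0..<?T e])
      = F e" if e: "length e = m" for e
  proof -
    obtain q ts where c: "(tm_step M ^^ ?T e) (init_config M (g e)) = (q, ts)" by fastforce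
    then have within: "config_within (?T e) (q, ts)" using config_within_funpow by metis
    have z: "?z e i = fst (ts ! 1) (int i)" if "i < ?T e" for i
      using that tapes_ge cell_in_snapshot[of 1 "(q, ts)" "?T e + i" "?T e"]
          config_withinD(2)[OF within]
      by (simp add: c)
    have out_e: "tape_output (ts ! 1) (F e)" using out[OF e] c by (simp add: outputs_within_def)
    have "fst (ts ! 1) (int (?T e)) = 0" using within tapes_ge by (simp add: config_within_def)
    from concat_output_symbols[OF out_e this z] show ?thesis .
  qed
  ultimately show ?thesis by (rule polytime_cong)
qed

end

theorem P_class_iff_polytime: "L \<in> P_class \<longleftrightarrow> polytime_pred 1 (\<lambda>e. arg 0 e \<in> L)"
proof
  assume "L \<in> P_class"
  then obtain M p where "is_tm M" "\<And>x. outputs_within M (poly p (length x)) x [x \<in> L]"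
    unfolding P_class_def by blast
  then show "polytime_pred 1 (\<lambda>e. arg 0 e \<in> L)"
    unfolding polytime_pred_def by (intro polytime_turing_machine[OF _ polytime_arg])
qed (rule polytime_pred_imp_P_class)


section \<open>Constraint satisfaction as a trip network\<close>

lemma temporal_path_invariant:
  assumes path: "temporal_path F u fs v"
    and start: "\<And>\<theta>. I u \<theta>"
    and step: "\<And>f \<theta>. f \<in># F \<Longrightarrow> I (t_tail f) \<theta> \<Longrightarrow> \<theta> \<le> t_start f \<Longrightarrow> I (t_head f) (t_arrival f)"
  shows "I v (t_arrival (last fs))"
  using path
proof (induction fs arbitrary: v rule: rev_induct)
  case Nil
  then show ?case by (simp add: temporal_path_def)
next
  case (snoc f gs)
  have f: "f \<in># F" "t_head f = v" using snoc.prems by (auto simp: temporal_path_def)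
  show ?case
  proof (cases "gs = []")
    case True
    then have "t_tail f = u" using snoc.prems by (simp add: temporal_path_def)
    then show ?thesis using step[OF f(1)] start f(2) True by auto
  next
    case False
    then have "temporal_path F u gs (t_head (last gs))" "t_head (last gs) = t_tail f"
        "t_arrival (last gs) \<le> t_start f"
      using snoc.prems by (auto simp: temporal_path_def successively_append_iff)
    then show ?thesis using snoc.IH[of "t_tail f"] step[OF f(1)] f(2) by auto
  qed
qed

definition reach_by :: "'v temporal_edge multiset \<Rightarrow> 'v \<Rightarrow> 'v \<Rightarrow> real \<Rightarrow> bool" where
  "reach_by F u v \<theta> \<longleftrightarrow> (\<exists>fs. temporal_path F u fs v \<and> t_arrival (last fs) \<le> \<theta>)"

lemma reach_by_edge: "(u, v, s, d) \<in># F \<Longrightarrow> reach_by F u v (s + d)"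
  unfolding reach_by_def
  by (intro exI[of _ "[(u, v, s, d)]"])
    (simp add: temporal_path_def t_tail_def t_head_def t_arrival_def t_start_def t_travel_def)

lemma reach_by_snoc:
  assumes "reach_by F u v \<theta>" "(v, w, s, d) \<in># F" "\<theta> \<le> s"
  shows "reach_by F u w (s + d)"
proof -
  obtain fs where "temporal_path F u fs v" "t_arrival (last fs) \<le> \<theta>"
    using assms(1) unfolding reach_by_def by blast
  then show ?thesis unfolding reach_by_def using assms(2,3)
    by (intro exI[of _ "fs @ [(v, w, s, d)]"])
      (auto simp: temporal_path_def successively_append_iff t_tail_def t_head_def t_arrival_def
          t_start_def t_travel_def)
qed


subsection \<open>The network\<close>

lemma slot_less: "j < m \<Longrightarrow> p < 3 \<Longrightarrow> 3 * j + p < 3 * m" for j p m :: nat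
  by linarith

lemma concat_map_upt3_nth:
  "j < n \<Longrightarrow> p < 3 \<Longrightarrow> concat (map (\<lambda>j. map (h j) [0..<3]) [0..<n]) ! (3 * j + p) = h j p"
  using nth_concat_uniform[of "map (\<lambda>j. map (h j) [0..<3]) [0..<n]" 3 j p]
  by (simp add: mult.commute)

lemma length_concat_map_upt3: "length (concat (map (\<lambda>j. map (h j) [0..<3]) [0..<n])) = 3 * n"
  by (simp add: length_concat o_def sum_list_triv)

text \<open>An instance has variables \<open>v < nv\<close> with values \<open>a < D\<close>; the literal \<open>(v, a)\<close> says that \<open>v\<close>
  has the value \<open>a\<close>. The clause \<open>j < m\<close> forbids that the literals \<open>L s\<close> of its slots \<open>s = 3 * j + p\<close>,
  \<open>p < 3\<close>, hold together. A path from \<open>Var 0\<close> chooses the value \<open>a\<close> of \<open>v\<close> by walking along the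
  nodes \<open>Chain v a 0, \<dots>, Chain v a (3 * m)\<close>, for which it needs the last edge of the trip of each
  slot with the literal \<open>(v, a)\<close>. After that it is too late for the first edge of such a trip, which
  crosses the clause of the slot.\<close>

datatype node = Var nat | Chain nat nat nat | Clause nat | Source nat | Sink nat

locale csp_gadget =
  fixes nv D m K :: nat and L :: "nat \<Rightarrow> nat \<times> nat"
begin

definition core_size :: nat where
  "core_size = nv + m + 2 + nv * D * (3 * m + 1)"

definition num_nodes :: nat where
  "num_nodes = core_size + 2 * K"

fun index :: "node \<Rightarrow> nat" where
  "index (Var v) = v"
| "index (Clause j) = nv + 1 + j"
| "index (Chain v a s) = nv + m + 2 + (v * D + a) * (3 * m + 1) + s"
| "index (Source i) = core_size + i"
| "index (Sink i) = core_size + K + i"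

definition slot_trip :: "nat \<Rightarrow> nat \<Rightarrow> (node \<times> node) list" where
  "slot_trip j p = (let s = 3 * j + p; v = fst (L s); a = snd (L s) in
     [(Clause j, Clause (Suc j)), (Clause (Suc j), Chain v a s), (Chain v a s, Chain v a (Suc s))])"

definition single_edges :: "(node \<times> node) list" where
  "single_edges = concat (map (\<lambda>v. concat (map (\<lambda>a.
       [(Var v, Chain v a 0), (Chain v a (3 * m), Var (Suc v))] @
       concat (map (\<lambda>s. if L s = (v, a) then [] else [(Chain v a s, Chain v a (Suc s))])
           [0..<3 * m])) [0..<D])) [0..<nv])
     @ concat (map (\<lambda>i. [(Source i, Var 0), (Clause m, Sink i)]) [0..<K])"

definition gadget_trips :: "(node \<times> node) list list" where
  "gadget_trips = [(Var nv, Clause 0)] # concat (map (\<lambda>j. map (slot_trip j) [0..<3]) [0..<m])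
     @ map (\<lambda>e. [e]) single_edges"

definition unit_edge :: "node \<times> node \<Rightarrow> rat_edge" where
  "unit_edge = (\<lambda>(u, v). (index u, index v, 1))"

definition gadget_input :: mrtt_input where
  "gadget_input =
      (num_nodes, map unit_edge (concat gadget_trips), map (map unit_edge) gadget_trips)"

definition satisfying :: "(nat \<Rightarrow> nat) \<Rightarrow> bool" where
  "satisfying f \<longleftrightarrow> (\<forall>v<nv. f v < D) \<and> (\<forall>j<m. \<exists>p<3. f (fst (L (3 * j + p))) \<noteq> snd (L (3 * j + p)))"

abbreviation "net \<equiv> network_of gadget_input"

end

locale csp_network = csp_gadget +
  assumes D_pos: "0 < D"
    and literal_less: "s < 3 * m \<Longrightarrow> fst (L s) < nv" "s < 3 * m \<Longrightarrow> snd (L s) < D"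
begin

fun valid_node :: "node \<Rightarrow> bool" where
  "valid_node (Var v) \<longleftrightarrow> v \<le> nv"
| "valid_node (Clause j) \<longleftrightarrow> j \<le> m"
| "valid_node (Chain v a s) \<longleftrightarrow> v < nv \<and> a < D \<and> s \<le> 3 * m"
| "valid_node (Source i) \<longleftrightarrow> i < K"
| "valid_node (Sink i) \<longleftrightarrow> i < K"

definition node_at :: "nat \<Rightarrow> node" where
  "node_at n = (if n \<le> nv then Var n else if n < nv + m + 2 then Clause (n - (nv + 1))
     else if n < core_size then
       Chain ((n - (nv + m + 2)) div (3 * m + 1) div D) ((n - (nv + m + 2)) div (3 * m + 1) mod D)
         ((n - (nv + m + 2)) mod (3 * m + 1))
     else if n < core_size + K then Source (n - core_size) else Sink (n - (core_size + K)))"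

lemma core_size_ge: "nv + m + 2 \<le> core_size"
  by (simp add: core_size_def)

lemma index_Chain_less: "v < nv \<Longrightarrow> a < D \<Longrightarrow> s \<le> 3 * m \<Longrightarrow> index (Chain v a s) < core_size"
proof -
  assume v: "v < nv" and a: "a < D" and s: "s \<le> 3 * m"
  have "Suc (v * D + a) \<le> Suc v * D" using a by simp
  also have "\<dots> \<le> nv * D" using v by (intro mult_le_mono1) simp
  finally have "Suc (v * D + a) * (3 * m + 1) \<le> nv * D * (3 * m + 1)" by (rule mult_le_mono1)
  then show ?thesis using s by (simp add: core_size_def)
qed

lemma index_less: "valid_node u \<Longrightarrow> index u < num_nodes"
  using core_size_ge by (cases u)
    (auto simp: num_nodes_def intro: trans_less_add1 index_Chain_less simp del: index.simps(3))

lemma node_at_index: "valid_node u \<Longrightarrow> node_at (index u) = u"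
proof (cases u)
  case (Chain v a s)
  assume "valid_node u"
  then have vas: "v < nv" "a < D" "s < 3 * m + 1" by (auto simp: Chain)
  have "index u - (nv + m + 2) = (v * D + a) * (3 * m + 1) + s" by (simp add: Chain)
  moreover have "((v * D + a) * (3 * m + 1) + s) div (3 * m + 1) = v * D + a"
    "((v * D + a) * (3 * m + 1) + s) mod (3 * m + 1) = s"
      using vas(3) by (simp_all only: div_mult_self3 mod_mult_self3) simp_all
  ultimately show ?thesis using index_Chain_less[of v a s] vas
    by (simp only: node_at_def Chain) simp
qed (auto simp: node_at_def core_size_def)

lemma index_node_at: "n < num_nodes \<Longrightarrow> valid_node (node_at n) \<and> index (node_at n) = n"
proof -
  assume n: "n < num_nodes"
  show ?thesis
  proof (cases "nv + m + 2 \<le> n \<and> n < core_size")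
    case True
    define k where "k = n - (nv + m + 2)"
    define l where "l = k div (3 * m + 1)"
    have k: "n = nv + m + 2 + k" and "k < nv * D * (3 * m + 1)"
      using True by (auto simp: k_def core_size_def)
    then have "l < nv * D" by (simp add: l_def less_mult_imp_div_less)
    then have "l div D < nv" by (simp add: less_mult_imp_div_less)
    moreover have "k mod (3 * m + 1) < 3 * m + 1" by (rule mod_less_divisor) simp
    moreover have "(l div D * D + l mod D) * (3 * m + 1) + k mod (3 * m + 1) = k"
      unfolding div_mult_mod_eq l_def ..
    moreover have "node_at n = Chain (l div D) (l mod D) (k mod (3 * m + 1))"
      using True by (simp add: node_at_def k_def l_def)
    ultimately show ?thesis using D_pos k by simp
  qed (use n in \<open>auto simp: node_at_def num_nodes_def core_size_def\<close>)
qed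

declare index.simps [simp del]

lemma single_edges_cases:
  assumes "e \<in> set single_edges"
  obtains (enter) v a where "v < nv" "a < D" "e = (Var v, Chain v a 0)"
  | (leave) v a where "v < nv" "a < D" "e = (Chain v a (3 * m), Var (Suc v))"
  | (skip) v a s where "v < nv" "a < D" "s < 3 * m" "L s \<noteq> (v, a)"
      "e = (Chain v a s, Chain v a (Suc s))"
  | (source) i where "i < K" "e = (Source i, Var 0)"
  | (sink) i where "i < K" "e = (Clause m, Sink i)"
  using assms unfolding single_edges_def by (auto split: if_splits)

lemma single_edges_intros:
  "v < nv \<Longrightarrow> a < D \<Longrightarrow> (Var v, Chain v a 0) \<in> set single_edges"
  "v < nv \<Longrightarrow> a < D \<Longrightarrow> (Chain v a (3 * m), Var (Suc v)) \<in> set single_edges"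
  "v < nv \<Longrightarrow> a < D \<Longrightarrow> s < 3 * m \<Longrightarrow> L s \<noteq> (v, a) \<Longrightarrow> (Chain v a s, Chain v a (Suc s)) \<in> set single_edges"
  "i < K \<Longrightarrow> (Source i, Var 0) \<in> set single_edges"
  "i < K \<Longrightarrow> (Clause m, Sink i) \<in> set single_edges"
  unfolding single_edges_def by (auto split: if_splits)

lemma gadget_trips_nth:
  "gadget_trips ! 0 = [(Var nv, Clause 0)]"
  "j < m \<Longrightarrow> p < 3 \<Longrightarrow> gadget_trips ! Suc (3 * j + p) = slot_trip j p"
  "i < length single_edges \<Longrightarrow> gadget_trips ! Suc (3 * m + i) = [single_edges ! i]"
  by (auto simp: gadget_trips_def nth_append length_concat_map_upt3 concat_map_upt3_nth)

lemma length_gadget_trips: "length gadget_trips = Suc (3 * m + length single_edges)"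
  by (simp add: gadget_trips_def length_concat_map_upt3)

lemma gadget_trips_cases:
  assumes "i < length gadget_trips"
  obtains (bridge) "i = 0" | (slot) j p where "j < m" "p < 3" "i = Suc (3 * j + p)"
  | (single) e where "e \<in> set single_edges" "gadget_trips ! i = [e]"
proof -
  consider (zero) "i = 0" | (slots) "0 < i" "i \<le> 3 * m" | (singles) "3 * m < i" by linarith
  then show thesis
  proof cases
    case slots
    then have "(i - 1) div 3 < m" "(i - 1) mod 3 < 3"
        "i = Suc (3 * ((i - 1) div 3) + (i - 1) mod 3)"
      by (auto simp: less_mult_imp_div_less mult.commute)
    then show thesis by (rule slot)
  next
    case singles
    then have "i = Suc (3 * m + (i - Suc (3 * m)))" by simp
    moreover have "i - Suc (3 * m) < length single_edges"
      using singles assms by (simp add: length_gadget_trips)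
    ultimately show thesis
      using single[of "single_edges ! (i - Suc (3 * m))"] gadget_trips_nth(3) by (metis nth_mem)
  qed (rule bridge)
qed

lemma set_gadget_trips:
  "set gadget_trips =
      insert [(Var nv, Clause 0)] ({slot_trip j p | j p. j < m \<and> p < 3} \<union>
      (\<lambda>e. [e]) ` set single_edges)"
  by (auto simp: gadget_trips_def)

lemma valid_trip_edge:
  assumes "T \<in> set gadget_trips" "(u, w) \<in> set T"
  shows "valid_node u" "valid_node w"
proof -
  have "valid_node u \<and> valid_node w"
    using assms D_pos literal_less slot_less unfolding set_gadget_trips
    by (auto simp: slot_trip_def Let_def Suc_le_eq less_imp_le elim: single_edges_cases)
  then show "valid_node u" "valid_node w" by simp_all
qed

lemma net_simps:
  "nodes net = {..<num_nodes}"
      "edges net = mset (map (real_edge \<circ> unit_edge) (concat gadget_trips))"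
  "trips net = map (map (real_edge \<circ> unit_edge)) gadget_trips"
  by (simp_all add: network_of_def gadget_input_def o_def flip: mset_map)

lemma real_unit_edge_simps:
  "tail (real_edge (unit_edge e)) = index (fst e)" "head (real_edge (unit_edge e)) = index (snd e)"
  "weight (real_edge (unit_edge e)) = 1"
  by (auto simp: real_edge_def unit_edge_def tail_def head_def weight_def split_def)

lemma successively_gadget_trip:
  "T \<in> set gadget_trips \<Longrightarrow> T \<noteq> [] \<and> successively (\<lambda>e e'. snd e = fst e') T"
  unfolding set_gadget_trips by (auto simp: slot_trip_def Let_def)

definition in_some_trip :: "node \<Rightarrow> bool" where
  "in_some_trip u \<longleftrightarrow> (\<exists>T\<in>set gadget_trips. \<exists>e\<in>set T. u = fst e \<or> u = snd e)"

lemma in_some_trip_single: "e \<in> set single_edges \<Longrightarrow> u = fst e \<or> u = snd e \<Longrightarrow> in_some_trip u"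
  unfolding in_some_trip_def by (rule bexI[of _ "[e]"]) (auto simp: set_gadget_trips)

lemma in_some_trip_slot:
  "e \<in> set (slot_trip j p) \<Longrightarrow> j < m \<Longrightarrow> p < 3 \<Longrightarrow> u = fst e \<or> u = snd e \<Longrightarrow> in_some_trip u"
  unfolding in_some_trip_def set_gadget_trips by blast

lemma in_some_trip_bridge: "in_some_trip (Var nv)" "in_some_trip (Clause 0)"
  unfolding in_some_trip_def set_gadget_trips by auto

lemma Chain_in_some_trip:
  assumes "v < nv" "a < D" "s \<le> 3 * m" shows "in_some_trip (Chain v a s)"
proof (cases "s < 3 * m \<and> L s = (v, a)")
  case True
  then have "s div 3 < m" "s mod 3 < 3" by (auto simp: less_mult_imp_div_less mult.commute)
  then show ?thesis
    by (intro in_some_trip_slot[of "(Chain v a s, Chain v a (Suc s))" "s div 3" "s mod 3"])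
      (use True in \<open>simp_all add: slot_trip_def Let_def\<close>)
next
  case False
  then show ?thesis
    using in_some_trip_single[OF single_edges_intros(2)[OF assms(1,2)]]
      in_some_trip_single[OF single_edges_intros(3)[OF assms(1,2), of s]] assms(3)
    by (cases "s = 3 * m") auto
qed

lemma valid_node_in_some_trip: "valid_node u \<Longrightarrow> in_some_trip u"
proof (cases u)
  case (Var v)
  assume "valid_node u"
  then show ?thesis
    using Var in_some_trip_bridge(1) in_some_trip_single[OF single_edges_intros(1)[of v 0]] D_pos
    by (cases "v = nv") auto
next
  case (Clause j)
  assume "valid_node u"
  then show ?thesis
    using Clause in_some_trip_bridge(2)
      in_some_trip_slot[of "(Clause (j - 1), Clause (Suc (j - 1)))" "j - 1" 0]
    by (cases j) (simp_all add: slot_trip_def Let_def)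
qed (simp_all add: Chain_in_some_trip in_some_trip_single[OF single_edges_intros(4)]
  in_some_trip_single[OF single_edges_intros(5)])

lemma is_trip_network_net: "is_trip_network net"
  unfolding is_trip_network_def
proof (intro conjI ballI)
  show "finite (nodes net)" by (simp add: net_simps)
next
  fix e assume "e \<in># edges net"
  then obtain T e' where "T \<in> set gadget_trips" "e' \<in> set T" "e = real_edge (unit_edge e')"
    by (auto simp: net_simps)
  then show "tail e \<in> nodes net" "head e \<in> nodes net" "0 < weight e" "\<exists>T\<in>set (trips net). e \<in> set T"
    using valid_trip_edge[of T "fst e'" "snd e'"] index_less
    by (auto simp: net_simps real_unit_edge_simps)
next
  fix T assume "T \<in> set (trips net)"
  then obtain T' where T': "T' \<in> set gadget_trips" "T = map (real_edge \<circ> unit_edge) T'"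
    by (auto simp: net_simps)
  then show "walk (edges net) T" using successively_gadget_trip[OF T'(1)]
    by (auto simp: walk_def net_simps successively_map real_unit_edge_simps elim: successively_mono)
next
  fix n assume "n \<in> nodes net"
  then have "valid_node (node_at n)" "index (node_at n) = n"
    using index_node_at by (auto simp: net_simps)
  moreover from this obtain T e where "T \<in> set gadget_trips" "e \<in> set T"
      "node_at n = fst e \<or> node_at n = snd e"
    using valid_node_in_some_trip unfolding in_some_trip_def by blast
  ultimately show "\<exists>T\<in>set (trips net). \<exists>e\<in>set T. n = tail e \<or> n = head e"
    by (intro bexI[of _ "map (real_edge \<circ> unit_edge) T"] bexI[of _ "real_edge (unit_edge e)"])
      (auto simp: net_simps real_unit_edge_simps)
qed

definition temp_edge :: "node \<Rightarrow> node \<Rightarrow> real \<Rightarrow> nat temporal_edge" where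
  "temp_edge u w \<theta> = (index u, index w, \<theta>, 1)"

lemma temp_edge_simps [simp]:
  "t_tail (temp_edge u w \<theta>) = index u" "t_head (temp_edge u w \<theta>) = index w"
  "t_start (temp_edge u w \<theta>) = \<theta>" "t_arrival (temp_edge u w \<theta>) = \<theta> + 1"
  by (simp_all add: temp_edge_def t_tail_def t_head_def t_start_def t_arrival_def t_travel_def)

lemma set_induced_edges:
  "set (induced_edges \<theta> (map (real_edge \<circ> unit_edge) T)) =
    {temp_edge (fst (T ! k)) (snd (T ! k)) (\<theta> + real k) | k. k < length T}"
proof -
  have "(\<Sum>j<k. weight (map (real_edge \<circ> unit_edge) T ! j)) = real k" if "k < length T" for k
    using that by (simp add: real_unit_edge_simps)
  then have "set (induced_edges \<theta> (map (real_edge \<circ> unit_edge) T)) =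
      (\<lambda>k. temp_edge (fst (T ! k)) (snd (T ! k)) (\<theta> + real k)) ` {0..<length T}"
    unfolding induced_edges_def set_map set_upt length_map
    by (intro image_cong refl) (simp add: temp_edge_def real_unit_edge_simps)
  then show ?thesis by auto
qed

lemma temporal_edges_iff:
  "f \<in># temporal_edges net \<tau> \<longleftrightarrow> (\<exists>i<length gadget_trips. \<exists>k<length (gadget_trips ! i).
     f = temp_edge (fst (gadget_trips ! i ! k)) (snd (gadget_trips ! i ! k)) (\<tau> i + real k))"
proof -
  have "set_mset (temporal_edges net \<tau>) =
      (\<Union>i<length gadget_trips. set
          (induced_edges (\<tau> i) (map (real_edge \<circ> unit_edge) (gadget_trips ! i))))"
    unfolding temporal_edges_def net_simps by (auto simp: set_mset_sum)
  then show ?thesis unfolding set_induced_edges by auto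
qed

lemma temporal_edges_cases:
  assumes "f \<in># temporal_edges net \<tau>"
  obtains (bridge) "f = temp_edge (Var nv) (Clause 0) (\<tau> 0)"
  | (cross) j p where "j < m" "p < 3"
      "f = temp_edge (Clause j) (Clause (Suc j)) (\<tau> (Suc (3 * j + p)))"
  | (detour) j p v a where "j < m" "p < 3" "L (3 * j + p) = (v, a)" "v < nv" "a < D"
      "f = temp_edge (Clause (Suc j)) (Chain v a (3 * j + p)) (\<tau> (Suc (3 * j + p)) + 1)"
  | (pass) s v a where "s < 3 * m" "L s = (v, a)" "v < nv" "a < D"
      "f = temp_edge (Chain v a s) (Chain v a (Suc s)) (\<tau> (Suc s) + 2)"
  | (single) u w \<theta> where "(u, w) \<in> set single_edges" "f = temp_edge u w \<theta>"
proof -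
  obtain i k where i: "i < length gadget_trips" and k: "k < length (gadget_trips ! i)"
    and f: "f = temp_edge (fst (gadget_trips ! i ! k)) (snd (gadget_trips ! i ! k)) (\<tau> i + real k)"
    using assms unfolding temporal_edges_iff by blast
  show thesis
    using i
  proof (cases rule: gadget_trips_cases)
    case bridge
    then show thesis using k f that(1) by (simp add: gadget_trips_nth(1))
  next
    case (slot j p)
    then have T: "gadget_trips ! i = slot_trip j p" by (simp add: gadget_trips_nth(2))
    then consider "k = 0" | "k = 1" | "k = 2"
      using k by (fastforce simp: slot_trip_def Let_def less_Suc_eq)
    then show thesis
      using that(2)[OF slot(1,2)] that(3)[OF slot(1,2) prod.collapse[symmetric]]
        that(4)[OF slot_less[OF slot(1,2)] prod.collapse[symmetric]] f T slot(3)
        literal_less[OF slot_less[OF slot(1,2)]]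
      by cases (auto simp: slot_trip_def Let_def)
  next
    case (single e)
    then show thesis using that(5)[of "fst e" "snd e"] k f by simp
  qed
qed

lemma temporal_edges_nth:
  "i < length gadget_trips \<Longrightarrow> gadget_trips ! i = T \<Longrightarrow> k < length T \<Longrightarrow>
    temp_edge (fst (T ! k)) (snd (T ! k)) (\<tau> i + real k) \<in># temporal_edges net \<tau>"
  unfolding temporal_edges_iff by blast


subsection \<open>From temporal paths to assignments\<close>

context
  fixes \<tau> :: temporalisation
begin

definition spent :: "nat \<Rightarrow> nat \<Rightarrow> real \<Rightarrow> bool" where
  "spent v a \<theta> \<longleftrightarrow> (\<forall>s<3 * m. L s = (v, a) \<longrightarrow> \<tau> (Suc s) + 3 \<le> \<theta>)"

definition chosen_upto :: "nat \<Rightarrow> real \<Rightarrow> bool" where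
  "chosen_upto v \<theta> \<longleftrightarrow> (\<forall>v'<v. \<exists>a<D. spent v' a \<theta>)"

definition crossed_upto :: "nat \<Rightarrow> bool" where
  "crossed_upto j \<longleftrightarrow> (\<forall>j'<j. \<exists>p<3. \<tau> 0 + 1 \<le> \<tau> (Suc (3 * j' + p)))"

definition solved :: bool where
  "solved \<longleftrightarrow> chosen_upto nv (\<tau> 0) \<and> crossed_upto m"

text \<open>What a path from a source certifies when it is at a node at time \<open>\<theta>\<close>. The disjuncts with the
  arrival time of the bridge account for paths that return from a clause to a chain.\<close>

fun path_inv :: "node \<Rightarrow> real \<Rightarrow> bool" where
  "path_inv (Var v) \<theta> \<longleftrightarrow> \<tau> 0 + 1 \<le> \<theta> \<or> chosen_upto v \<theta>"
| "path_inv (Chain v a s) \<theta> \<longleftrightarrow> \<tau> 0 + 1 \<le> \<theta> \<or>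
     chosen_upto v \<theta> \<and> (\<forall>s'<s. L s' = (v, a) \<longrightarrow> \<tau> (Suc s') + 3 \<le> \<theta>)"
| "path_inv (Clause j) \<theta> \<longleftrightarrow> \<tau> 0 + 1 \<le> \<theta> \<and> chosen_upto nv (\<tau> 0) \<and> crossed_upto j"
| "path_inv (Source i) \<theta> \<longleftrightarrow> True"
| "path_inv (Sink i) \<theta> \<longleftrightarrow> solved"

lemma chosen_upto_mono: "chosen_upto v \<theta> \<Longrightarrow> \<theta> \<le> \<theta>' \<Longrightarrow> chosen_upto v \<theta>'"
  unfolding chosen_upto_def spent_def by (meson order.trans)

lemma path_inv_mono: "path_inv u \<theta> \<Longrightarrow> \<theta> \<le> \<theta>' \<Longrightarrow> path_inv u \<theta>'"
  by (cases u) (auto intro: order.trans chosen_upto_mono)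

lemma path_inv_step:
  assumes f: "f \<in># temporal_edges net \<tau>" and inv: "path_inv (node_at (t_tail f)) (t_start f)"
  shows "path_inv (node_at (t_head f)) (t_arrival f)"
proof -
  have later: "chosen_upto v (\<theta> + 1)" if "chosen_upto v \<theta>" for v \<theta>
    using chosen_upto_mono[OF that] by simp
  show ?thesis
    using f
  proof (cases rule: temporal_edges_cases)
    case bridge
    then show ?thesis using inv by (auto simp: node_at_index crossed_upto_def)
  next
    case (cross j p)
    then have "crossed_upto (Suc j)" "chosen_upto nv (\<tau> 0)" "\<tau> 0 + 1 \<le> \<tau> (Suc (3 * j + p))"
      using inv by (auto simp: node_at_index crossed_upto_def less_Suc_eq)
    then show ?thesis using cross by (simp add: node_at_index)
  next
    case (detour j p v a)
    then have "\<tau> 0 + 1 \<le> \<tau> (Suc (3 * j + p)) + 1" using inv by (simp add: node_at_index)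
    then show ?thesis
      using detour slot_less[OF detour(1,2)] by (simp add: node_at_index less_imp_le)
  next
    case (pass s v a)
    then show ?thesis using inv later by (fastforce simp: node_at_index less_Suc_eq)
  next
    case (single u w \<theta>)
    from single(1) show ?thesis
    proof (cases rule: single_edges_cases)
      case (leave v a)
      then have "spent v a (\<theta> + 1)" if "\<not> \<tau> 0 + 1 \<le> \<theta>" "path_inv (Chain v a (3 * m)) \<theta>"
        using that by (fastforce simp: spent_def)
      then show ?thesis using inv leave single(2) later
        by (auto simp: node_at_index chosen_upto_def less_Suc_eq)
    qed (use inv single(2) later in \<open>fastforce simp: node_at_index less_Suc_eq chosen_upto_def
        solved_def\<close>)+
  qed
qed

lemma source_reaches_sink_imp_solved:
  assumes "temporally_reachable (temporal_edges net \<tau>) (index (Source i)) (index (Sink i'))" "i < K"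
      "i' < K"
  shows solved
proof -
  have "index (Source i) \<noteq> index (Sink i')" using assms(2) by (simp add: index.simps)
  then obtain fs where "temporal_path (temporal_edges net \<tau>) (index (Source i)) fs
      (index (Sink i'))"
    using assms(1) unfolding temporally_reachable_def by blast
  then have "path_inv (node_at (index (Sink i'))) (t_arrival (last fs))"
  proof (rule temporal_path_invariant)
    show "path_inv (node_at (index (Source i))) \<theta>" for \<theta>
      by (simp only: node_at_index valid_node.simps assms(2) path_inv.simps)
  qed (blast intro: path_inv_step path_inv_mono)
  then show solved by (simp only: node_at_index valid_node.simps assms(3) path_inv.simps)
qed

lemma temporal_edges_source_sink:
  assumes "f \<in># temporal_edges net \<tau>"
  shows "t_tail f < core_size + K" "t_head f < core_size \<or> core_size + K \<le> t_head f"
proof -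
  have chain: "v < nv \<Longrightarrow> a < D \<Longrightarrow> s \<le> 3 * m \<Longrightarrow> index (Chain v a s) < core_size + K" for v a s
    by (intro trans_less_add1 index_Chain_less)
  have "t_tail f < core_size + K \<and> (t_head f < core_size \<or> core_size + K \<le> t_head f)"
    using assms
    by (cases rule: temporal_edges_cases)
      (use core_size_ge slot_less in \<open>auto intro!: index_Chain_less chain simp: index.simps(1,2,4,5)
          elim!: single_edges_cases\<close>)
  then show "t_tail f < core_size + K" "t_head f < core_size \<or> core_size + K \<le> t_head f" by simp_all
qed

lemma reachable_from_outer_node:
  assumes reach: "temporally_reachable (temporal_edges net \<tau>) u v" and "core_size \<le> u"
      "v < num_nodes" "\<not> solved"
  shows "v = u \<or> v < core_size"
proof (rule ccontr)
  assume outer: "\<not> (v = u \<or> v < core_size)"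
  then obtain fs where fs: "temporal_path (temporal_edges net \<tau>) u fs v"
    using reach unfolding temporally_reachable_def by auto
  then have "hd fs \<in># temporal_edges net \<tau>" "last fs \<in># temporal_edges net \<tau>"
    unfolding temporal_path_def by (auto dest: hd_in_set last_in_set)
  then have "u < core_size + K" "core_size + K \<le> v"
    using fs outer temporal_edges_source_sink unfolding temporal_path_def by blast+
  then have "u = index (Source (u - core_size))" "v = index (Sink (v - (core_size + K)))"
    "u - core_size < K" "v - (core_size + K) < K"
    using assms(2,3) by (auto simp: num_nodes_def index.simps)
  then show False using source_reaches_sink_imp_solved reach assms(4) by metis
qed

lemma temporal_reachability_unsolved:
  assumes "\<not> solved"
  shows "temporal_reachability net \<tau> \<le> core_size * num_nodes + 2 * K * (core_size + 1)"
proof -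
  let ?R = "\<lambda>u. {v \<in> nodes net. temporally_reachable (temporal_edges net \<tau>) u v}"
  have all: "card (?R u) \<le> num_nodes" for u
    using card_mono[of "{..<num_nodes}" "?R u"] by (auto simp: net_simps)
  have outer: "card (?R u) \<le> core_size + 1" if "core_size \<le> u" for u
  proof -
    have "?R u \<subseteq> insert u {..<core_size}"
      using reachable_from_outer_node[OF _ that _ assms] by (auto simp: net_simps)
    then have "card (?R u) \<le> card (insert u {..<core_size})" by (intro card_mono) auto
    also have "\<dots> \<le> core_size + 1" using card_insert_le_m1[of "core_size + 1" "{..<core_size}" u]
      by simp
    finally show ?thesis .
  qed
  have split: "{..<num_nodes} = {..<core_size} \<union> {core_size..<num_nodes}"
    by (auto simp: num_nodes_def)
  have "temporal_reachability net \<tau> =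
      (\<Sum>u<core_size. card (?R u)) + (\<Sum>u=core_size..<num_nodes. card (?R u))"
    unfolding temporal_reachability_def net_simps(1) split by (rule sum.union_disjoint) auto
  also have "\<dots> \<le> (\<Sum>u<core_size. num_nodes) + (\<Sum>u=core_size..<num_nodes. core_size + 1)"
    by (intro add_mono sum_mono all outer) auto
  also have "\<dots> = core_size * num_nodes + 2 * K * (core_size + 1)" by (simp add: num_nodes_def)
  finally show ?thesis .
qed

lemma solved_imp_satisfying:
  assumes solved
  obtains f where "satisfying f"
    "\<And>s. s < 3 * m \<Longrightarrow> f (fst (L s)) = snd (L s) \<Longrightarrow> \<tau> (Suc s) < \<tau> 0"
    "\<And>j. j < m \<Longrightarrow> \<exists>p<3. \<tau> 0 \<le> \<tau> (Suc (3 * j + p))"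
proof -
  obtain f where f: "\<And>v. v < nv \<Longrightarrow> f v < D \<and> spent v (f v) (\<tau> 0)"
    using assms unfolding solved_def chosen_upto_def by metis
  have early: "\<tau> (Suc s) < \<tau> 0" if "s < 3 * m" "f (fst (L s)) = snd (L s)" for s
    using f[OF literal_less(1)[OF that(1)]] that by (fastforce simp: spent_def)
  have late: "\<exists>p<3. \<tau> 0 \<le> \<tau> (Suc (3 * j + p))" if "j < m" for j
    using assms that unfolding solved_def crossed_upto_def by fastforce
  have "\<exists>p<3. f (fst (L (3 * j + p))) \<noteq> snd (L (3 * j + p))" if j: "j < m" for j
    using late[OF j] early slot_less[OF j] by (meson not_less)
  then have "satisfying f" using f by (simp add: satisfying_def)
  then show thesis using early late by (rule that)
qed

end


subsection \<open>From assignments to temporal paths\<close>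

fun node_time :: "node \<Rightarrow> real" where
  "node_time (Var v) = real (v * (3 * m + 2))"
| "node_time (Chain v a s) = real (v * (3 * m + 2) + 1 + s)"
| "node_time (Clause j) = real (nv * (3 * m + 2) + 1 + j)"
| "node_time (Source i) = -1"
| "node_time (Sink i) = real (nv * (3 * m + 2) + 2 + m)"

text \<open>The trip of a slot either serves the chain of its literal, if this is chosen, or its clause.\<close>

definition schedule :: "(nat \<Rightarrow> nat) \<Rightarrow> temporalisation" where
  "schedule f i = (if 0 < i \<and> i \<le> 3 * m \<and> f (fst (L (i - 1))) = snd (L (i - 1))
     then node_time (Chain (fst (L (i - 1))) (snd (L (i - 1))) (i - 1)) - 2
     else node_time (fst (hd (gadget_trips ! i))))"

lemma bridge_in_schedule: "temp_edge (Var nv) (Clause 0) (node_time (Var nv))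
    \<in># temporal_edges net (schedule f)"
  using temporal_edges_nth[of 0 _ 0 "schedule f"]
  by (simp add: gadget_trips_nth(1) length_gadget_trips schedule_def)

lemma single_edge_in_schedule:
  assumes "(u, w) \<in> set single_edges"
  shows "temp_edge u w (node_time u) \<in># temporal_edges net (schedule f)"
proof -
  obtain i where "i < length single_edges" "single_edges ! i = (u, w)"
    using assms by (metis in_set_conv_nth)
  then show ?thesis
    using temporal_edges_nth[of "Suc (3 * m + i)" _ 0 "schedule f"]
    by (simp add: gadget_trips_nth(3) length_gadget_trips schedule_def)
qed

lemma cross_in_schedule:
  assumes "j < m" "p < 3" "f (fst (L (3 * j + p))) \<noteq> snd (L (3 * j + p))"
  shows "temp_edge (Clause j) (Clause (Suc j)) (node_time (Clause j))
      \<in># temporal_edges net (schedule f)"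
  using assms temporal_edges_nth[of "Suc (3 * j + p)" _ 0 "schedule f"]
  by (simp add: gadget_trips_nth(2) length_gadget_trips schedule_def slot_trip_def Let_def)

lemma pass_in_schedule:
  assumes v: "v < nv" "f v < D" and s: "s < 3 * m"
  shows "temp_edge (Chain v (f v) s) (Chain v (f v) (Suc s)) (node_time (Chain v (f v) s))
      \<in># temporal_edges net (schedule f)"
proof (cases "L s = (v, f v)")
  case True
  have "s div 3 < m" "s mod 3 < 3" "3 * (s div 3) + s mod 3 = s"
    using s by (auto simp: less_mult_imp_div_less mult.commute)
  then have "gadget_trips ! Suc s = slot_trip (s div 3) (s mod 3)"
    using gadget_trips_nth(2) by metis
  moreover have "schedule f (Suc s) + 2 = node_time (Chain v (f v) s)"
    using True s by (simp add: schedule_def)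
  ultimately show ?thesis
    using True s temporal_edges_nth[of "Suc s" _ 2 "schedule f"]
    by (simp add: length_gadget_trips slot_trip_def Let_def del: node_time.simps)
qed (intro single_edge_in_schedule single_edges_intros v s)

lemma reach_by_advance:
  "reach_by F x (index u) (node_time u) \<Longrightarrow> temp_edge u w (node_time u) \<in># F \<Longrightarrow>
    node_time w = node_time u + 1 \<Longrightarrow> reach_by F x (index w) (node_time w)"
  using reach_by_snoc[of F x "index u" "node_time u" "index w" "node_time u" 1]
  by (simp add: temp_edge_def)

lemma satisfying_reaches_var:
  assumes f: "satisfying f" and i: "i < K" and v: "v \<le> nv"
  shows "reach_by (temporal_edges net (schedule f)) (index (Source i)) (index (Var v))
      (node_time (Var v))"
  using v
proof (induction v)
  case 0
  show ?case
    using reach_by_edge[of "index (Source i)" "index (Var 0)"]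
        single_edge_in_schedule[OF single_edges_intros(4)[OF i]]
    by (fastforce simp: temp_edge_def)
next
  case (Suc v)
  let ?F = "temporal_edges net (schedule f)"
  have v: "v < nv" "f v < D" using Suc.prems f by (auto simp: satisfying_def)
  have "reach_by ?F (index (Source i)) (index (Chain v (f v) s)) (node_time (Chain v (f v) s))"
    if "s \<le> 3 * m" for s
    using that
  proof (induction s)
    case 0
    from Suc.IH show ?case
      by (rule reach_by_advance[OF _ single_edge_in_schedule[OF single_edges_intros(1)[OF v]]])
        (use v in simp_all)
  next
    case (Suc s)
    then show ?case by (intro reach_by_advance[OF _ pass_in_schedule[of v f s]] v) simp_all
  qed
  from this[of "3 * m"] show ?case
    by (rule reach_by_advance[OF _ single_edge_in_schedule[OF single_edges_intros(2)[OF v]]])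
      simp_all
qed

lemma satisfying_reaches_sink:
  assumes f: "satisfying f" and i: "i < K" "i' < K"
  shows "temporally_reachable (temporal_edges net (schedule f)) (index (Source i))
      (index (Sink i'))"
proof -
  let ?F = "temporal_edges net (schedule f)"
  have "reach_by ?F (index (Source i)) (index (Clause j)) (node_time (Clause j))" if "j \<le> m" for j
    using that
  proof (induction j)
    case 0
    show ?case
      by (rule reach_by_advance[OF satisfying_reaches_var[OF f i(1) le_refl] bridge_in_schedule])
        simp
  next
    case (Suc j)
    then have "j < m" by simp
    then obtain p where "p < 3" "f (fst (L (3 * j + p))) \<noteq> snd (L (3 * j + p))"
      using f unfolding satisfying_def by blast
    with Suc show ?case by (intro reach_by_advance[OF _ cross_in_schedule]) simp_all
  qed
  from this[of m] have "reach_by ?F (index (Source i)) (index (Sink i')) (node_time (Sink i'))"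
    by (rule reach_by_advance[OF _ single_edge_in_schedule[OF single_edges_intros(5)[OF i(2)]]])
      simp_all
  then show ?thesis unfolding temporally_reachable_def reach_by_def by blast
qed

lemma temporal_reachability_le: "temporal_reachability net \<tau> \<le> num_nodes * num_nodes"
proof -
  have "card {v \<in> nodes net. temporally_reachable (temporal_edges net \<tau>) u v} \<le> num_nodes" for u
    using card_mono[of "{..<num_nodes}" "{v
        \<in> nodes net. temporally_reachable (temporal_edges net \<tau>) u v}"]
    by (auto simp: net_simps)
  then show ?thesis
    unfolding temporal_reachability_def net_simps(1)
    using sum_bounded_above[of "{..<num_nodes}" _ num_nodes] by simp
qed

lemma max_reachability_satisfiable:
  assumes f: "satisfying f" shows "K * K \<le> max_reachability net"
proof -
  let ?R = "\<lambda>u. {v \<in> nodes net. temporally_reachable (temporal_edges net (schedule f)) u v}"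
  have "K \<le> card (?R u)" if u: "u \<in> {core_size..<core_size + K}" for u
  proof -
    have "(\<lambda>i. core_size + K + i) ` {..<K} \<subseteq> ?R u"
      using satisfying_reaches_sink[OF f, of "u - core_size"] u
      by (auto simp: net_simps num_nodes_def index.simps)
    moreover have "finite (?R u)" by (simp add: net_simps)
    ultimately have "card ((\<lambda>i. core_size + K + i) ` {..<K}) \<le> card (?R u)"
      by (rule card_mono[rotated])
    then show ?thesis by (simp add: card_image)
  qed
  then have "(\<Sum>u=core_size..<core_size + K. K) \<le> (\<Sum>u=core_size..<core_size + K. card (?R u))"
    by (rule sum_mono)
  also have "\<dots> \<le> temporal_reachability net (schedule f)"
    unfolding temporal_reachability_def by (rule sum_mono2) (auto simp: net_simps num_nodes_def)
  also have "\<dots> \<le> max_reachability net"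
    unfolding max_reachability_def
  proof (rule Max_ge)
    have "range (temporal_reachability net) \<subseteq> {..num_nodes * num_nodes}"
      using temporal_reachability_le by auto
    then show "finite (range (temporal_reachability net))" by (rule finite_subset) simp
  qed simp
  finally show ?thesis by simp
qed

end


section \<open>Runs of a stack machine as a constraint satisfaction problem\<close>

text \<open>In a grid \<open>g\<close>, the entry \<open>g t k i\<close> is meant to be the symbol at depth \<open>i\<close> of stack \<open>k < N\<close>
  after \<open>t\<close> steps; \<open>g t N 0\<close> is the control state. The literal \<open>(t, k, i, a)\<close> says that
  \<open>g t k i = a\<close>, and a clause is violated if all of its literals hold.\<close>

type_synonym grid = "nat \<Rightarrow> nat \<Rightarrow> nat \<Rightarrow> nat"
type_synonym grid_literal = "nat \<times> nat \<times> nat \<times> nat"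

definition satisfies :: "grid \<Rightarrow> grid_literal list list \<Rightarrow> bool" where
  "satisfies g cs \<longleftrightarrow> (\<forall>c\<in>set cs. \<exists>(t, k, i, a)\<in>set c. g t k i \<noteq> a)"

lemma satisfies_simps [simp]:
  "satisfies g []" "satisfies g (c # cs) \<longleftrightarrow> (\<exists>(t, k, i, a)\<in>set c. g t k i \<noteq> a) \<and> satisfies g cs"
  "satisfies g (cs @ ds) \<longleftrightarrow> satisfies g cs \<and> satisfies g ds"
  "satisfies g (concat (map F [0..<n])) \<longleftrightarrow> (\<forall>i<n. satisfies g (F i))"
  by (auto simp: satisfies_def)

definition assert_in :: "nat \<Rightarrow> nat \<Rightarrow> nat \<Rightarrow> nat \<Rightarrow> (nat \<Rightarrow> bool) \<Rightarrow> grid_literal list list" where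
  "assert_in D t k i R =
     concat (map (\<lambda>a. if R a then [] else [[(t, k, i, a), (t, k, i, a), (t, k, i, a)]]) [0..<D])"

definition assert_if :: "nat \<Rightarrow> grid_literal \<Rightarrow> grid_literal \<Rightarrow> grid_literal \<Rightarrow> grid_literal list list"
  where
  "assert_if D l l' = (\<lambda>(t, k, i, s).
     concat (map (\<lambda>b. if b = s then [] else [[l, l', (t, k, i, b)]]) [0..<D]))"

lemma satisfies_assert_in: "g t k i < D \<Longrightarrow> satisfies g (assert_in D t k i R) \<longleftrightarrow> R (g t k i)"
  by (auto simp: assert_in_def)

lemma satisfies_assert_if:
  "g t'' k'' i'' < D \<Longrightarrow> satisfies g (assert_if D (t, k, i, a) (t', k', i', a') (t'', k'', i'', s)) \<longleftrightarrow>
    (g t k i = a \<longrightarrow> g t' k' i' = a' \<longrightarrow> g t'' k'' i'' = s)"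
  by (auto simp: assert_if_def)

context finite_stack_machine
begin

definition num_values :: nat where
  "num_values = Q + 3"

definition copy_cell :: "nat \<Rightarrow> nat \<Rightarrow> nat \<Rightarrow> nat \<Rightarrow> nat \<Rightarrow> grid_literal list list" where
  "copy_cell t q k i i' =
     concat (map (\<lambda>a. assert_if num_values (t, N, 0, q) (t, k, i, a) (Suc t, k, i', a))
         [0..<num_values])"

definition write_cell :: "nat \<Rightarrow> nat \<Rightarrow> nat \<Rightarrow> nat \<Rightarrow> nat \<Rightarrow> grid_literal list list" where
  "write_cell t q k i s = assert_if num_values (t, N, 0, q) (t, N, 0, q) (Suc t, k, i, s)"

definition next_state :: "nat \<Rightarrow> nat \<Rightarrow> grid_literal list list" where
  "next_state t q = concat (map (\<lambda>a. assert_if num_values (t, N, 0, q) (t, stack_of S q, 0, a)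
     (Suc t, N, 0, next_of S q (symbol_bit a))) [0..<3])"

definition next_stack :: "nat \<Rightarrow> nat \<Rightarrow> nat \<Rightarrow> nat \<Rightarrow> grid_literal list list" where
  "next_stack W t q k = (case if k = stack_of S q then op_of S q else Nop of
       Nop \<Rightarrow> concat (map (\<lambda>i. copy_cell t q k i i) [0..<W])
     | PushOp c \<Rightarrow> write_cell t q k 0 (bit_symbol c) @
         concat (map (\<lambda>i. copy_cell t q k i (Suc i)) [0..<W - 1])
     | PopOp \<Rightarrow> concat (map (\<lambda>i. copy_cell t q k (Suc i) i) [0..<W - 1]) @
         write_cell t q k (W - 1) 0)"

definition step_clauses :: "nat \<Rightarrow> nat \<Rightarrow> grid_literal list list" where
  "step_clauses W t = concat (map (\<lambda>q. next_state t q @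
     concat (map (\<lambda>k. next_stack W t q k) [0..<N])) [0..<Q])"

definition initial_symbol :: "bool list \<Rightarrow> nat \<Rightarrow> nat \<Rightarrow> nat \<Rightarrow> nat \<Rightarrow> bool" where
  "initial_symbol x n k i a \<longleftrightarrow>
     (if k = 1 \<and> i < n then a = 1 \<or> a = 2 else a = (if k = 0 then cell x i else 0))"

definition initial_clauses :: "nat \<Rightarrow> bool list \<Rightarrow> nat \<Rightarrow> grid_literal list list" where
  "initial_clauses W x n = assert_in num_values 0 N 0 (\<lambda>a. a = 0) @
     concat (map (\<lambda>k. concat (map (\<lambda>i.
       assert_in num_values 0 k i (initial_symbol x n k i)) [0..<W])) [0..<N])"

definition final_clauses :: "nat \<Rightarrow> grid_literal list list" where
  "final_clauses T = assert_in num_values T N 0 (\<lambda>a. a = h) @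
     assert_in num_values T 2 0 (\<lambda>a. a = 2)"

text \<open>These clauses hold in every grid. They come first in order that the certificate can be read off
  from the times of the first \<open>3 * n\<close> slots.\<close>

definition certificate_clauses :: "nat \<Rightarrow> grid_literal list list" where
  "certificate_clauses n = concat (map (\<lambda>i. [[(0, 1, i, 2), (0, 1, i, 1), (0, 1, i, 1)]]) [0..<n])"

definition clauses :: "nat \<Rightarrow> bool list \<Rightarrow> nat \<Rightarrow> nat \<Rightarrow> grid_literal list list" where
  "clauses W x n T = certificate_clauses n @ initial_clauses W x n @
     concat (map (step_clauses W) [0..<T]) @ final_clauses T"

definition start :: "bool list \<Rightarrow> bool list \<Rightarrow> store" where
  "start x z = (\<lambda>_. [])(0 := x, 1 := z)"

definition run :: "bool list \<Rightarrow> bool list \<Rightarrow> nat \<Rightarrow> nat \<times> store" where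
  "run x z t = (sm_step S ^^ t) (0, start x z)"

definition accepts :: "bool list \<Rightarrow> bool list \<Rightarrow> nat \<Rightarrow> bool" where
  "accepts x z T \<longleftrightarrow> fst (run x z T) = h \<and> peek (snd (run x z T) 2) = Some True"

lemma run_simps: "run x z 0 = (0, start x z)" "run x z (Suc t) = sm_step S (run x z t)"
  by (simp_all add: run_def)

lemma run_state_less: "fst (run x z t) < Q"
  using halt_less next_of_less
  by (induction t) (auto simp: run_simps sm_step_def split: prod.splits)

lemma length_run: "length (snd (run x z t) k) \<le> length x + length z + t"
proof (induction t)
  case 0
  show ?case by (simp add: run_simps start_def)
next
  case (Suc t)
  have "length (snd (sm_step S c) k) \<le> Suc (length (snd c k))" for c
    using length_apply_op by (auto simp: sm_step_def split: prod.splits)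
  then show ?case using Suc.IH by (metis run_simps(2) Suc_le_mono add_Suc_right order.trans)
qed

definition row_holds :: "grid \<Rightarrow> nat \<Rightarrow> nat \<Rightarrow> nat \<times> store \<Rightarrow> bool" where
  "row_holds g W t = (\<lambda>(q, \<sigma>). g t N 0 = q \<and> (\<forall>k<N. \<forall>i<W. g t k i = cell (\<sigma> k) i))"

context
  fixes g :: grid and W T :: nat
  assumes bounded: "t \<le> T \<Longrightarrow> k \<le> N \<Longrightarrow> i < W \<Longrightarrow> g t k i < num_values"
    and W_pos: "0 < W"
begin

lemma satisfies_copy_cell:
  assumes "t < T" "k < N" "i < W" "i' < W"
  shows "satisfies g (copy_cell t q k i i') \<longleftrightarrow> (g t N 0 = q \<longrightarrow> g (Suc t) k i' = g t k i)"
  using bounded[of t k i] bounded[of "Suc t" k i'] assms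
  by (auto simp: copy_cell_def satisfies_assert_if)

lemma satisfies_write_cell:
  assumes "t < T" "k < N" "i < W"
  shows "satisfies g (write_cell t q k i s) \<longleftrightarrow> (g t N 0 = q \<longrightarrow> g (Suc t) k i = s)"
  using bounded[of "Suc t" k i] assms by (simp add: write_cell_def satisfies_assert_if)

lemma satisfies_next_state:
  assumes "t < T" "q < Q" "g t (stack_of S q) 0 = cell w 0"
  shows "satisfies g (next_state t q) \<longleftrightarrow> (g t N 0 = q \<longrightarrow> g (Suc t) N 0 = next_of S q (peek w))"
  using bounded[of "Suc t" N 0] W_pos assms cell_less[of w 0]
  by (auto simp: next_state_def satisfies_assert_if symbol_bit_cell)

lemma satisfies_next_stack:
  assumes t: "t < T" and k: "k < N" and w: "\<forall>i<W. g t k i = cell w i" "length w \<le> W"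
  shows "satisfies g (next_stack W t q k) \<longleftrightarrow> (g t N 0 = q \<longrightarrow>
    (\<forall>i<W. g (Suc t) k i = cell (apply_op (if k = stack_of S q then op_of S q else Nop) w) i))"
proof -
  obtain V where V: "W = Suc V" using W_pos by (cases W) auto
  note simps = satisfies_copy_cell[OF t k] satisfies_write_cell[OF t k] w(1) V
  show ?thesis
  proof (cases "if k = stack_of S q then op_of S q else Nop")
    case Nop
    then show ?thesis unfolding next_stack_def Nop by (auto simp: simps All_less_Suc)
  next
    case (PushOp c)
    show ?thesis unfolding next_stack_def PushOp by (auto simp: simps All_less_Suc2)
  next
    case PopOp
    have "cell (tl w) V = 0" using w(2) V by (simp add: cell_def)
    then show ?thesis unfolding next_stack_def PopOp by (auto simp: simps cell_tl All_less_Suc)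
  qed
qed

lemma satisfies_step_clauses:
  assumes t: "t < T" and q: "q < Q" and row: "row_holds g W t (q, \<sigma>)"
    and len: "\<And>k. length (\<sigma> k) \<le> W"
  shows "satisfies g (step_clauses W t) \<longleftrightarrow> row_holds g W (Suc t) (sm_step S (q, \<sigma>))"
proof -
  have row': "g t N 0 = q" "\<And>k. k < N \<Longrightarrow> \<forall>i<W. g t k i = cell (\<sigma> k) i"
    using row by (auto simp: row_holds_def)
  have "satisfies g (next_state t q') \<longleftrightarrow>
      (q = q' \<longrightarrow> g (Suc t) N 0 = next_of S q (peek (\<sigma> (stack_of S q))))"
    if "q' < Q" for q'
    using satisfies_next_state[OF t that, of "\<sigma> (stack_of S q')"] row' W_pos stack_of_less[OF that]
    by auto
  moreover have "satisfies g (next_stack W t q' k) \<longleftrightarrow> (q = q' \<longrightarrow>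
      (\<forall>i<W. g (Suc t) k i = cell (snd (sm_step S (q, \<sigma>)) k) i))" if "k < N" for q' k
    using satisfies_next_stack[OF t that row'(2)[OF that] len, of q'] row'(1)
    by (auto simp: sm_step_def)
  ultimately show ?thesis using q by (auto simp: step_clauses_def row_holds_def sm_step_def)
qed

lemma satisfies_all_steps:
  assumes "row_holds g W 0 (run x z 0)" "length x + length z + T \<le> W" "s \<le> T"
  shows "satisfies g (concat (map (step_clauses W) [0..<s])) \<longleftrightarrow> (\<forall>t\<le>s. row_holds g W t (run x z t))"
  using assms(3)
proof (induction s)
  case 0
  then show ?case using assms(1) by simp
next
  case (Suc s)
  have "length (snd (run x z s) k) \<le> W" for k
    using length_run[of x z s k] assms(2) Suc.prems by linarith
  then have "satisfies g (step_clauses W s) \<longleftrightarrow> row_holds g W (Suc s) (run x z (Suc s))"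
    if "row_holds g W s (run x z s)"
    using satisfies_step_clauses[of s "fst (run x z s)" "snd (run x z s)"] Suc.prems that
        run_state_less
    by (simp add: run_simps)
  then show ?case using Suc by (auto simp: le_Suc_eq)
qed

lemma satisfies_initial_clauses:
  assumes "1 < N" "n \<le> W"
  shows "satisfies g (initial_clauses W x n) \<longleftrightarrow> (\<exists>z. length z = n \<and> row_holds g W 0 (run x z 0))"
proof -
  have iff: "satisfies g (initial_clauses W x n) \<longleftrightarrow>
      g 0 N 0 = 0 \<and> (\<forall>k<N. \<forall>i<W. initial_symbol x n k i (g 0 k i))"
    using bounded[of 0] W_pos by (simp add: initial_clauses_def satisfies_assert_in)
  show ?thesis
  proof
    assume sat: "satisfies g (initial_clauses W x n)"
    let ?z = "map (\<lambda>i. g 0 1 i = 2) [0..<n]"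
    have "g 0 k i = cell (start x ?z k) i" if "k < N" "i < W" for k i
    proof -
      have "initial_symbol x n k i (g 0 k i)" using sat that by (simp add: iff)
      then show ?thesis
        by (auto simp: initial_symbol_def start_def cell_def bit_symbol_def split: if_splits)
    qed
    then have "row_holds g W 0 (run x ?z 0)" using sat by (simp add: row_holds_def run_simps iff)
    then show "\<exists>z. length z = n \<and> row_holds g W 0 (run x z 0)" by (intro exI[of _ ?z]) simp
  next
    assume "\<exists>z. length z = n \<and> row_holds g W 0 (run x z 0)"
    then obtain z where z: "length z = n" "row_holds g W 0 (run x z 0)" by blast
    have "initial_symbol x n k i (cell (start x z k) i)" for k i
      using z(1) by (auto simp: initial_symbol_def start_def cell_def bit_symbol_def)
    then show "satisfies g (initial_clauses W x n)"
      using z(2) by (simp add: iff row_holds_def run_simps)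
  qed
qed

lemma satisfies_final_clauses:
  assumes "2 < N" "row_holds g W T (run x z T)"
  shows "satisfies g (final_clauses T) \<longleftrightarrow> accepts x z T"
proof -
  have "g T 2 0 = 2 \<longleftrightarrow> peek (snd (run x z T) 2) = Some True"
    using assms W_pos
    by (cases "snd (run x z T) 2") (auto simp: row_holds_def bit_symbol_def split: prod.splits)
  moreover have "g T N 0 = fst (run x z T)"
    using assms(2) by (auto simp: row_holds_def split: prod.splits)
  ultimately show ?thesis
    using bounded[of T N 0] bounded[of T 2 0] assms(1) W_pos
    by (simp add: final_clauses_def satisfies_assert_in accepts_def)
qed

theorem satisfies_clauses:
  assumes N: "2 < N" and W: "length x + n + T \<le> W"
  shows "satisfies g (clauses W x n T) \<longleftrightarrow>
    (\<exists>z. length z = n \<and> (\<forall>t\<le>T. row_holds g W t (run x z t)) \<and> accepts x z T)"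
proof -
  have "satisfies g (certificate_clauses n)" by (auto simp: satisfies_def certificate_clauses_def)
  then have "satisfies g (clauses W x n T) \<longleftrightarrow> (\<exists>z. length z = n \<and> row_holds g W 0 (run x z 0) \<and>
      satisfies g (concat (map (step_clauses W) [0..<T])) \<and> satisfies g (final_clauses T))"
    using satisfies_initial_clauses[of n x] N W
    by (auto simp: clauses_def simp del: satisfies_simps(4))
  also have "\<dots> \<longleftrightarrow> (\<exists>z. length z = n \<and> (\<forall>t\<le>T. row_holds g W t (run x z t)) \<and> accepts x z T)"
    using satisfies_all_steps[of x _ T] satisfies_final_clauses[OF N] W
    by (metis order_refl zero_le)
  finally show ?thesis .
qed

end


subsection \<open>The network of a machine\<close>

definition number_of_variables :: "nat \<Rightarrow> nat \<Rightarrow> nat" where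
  "number_of_variables W T = (T + 1) * (N + 1) * W"

definition variable :: "nat \<Rightarrow> grid" where
  "variable W t k i = (t * (N + 1) + k) * W + i"

definition numbered :: "nat \<Rightarrow> grid_literal \<Rightarrow> nat \<times> nat" where
  "numbered W = (\<lambda>(t, k, i, a). (variable W t k i, a))"

definition grid_assignment :: "nat \<Rightarrow> grid \<Rightarrow> nat \<Rightarrow> nat" where
  "grid_assignment W g v = g (v div W div (N + 1)) (v div W mod (N + 1)) (v mod W)"

lemma variable_less:
  assumes "t \<le> T" "k \<le> N" "i < W" shows "variable W t k i < number_of_variables W T"
proof -
  have "Suc (t * (N + 1) + k) \<le> Suc t * (N + 1)" using assms(2) by simp
  also have "\<dots> \<le> (T + 1) * (N + 1)" using assms(1) by (intro mult_right_mono) auto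
  finally have "Suc (t * (N + 1) + k) * W \<le> number_of_variables W T"
    unfolding number_of_variables_def by (rule mult_right_mono) simp
  moreover have "variable W t k i < Suc (t * (N + 1) + k) * W"
    using assms(3) by (simp add: variable_def)
  ultimately show ?thesis by linarith
qed

lemma grid_assignment_variable:
  assumes "k \<le> N" "i < W" shows "grid_assignment W g (variable W t k i) = g t k i"
proof -
  have "variable W t k i div W = t * (N + 1) + k" "variable W t k i mod W = i"
    using assms(2) by (simp_all add: variable_def)
  moreover have "(t * (N + 1) + k) div (N + 1) = t" "(t * (N + 1) + k) mod (N + 1) = k"
    using assms(1) by (simp_all only: div_mult_self3 mod_mult_self3) simp_all
  ultimately show ?thesis by (simp only: grid_assignment_def)
qed

definition valid_clauses :: "nat \<Rightarrow> nat \<Rightarrow> grid_literal list list \<Rightarrow> bool" where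
  "valid_clauses W T cs \<longleftrightarrow>
     (\<forall>c\<in>set cs. length c = 3 \<and> (\<forall>(t, k, i, a)\<in>set c. t \<le> T \<and> k \<le> N \<and> i < W \<and> a < num_values))"

lemma valid_clauses_simps [simp]:
  "valid_clauses W T []" "valid_clauses W T (cs @ ds) \<longleftrightarrow> valid_clauses W T cs \<and> valid_clauses W T ds"
  "valid_clauses W T (concat (map F [0..<n])) \<longleftrightarrow> (\<forall>i<n. valid_clauses W T (F i))"
  by (simp_all add: valid_clauses_def ball_Un atLeast0LessThan Ball_def[of "{..<n}"])

lemma valid_assert_in: "t \<le> T \<Longrightarrow> k \<le> N \<Longrightarrow> i < W \<Longrightarrow> valid_clauses W T (assert_in num_values t k i R)"
  by (auto simp: valid_clauses_def assert_in_def)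

lemma valid_assert_if:
  "t < T \<Longrightarrow> q < Q \<Longrightarrow> k \<le> N \<Longrightarrow> i < W \<Longrightarrow> a < num_values \<Longrightarrow> k' \<le> N \<Longrightarrow> i' < W \<Longrightarrow>
    valid_clauses W T (assert_if num_values (t, N, 0, q) (t, k, i, a) (Suc t, k', i', s))"
  by (auto simp: valid_clauses_def assert_if_def num_values_def)

lemma less_num_values: "q < Q \<Longrightarrow> q < num_values" "a < 3 \<Longrightarrow> a < num_values"
  by (simp_all add: num_values_def)

lemma valid_step_clauses:
  assumes "t < T" "0 < W" shows "valid_clauses W T (step_clauses W t)"
proof -
  have "valid_clauses W T (copy_cell t q k i i')" if "q < Q" "k < N" "i < W" "i' < W" for q k i i'
    using that assms by (simp add: copy_cell_def valid_assert_if)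
  moreover have "valid_clauses W T (write_cell t q k i s)" if "q < Q" "k < N" "i < W" for q k i s
    using that assms less_num_values by (simp add: write_cell_def valid_assert_if)
  moreover have "valid_clauses W T (next_state t q)" if "q < Q" for q
    using that assms stack_of_less[OF that] less_num_values
    by (simp add: next_state_def valid_assert_if)
  ultimately show ?thesis
    using assms(2) by (auto simp: step_clauses_def next_stack_def split: stack_op.splits)
qed

lemma valid_clauses_clauses:
  assumes "2 < N" "n \<le> W" "0 < W" shows "valid_clauses W T (clauses W x n T)"
proof -
  have "valid_clauses W T (certificate_clauses n)"
    using assms by (auto simp: valid_clauses_def certificate_clauses_def num_values_def)
  then show ?thesis
    using assms by (simp add: clauses_def initial_clauses_def final_clauses_def
        valid_assert_in valid_step_clauses)
qed

definition run_width :: "bool list \<Rightarrow> nat \<Rightarrow> nat \<Rightarrow> nat" where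
  "run_width x n T = Suc (length x + n + T)"

definition run_clauses :: "bool list \<Rightarrow> nat \<Rightarrow> nat \<Rightarrow> grid_literal list list" where
  "run_clauses x n T = clauses (run_width x n T) x n T"

definition slot_literal :: "bool list \<Rightarrow> nat \<Rightarrow> nat \<Rightarrow> nat \<Rightarrow> nat \<times> nat" where
  "slot_literal x n T s = numbered (run_width x n T) (concat (run_clauses x n T) ! s)"

definition run_input :: "bool list \<Rightarrow> nat \<Rightarrow> nat \<Rightarrow> nat \<Rightarrow> mrtt_input" where
  "run_input x n T K = csp_gadget.gadget_input (number_of_variables (run_width x n T) T) num_values
     (length (run_clauses x n T)) K (slot_literal x n T)"

definition base_size :: "bool list \<Rightarrow> nat \<Rightarrow> nat \<Rightarrow> nat" where
  "base_size x n T = csp_gadget.core_size (number_of_variables (run_width x n T) T) num_values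
     (length (run_clauses x n T))"

context
  fixes x :: "bool list" and n T K :: nat
  assumes N: "2 < N"
begin

private abbreviation "width \<equiv> run_width x n T"
private abbreviation "cs \<equiv> run_clauses x n T"
private abbreviation "lit \<equiv> slot_literal x n T"

lemma valid_run_clauses: "valid_clauses width T cs"
  unfolding run_clauses_def using N by (intro valid_clauses_clauses) (auto simp: run_width_def)

lemma slot_literal_nth: "j < length cs \<Longrightarrow> p < 3 \<Longrightarrow> lit (3 * j + p) = numbered width (cs ! j ! p)"
  using valid_run_clauses nth_concat_uniform[of cs 3 j p]
  by (auto simp: slot_literal_def valid_clauses_def mult.commute)

interpretation net: csp_network "number_of_variables width T" "num_values" "length cs" K lit
proof
  fix s assume "s < 3 * length cs"
  then have j: "s div 3 < length cs" by (simp add: less_mult_imp_div_less mult.commute)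
  obtain t k i a where l: "cs ! (s div 3) ! (s mod 3) = (t, k, i, a)" by (metis surj_pair)
  have "length (cs ! (s div 3)) = 3" using valid_run_clauses j by (simp add: valid_clauses_def)
  then have "(t, k, i, a) \<in> set (cs ! (s div 3))" by (simp flip: l)
  then have "t \<le> T \<and> k \<le> N \<and> i < width \<and> a < num_values"
    using valid_run_clauses nth_mem[OF j] unfolding valid_clauses_def by blast
  moreover have "lit s = numbered width (t, k, i, a)"
    using slot_literal_nth[OF j, of "s mod 3"] by (simp add: l)
  ultimately show "fst (lit s) < number_of_variables width T" "snd (lit s) < num_values"
    using variable_less by (simp_all add: numbered_def)
qed (simp add: num_values_def)

lemma satisfying_iff:
  "net.satisfying f \<longleftrightarrow> (\<forall>v<number_of_variables width T. f v < num_values) \<and>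
     satisfies (\<lambda>t k i. f (variable width t k i)) cs"
proof -
  have "(\<exists>p<3. f (fst (lit (3 * j + p))) \<noteq> snd (lit (3 * j + p))) \<longleftrightarrow>
      (\<exists>(t, k, i, a)\<in>set (cs ! j). f (variable width t k i) \<noteq> a)" if "j < length cs" for j
  proof -
    have "length (cs ! j) = 3" using valid_run_clauses that by (simp add: valid_clauses_def)
    then have "(\<exists>p<3. f (fst (numbered width (cs ! j ! p))) \<noteq> snd (numbered width (cs ! j ! p))) \<longleftrightarrow>
        (\<exists>(t, k, i, a)\<in>set (cs ! j). f (variable width t k i) \<noteq> a)"
      by (force simp: in_set_conv_nth numbered_def split_def)
    then show ?thesis by (simp add: slot_literal_nth[OF that] cong: conj_cong)
  qed
  then show ?thesis unfolding net.satisfying_def satisfies_def by (auto simp: all_set_conv_all_nth)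
qed

lemma run_input_network:
  "is_trip_network (network_of (run_input x n T K))"
  "nodes (network_of (run_input x n T K)) = {..<base_size x n T + 2 * K}"
  "3 * n < length (trips (network_of (run_input x n T K)))"
proof -
  have "n \<le> length cs"
    by (simp add: run_clauses_def clauses_def certificate_clauses_def concat_map_singleton)
  then show "3 * n < length (trips (network_of (run_input x n T K)))"
    by (simp add: run_input_def net.net_simps net.length_gadget_trips)
qed (simp_all add: run_input_def base_size_def net.is_trip_network_net net.net_simps
  net.num_nodes_def)

theorem max_reachability_accepts:
  assumes "length z = n" "accepts x z T"
  shows "K * K \<le> max_reachability (network_of (run_input x n T K))"
  unfolding run_input_def
proof (rule net.max_reachability_satisfiable)
  define g where "g = (\<lambda>t k i. if k = N then fst (run x z t) else cell (snd (run x z t) k) i)"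
  let ?f = "grid_assignment width g"
  let ?g = "\<lambda>t k i. ?f (variable width t k i)"
  have bounded: "g t k i < num_values" for t k i
    using run_state_less[of x z t] cell_less by (simp add: g_def less_num_values)
  have "row_holds ?g width t (run x z t)" for t
    by (simp add: row_holds_def grid_assignment_variable g_def run_width_def split: prod.splits)
  then have "satisfies ?g cs"
    unfolding run_clauses_def
    using assms N bounded by (subst satisfies_clauses[where W = width and T = T])
      (auto simp: grid_assignment_def run_width_def)
  then show "net.satisfying ?f" using bounded by (simp add: satisfying_iff grid_assignment_def)
qed

lemma certificate_bit:
  fixes \<tau> :: temporalisation
  assumes i: "i < n" and f: "f (variable width 0 1 i) = bit_symbol b"
    and early: "\<And>s. s < 3 * length cs \<Longrightarrow> f (fst (lit s)) = snd (lit s) \<Longrightarrow> \<tau> (Suc s) < \<tau> 0"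
    and late: "\<And>j. j < length cs \<Longrightarrow> \<exists>p<3. \<tau> 0 \<le> \<tau> (Suc (3 * j + p))"
  shows "\<tau> (Suc (3 * i)) < \<tau> 0 \<longleftrightarrow> b"
proof -
  have j: "i < length cs" "cs ! i = [(0, 1, i, 2), (0, 1, i, 1), (0, 1, i, 1)]"
    using i by (simp_all add: run_clauses_def clauses_def certificate_clauses_def
        concat_map_singleton nth_append)
  have slots: "\<tau> (Suc (3 * i + p)) < \<tau> 0" if "p < 3" "bit_symbol b = [2, 1, 1] ! p" for p
  proof (rule early)
    show "3 * i + p < 3 * length cs" using j(1) that(1) by (rule slot_less)
    show "f (fst (lit (3 * i + p))) = snd (lit (3 * i + p))"
      unfolding slot_literal_nth[OF j(1) that(1)]
      using that f by (auto simp: j(2) numbered_def less_Suc_eq numeral_3_eq_3)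
  qed
  show ?thesis
  proof (cases b)
    case True
    then show ?thesis using slots[of 0] by (simp add: bit_symbol_def)
  next
    case False
    then have "\<tau> (Suc (3 * i + 1)) < \<tau> 0" "\<tau> (Suc (3 * i + 2)) < \<tau> 0"
      using slots[of 1] slots[of 2] by (simp_all add: bit_symbol_def)
    then show ?thesis using late[OF j(1)] False by (auto simp: less_Suc_eq numeral_3_eq_3)
  qed
qed

theorem accepts_of_reachability:
  assumes "base_size x n T * (base_size x n T + 2 * K) + 2 * K * (base_size x n T + 1)
    < temporal_reachability (network_of (run_input x n T K)) \<tau>"
  shows "accepts x (map (\<lambda>i. \<tau> (Suc (3 * i)) < \<tau> 0) [0..<n]) T"
proof -
  have "net.solved \<tau>"
    using assms net.temporal_reachability_unsolved[of \<tau>]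
    by (auto simp: run_input_def base_size_def net.num_nodes_def)
  then obtain f where f: "net.satisfying f"
    and early: "\<And>s. s < 3 * length cs \<Longrightarrow> f (fst (lit s)) = snd (lit s) \<Longrightarrow> \<tau> (Suc s) < \<tau> 0"
    and late: "\<And>j. j < length cs \<Longrightarrow> \<exists>p<3. \<tau> 0 \<le> \<tau> (Suc (3 * j + p))"
    by (rule net.solved_imp_satisfying) blast
  define g where "g = (\<lambda>t k i. f (variable width t k i))"
  have bounded: "g t k i < num_values" if "t \<le> T" "k \<le> N" "i < width" for t k i
    using f variable_less[OF that] by (simp add: satisfying_iff g_def)
  have "satisfies g cs" using f by (simp add: satisfying_iff g_def)
  then obtain z where z: "length z = n" "row_holds g width 0 (run x z 0)" "accepts x z T"
    using satisfies_clauses[where T = T and W = width and x = x and n = n, OF bounded _ N]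
    by (auto simp: run_clauses_def run_width_def)
  have "\<tau> (Suc (3 * i)) < \<tau> 0 \<longleftrightarrow> z ! i" if i: "i < n" for i
  proof (rule certificate_bit[OF i _ early late])
    have "g 0 1 i = bit_symbol (z ! i)"
      using z(1,2) N i by (simp add: row_holds_def run_simps start_def cell_def run_width_def)
    then show "f (variable width 0 1 i) = bit_symbol (z ! i)" by (simp add: g_def)
  qed
  then have "map (\<lambda>i. \<tau> (Suc (3 * i)) < \<tau> 0) [0..<n] = z" using z(1) by (intro nth_equalityI) auto
  then show ?thesis using z(3) by simp
qed

end

end


section \<open>Computing the reduction\<close>

subsection \<open>The clauses\<close>

context finite_stack_machine
begin

definition polytime_literal :: 
    "nat \<Rightarrow> (bool list list \<Rightarrow> nat) \<Rightarrow> (bool list list \<Rightarrow> grid_literal) \<Rightarrow> bool" where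
  "polytime_literal m W l \<longleftrightarrow>
     polytime_nat m (\<lambda>e. fst (numbered (W e) (l e))) \<and>
         polytime_nat m (\<lambda>e. snd (numbered (W e) (l e)))"

definition literal_nats :: "nat \<Rightarrow> grid_literal list list \<Rightarrow> nat list" where
  "literal_nats W cs = concat (map (\<lambda>l. [fst (numbered W l), snd (numbered W l)]) (concat cs))"

definition polytime_clauses ::
    "nat \<Rightarrow> (bool list list \<Rightarrow> nat) \<Rightarrow> (bool list list \<Rightarrow> grid_literal list list) \<Rightarrow> bool" where
  "polytime_clauses m W C \<longleftrightarrow>
     polytime_nats m (\<lambda>e. literal_nats (W e) (C e)) \<and> polytime_nat m (\<lambda>e. length (C e))"

lemma literal_nats_append: "literal_nats W (cs @ ds) = literal_nats W cs @ literal_nats W ds"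
  by (simp add: literal_nats_def)

lemma literal_nats_concat: "literal_nats W (concat Cs) = concat (map (literal_nats W) Cs)"
  by (induction Cs) (simp_all add: literal_nats_append, simp add: literal_nats_def)

lemma polytime_literalI:
  "polytime_nat m W \<Longrightarrow> polytime_nat m t \<Longrightarrow> polytime_nat m k \<Longrightarrow> polytime_nat m i \<Longrightarrow> polytime_nat m a \<Longrightarrow>
    polytime_literal m W (\<lambda>e. (t e, k e, i e, a e))"
  unfolding polytime_literal_def numbered_def variable_def prod.case fst_conv snd_conv
  by (intro conjI polytime_nat_intros)

lemma polytime_clauses_Nil: "polytime_clauses m W (\<lambda>e. [])"
  by (simp add: polytime_clauses_def literal_nats_def polytime_nats_Nil polytime_nat_const)

lemma polytime_clauses_append:
  "polytime_clauses m W C \<Longrightarrow> polytime_clauses m W C' \<Longrightarrow> polytime_clauses m W (\<lambda>e. C e @ C' e)"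
  by (simp add: polytime_clauses_def literal_nats_append polytime_nats_append polytime_nat_add)

lemma polytime_clauses_single:
  "polytime_literal m W l \<Longrightarrow> polytime_literal m W l' \<Longrightarrow> polytime_literal m W l'' \<Longrightarrow>
    polytime_clauses m W (\<lambda>e. [[l e, l' e, l'' e]])"
  by (simp add: polytime_clauses_def literal_nats_def polytime_literal_def polytime_nat_const
      polytime_nats_Nil polytime_nats_Cons)

lemma polytime_clauses_concat:
  "(\<And>a. a \<in> set xs \<Longrightarrow> polytime_clauses m W (C a)) \<Longrightarrow>
    polytime_clauses m W (\<lambda>e. concat (map (\<lambda>a. C a e) xs))"
  by (induction xs) (simp_all add: polytime_clauses_Nil polytime_clauses_append)

lemma polytime_clauses_for:
  assumes "polytime_clauses (Suc m) (\<lambda>e. W (tl e)) (\<lambda>e. C (length (arg 0 e)) (tl e))"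
      "polytime_nat m n"
  shows "polytime_clauses m W (\<lambda>e. concat (map (\<lambda>i. C i e) [0..<n e]))"
proof -
  have "length (concat (map (\<lambda>i. C i e) [0..<k])) = (\<Sum>i<k. length (C i e))" for e k
    by (induction k) simp_all
  then show ?thesis
    using assms polytime_nats_for[of m "\<lambda>i e. literal_nats (W e) (C i e)" n]
      polytime_nat_sum[of m "\<lambda>i e. length (C i e)" n]
    by (simp add: polytime_clauses_def literal_nats_concat o_def)
qed

lemma polytime_clauses_if:
  "polytime_pred m P \<Longrightarrow> polytime_clauses m W C \<Longrightarrow> polytime_clauses m W C' \<Longrightarrow>
    polytime_clauses m W (\<lambda>e. if P e then C e else C' e)"
  unfolding polytime_clauses_def polytime_nats_def if_distrib[of "literal_nats _"]
    if_distrib[of length] if_distrib[of enc_nats]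
  by (intro conjI polytime_if polytime_nat_if) auto

lemma polytime_clauses_assert_in:
  "(\<And>a. polytime_pred m (\<lambda>e. R e a)) \<Longrightarrow>
    polytime_nat m W \<Longrightarrow> polytime_nat m t \<Longrightarrow> polytime_nat m k \<Longrightarrow> polytime_nat m i \<Longrightarrow>
    polytime_clauses m W (\<lambda>e. assert_in D (t e) (k e) (i e) (R e))"
  unfolding assert_in_def
  by (intro polytime_clauses_concat polytime_clauses_if polytime_clauses_single polytime_clauses_Nil
      polytime_literalI polytime_nat_const)

lemma polytime_clauses_assert_if:
  "polytime_literal m W l \<Longrightarrow> polytime_literal m W l' \<Longrightarrow> polytime_nat m W \<Longrightarrow> polytime_nat m t \<Longrightarrow>
    polytime_nat m k \<Longrightarrow> polytime_nat m i \<Longrightarrow> polytime_nat m s \<Longrightarrow>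
    polytime_clauses m W (\<lambda>e. assert_if D (l e) (l' e) (t e, k e, i e, s e))"
  unfolding assert_if_def prod.case
  by (intro polytime_clauses_concat polytime_clauses_if polytime_clauses_single polytime_clauses_Nil
      polytime_literalI polytime_nat_const polytime_pred_eq)

lemma polytime_clauses_copy_cell:
  "polytime_nat m W \<Longrightarrow> polytime_nat m t \<Longrightarrow> polytime_nat m i \<Longrightarrow> polytime_nat m i' \<Longrightarrow>
    polytime_clauses m W (\<lambda>e. copy_cell (t e) q k (i e) (i' e))"
  unfolding copy_cell_def
  by (intro polytime_clauses_concat polytime_clauses_assert_if polytime_literalI polytime_nat_const
    polytime_nat_Suc)

lemma polytime_clauses_write_cell:
  "polytime_nat m W \<Longrightarrow> polytime_nat m t \<Longrightarrow> polytime_nat m i \<Longrightarrow>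
    polytime_clauses m W (\<lambda>e. write_cell (t e) q k (i e) s)"
  unfolding write_cell_def
  by (intro polytime_clauses_assert_if polytime_literalI polytime_nat_const polytime_nat_Suc)

lemma polytime_clauses_next_state:
  "polytime_nat m W \<Longrightarrow> polytime_nat m t \<Longrightarrow> polytime_clauses m W (\<lambda>e. next_state (t e) q)"
  unfolding next_state_def
  by (intro polytime_clauses_concat polytime_clauses_assert_if polytime_literalI polytime_nat_const
    polytime_nat_Suc)

lemma polytime_clauses_next_stack:
  "polytime_nat m W \<Longrightarrow> polytime_nat m t \<Longrightarrow> polytime_clauses m W (\<lambda>e. next_stack (W e) (t e) q k)"
  unfolding next_stack_def
  by (cases "if k = stack_of S q then op_of S q else Nop"; simp only: stack_op.case;
      intro polytime_clauses_append polytime_clauses_for polytime_clauses_copy_cell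
          polytime_clauses_write_cell
        polytime_nat_intros polytime_nat_tl_args)

lemma polytime_pred_initial_symbol:
  assumes "polytime m x" "polytime_nat m n" "polytime_nat m i"
  shows "polytime_pred m (\<lambda>e. initial_symbol (x e) (n e) k (i e) a)"
proof -
  let ?s = "\<lambda>e. if k = 0 then cell (x e) (i e) else 0"
  have "polytime_nat m ?s"
    by (cases "k = 0") (simp_all add: polytime_nat_cell polytime_nat_const assms)
  then have eq: "polytime_pred m (\<lambda>e. a = ?s e)" by (intro polytime_pred_eq polytime_nat_const)
  then have "polytime_pred m (\<lambda>e. if i e < n e then a = 1 \<or> a = 2 else a = ?s e)"
    by (intro polytime_pred_if polytime_pred_less polytime_pred_const assms)
  with eq show ?thesis
    unfolding initial_symbol_def by (cases "k = 1"; simp only: simp_thms if_False)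
qed

lemma polytime_clauses_clauses:
  assumes W: "polytime_nat m W" and x: "polytime m x" and n: "polytime_nat m n"
    and T: "polytime_nat m T"
  shows "polytime_clauses m W (\<lambda>e. clauses (W e) (x e) (n e) (T e))"
proof -
  have certificate: "polytime_clauses m W (\<lambda>e. certificate_clauses (n e))"
    unfolding certificate_clauses_def
    by (intro polytime_clauses_for polytime_clauses_single polytime_literalI polytime_nat_const
        polytime_nat_length_arg polytime_nat_tl_args W n)
  have initial: "polytime_clauses m W (\<lambda>e. initial_clauses (W e) (x e) (n e))"
    unfolding initial_clauses_def
    by (intro polytime_clauses_append polytime_clauses_concat polytime_clauses_for
          polytime_clauses_assert_in polytime_pred_initial_symbol polytime_pred_const
          polytime_literalI polytime_nat_const polytime_nat_length_arg polytime_nat_tl_args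
          polytime_tl_args W x n)
  have steps: "polytime_clauses m W (\<lambda>e. concat (map (step_clauses (W e)) [0..<T e]))"
    unfolding step_clauses_def
    by (intro polytime_clauses_append polytime_clauses_concat polytime_clauses_for
          polytime_clauses_next_state polytime_clauses_next_stack polytime_nat_length_arg
          polytime_nat_tl_args W T)
  have final: "polytime_clauses m W (\<lambda>e. final_clauses (T e))"
    unfolding final_clauses_def
    by (intro polytime_clauses_append polytime_clauses_assert_in polytime_pred_const
          polytime_literalI polytime_nat_const W T)
  show ?thesis
    unfolding clauses_def by (intro polytime_clauses_append certificate initial steps final)
qed

end


subsection \<open>The network\<close>

definition enc_edges :: "('a \<Rightarrow> rat_edge) \<Rightarrow> 'a list \<Rightarrow> bool list" where
  "enc_edges U T = concat (map (\<lambda>a. True # enc_edge (U a)) T)"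

text \<open>\<open>U e\<close> numbers the nodes of the edges \<open>T e\<close>. The input of the approximation algorithm contains
  both the trips and, concatenated, their edges.\<close>

definition polytime_trip ::
    "nat \<Rightarrow> (bool list list \<Rightarrow> 'a \<Rightarrow> rat_edge) \<Rightarrow> (bool list list \<Rightarrow> 'a list) \<Rightarrow> bool" where
  "polytime_trip m U T \<longleftrightarrow> polytime m (\<lambda>e. enc_edges (U e) (T e))"

definition polytime_trips ::
    "nat \<Rightarrow> (bool list list \<Rightarrow> 'a \<Rightarrow> rat_edge) \<Rightarrow> (bool list list \<Rightarrow> 'a list list) \<Rightarrow> bool" where
  "polytime_trips m U Ts \<longleftrightarrow>
      polytime m (\<lambda>e. concat (map (\<lambda>T. True # enc_edges (U e) T @ [False]) (Ts e))) \<and>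
     polytime_trip m U (\<lambda>e. concat (Ts e))"

lemma enc_edges_simps [simp]:
  "enc_edges U [] = []" "enc_edges U (a # T) = True # enc_edge (U a) @ enc_edges U T"
  "enc_edges U (T @ T') = enc_edges U T @ enc_edges U T'"
  by (simp_all add: enc_edges_def)

lemma enc_edges_concat: "enc_edges U (concat Ts) = concat (map (enc_edges U) Ts)"
  by (induction Ts) simp_all

lemma concat_map_concat: "concat (map f (concat xss)) = concat (map (\<lambda>xs. concat (map f xs)) xss)"
  by (induction xss) simp_all

lemma polytime_trip_Nil: "polytime_trip m U (\<lambda>e. [])"
  by (simp add: polytime_trip_def polytime_const)

lemma polytime_trip_Cons:
  "polytime m (\<lambda>e. enc_edge (U e (a e))) \<Longrightarrow> polytime_trip m U T \<Longrightarrow> polytime_trip m U (\<lambda>e. a e # T e)"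
  by (simp add: polytime_trip_def polytime_Cons polytime_append)

lemma polytime_trips_Nil: "polytime_trips m U (\<lambda>e. [])"
  by (simp add: polytime_trips_def polytime_trip_Nil polytime_const)

lemma polytime_trips_Cons:
  "polytime_trip m U T \<Longrightarrow> polytime_trips m U Ts \<Longrightarrow> polytime_trips m U (\<lambda>e. T e # Ts e)"
  by (simp add: polytime_trips_def polytime_trip_def polytime_Cons polytime_append)

lemma polytime_trips_append:
  "polytime_trips m U Ts \<Longrightarrow> polytime_trips m U Ts' \<Longrightarrow> polytime_trips m U (\<lambda>e. Ts e @ Ts' e)"
  by (simp add: polytime_trips_def polytime_trip_def polytime_append)

lemma polytime_trips_for:
  assumes "polytime_trips (Suc m) (\<lambda>e. U (tl e)) (\<lambda>e. F (length (arg 0 e)) (tl e))"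
      "polytime_nat m n"
  shows "polytime_trips m U (\<lambda>e. concat (map (\<lambda>i. F i e) [0..<n e]))"
  using assms
    polytime_for[of m "\<lambda>i e. concat (map (\<lambda>T. True # enc_edges (U e) T @ [False]) (F i e))" n]
    polytime_for[of m "\<lambda>i e. enc_edges (U e) (concat (F i e))" n]
  by (simp add: polytime_trips_def polytime_trip_def concat_map_concat enc_edges_concat o_def)

lemma polytime_trips_if:
  "polytime_pred m P \<Longrightarrow> polytime_trips m U F \<Longrightarrow> polytime_trips m U G \<Longrightarrow>
    polytime_trips m U (\<lambda>e. if P e then F e else G e)"
  unfolding polytime_trips_def polytime_trip_def if_distrib[of "map _"] if_distrib[of concat]
      if_distrib[of "enc_edges _"]
  by (intro conjI polytime_if) auto

lemma polytime_trips_enc_input: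
  assumes "polytime_trips m U Ts" "polytime_nat m n"
  shows "polytime m (\<lambda>e. enc_input (n e, map (U e) (concat (Ts e)), map (map (U e)) (Ts e)))"
proof -
  have "enc_input (k, map V (concat Vs), map (map V) Vs) = enc_nat k @
      (enc_edges V (concat Vs) @ [False]) @
      concat (map (\<lambda>T. True # enc_edges V T @ [False]) Vs) @ [False]"
    for k V and Vs :: "'a list list"
    by (simp add: enc_input_def enc_list_def enc_edges_def o_def)
  then show ?thesis
    using assms
    by (simp only: polytime_trips_def polytime_trip_def polytime_append polytime_const
      polytime_enc_nat)
qed

lemma polytime_nat_index:
  assumes "polytime_nat m nv" "polytime_nat m k" "polytime_nat m K"
  shows
    "polytime_nat m v \<Longrightarrow> polytime_nat m (\<lambda>e. csp_gadget.index (nv e) D (k e) (K e) (Var (v e)))"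
    "polytime_nat m v \<Longrightarrow> polytime_nat m (\<lambda>e. csp_gadget.index (nv e) D (k e) (K e) (Clause (v e)))"
    "polytime_nat m v \<Longrightarrow> polytime_nat m a \<Longrightarrow> polytime_nat m s \<Longrightarrow>
      polytime_nat m (\<lambda>e. csp_gadget.index (nv e) D (k e) (K e) (Chain (v e) (a e) (s e)))"
    "polytime_nat m v \<Longrightarrow> polytime_nat m (\<lambda>e. csp_gadget.index (nv e) D (k e) (K e) (Source (v e)))"
    "polytime_nat m v \<Longrightarrow> polytime_nat m (\<lambda>e. csp_gadget.index (nv e) D (k e) (K e) (Sink (v e)))"
  unfolding csp_gadget.index.simps csp_gadget.core_size_def
  by (assumption | intro polytime_nat_intros assms)+

lemma polytime_enc_unit_edge:
  "polytime_nat m (\<lambda>e. csp_gadget.index (nv e) D (k e) (K e) (u e)) \<Longrightarrow>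
    polytime_nat m (\<lambda>e. csp_gadget.index (nv e) D (k e) (K e) (v e)) \<Longrightarrow>
    polytime m (\<lambda>e. enc_edge (csp_gadget.unit_edge (nv e) D (k e) (K e) (u e, v e)))"
  unfolding enc_edge_def csp_gadget.unit_edge_def prod.case
  by (intro polytime_append polytime_enc_nat polytime_const)

definition stored_literal :: "bool list \<Rightarrow> nat \<Rightarrow> nat \<times> nat" where
  "stored_literal w s = (nth_block w (2 * s), nth_block w (2 * s + 1))"

lemma polytime_trips_gadget_trips:
  assumes nv: "polytime_nat m nv" and k: "polytime_nat m k" and K: "polytime_nat m K"
    and w: "polytime m w"
  shows "polytime_trips m (\<lambda>e. csp_gadget.unit_edge (nv e) D (k e) (K e))
    (\<lambda>e. csp_gadget.gadget_trips (nv e) D (k e) (K e) (stored_literal (w e)))"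
proof -
  let ?U = "\<lambda>e. csp_gadget.unit_edge (nv e) D (k e) (K e)"
  note nat_intros = polytime_nat_index polytime_nat_intros polytime_nat_nth_block
      polytime_nat_tl_args polytime_tl_args polytime_arg
    nv k K w
  note intros = polytime_trips_append polytime_trips_for polytime_trips_Cons
    polytime_trips_if polytime_trips_Nil polytime_trip_Cons polytime_trip_Nil polytime_enc_unit_edge
    polytime_pred_conj polytime_pred_eq
  have slots: "polytime_trips m ?U (\<lambda>e. concat (map (\<lambda>j. concat (map (\<lambda>p.
      [csp_gadget.slot_trip (stored_literal (w e)) j p]) [0..<3])) [0..<k e]))"
    unfolding csp_gadget.slot_trip_def Let_def stored_literal_def fst_conv snd_conv
    by (intro intros; intro nat_intros)
  have single: "polytime_trips m ?U (\<lambda>e. map (\<lambda>a. [a])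
      (csp_gadget.single_edges (nv e) D (k e) (K e) (stored_literal (w e))))"
    unfolding csp_gadget.single_edges_def stored_literal_def map_append map_concat map_map o_def
      list.map if_distrib[of "map _"] prod.inject
    by (intro intros; intro nat_intros)
  have bridge: "polytime_trips m ?U (\<lambda>e. [[(Var (nv e), Clause 0)]])"
    by (intro intros; intro nat_intros)
  show ?thesis
    using polytime_trips_append[OF bridge polytime_trips_append[OF slots single]]
    by (simp only: csp_gadget.gadget_trips_def concat_map_singleton append.simps)
qed

lemma gadget_trips_cong:
  assumes "\<And>s. s < 3 * m \<Longrightarrow> L s = L' s"
  shows "csp_gadget.gadget_trips nv D m K L = csp_gadget.gadget_trips nv D m K L'"
proof -
  have "map (\<lambda>j. map (csp_gadget.slot_trip L j) [0..<3]) [0..<m] =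
      map (\<lambda>j. map (csp_gadget.slot_trip L' j) [0..<3]) [0..<m]"
    using assms slot_less by (intro map_cong refl) (simp add: csp_gadget.slot_trip_def)
  moreover have "map (\<lambda>s. if L s = l then [] else F s) [0..<3 * m] =
      map (\<lambda>s. if L' s = l then [] else F s) [0..<3 * m]" for l and F :: "nat \<Rightarrow> (node \<times> node) list"
    using assms by (intro map_cong refl) simp
  ultimately show ?thesis
    unfolding csp_gadget.gadget_trips_def csp_gadget.single_edges_def by (simp only:)
qed

context finite_stack_machine
begin

lemma stored_literal_eq:
  assumes "2 < N" "s < 3 * length (run_clauses x n T)"
  shows "stored_literal (enc_nats (literal_nats (run_width x n T) (run_clauses x n T))) s =
      slot_literal x n T s"
proof -
  let ?W = "run_width x n T" and ?ls = "concat (run_clauses x n T)"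
  have "sum_list (map length (run_clauses x n T)) = (\<Sum>c\<leftarrow>run_clauses x n T. 3)"
    using valid_run_clauses[OF assms(1)]
    by (intro arg_cong[of _ _ sum_list] map_cong refl) (simp add: valid_clauses_def)
  then have s: "s < length ?ls" using assms(2) by (simp add: length_concat sum_list_triv)
  have "literal_nats ?W (run_clauses x n T) ! (2 * s + p) =
      [fst (numbered ?W (?ls ! s)), snd (numbered ?W (?ls ! s))] ! p"
    if "p < 2" for p
    using nth_concat_uniform[of "map (\<lambda>l. [fst (numbered ?W l), snd (numbered ?W l)]) ?ls" 2 s p] s
        that
    by (auto simp: literal_nats_def mult.commute)
  from this[of 0] this[of 1] show ?thesis
    using s by (simp add: stored_literal_def nth_block_enc_nats slot_literal_def literal_nats_def
        length_concat o_def sum_list_triv)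
qed

lemma
  assumes x: "polytime m x" and n: "polytime_nat m n" and T: "polytime_nat m T"
  shows polytime_nat_base_size: "polytime_nat m (\<lambda>e. base_size (x e) (n e) (T e))"
    and polytime_run_input: "2 < N \<Longrightarrow> polytime_nat m K \<Longrightarrow>
      polytime m (\<lambda>e. enc_input (run_input (x e) (n e) (T e) (K e)))"
proof -
  let ?W = "\<lambda>e. run_width (x e) (n e) (T e)" and ?cs = "\<lambda>e. run_clauses (x e) (n e) (T e)"
  let ?nv = "\<lambda>e. number_of_variables (?W e) (T e)"
  have W: "polytime_nat m ?W"
    unfolding run_width_def by (intro polytime_nat_intros x n T)
  then have nv: "polytime_nat m ?nv"
    unfolding number_of_variables_def by (intro polytime_nat_intros T)
  have "polytime_clauses m ?W ?cs"
    unfolding run_clauses_def by (rule polytime_clauses_clauses[OF W x n T])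
  then have w: "polytime m (\<lambda>e. enc_nats (literal_nats (?W e) (?cs e)))"
    and k: "polytime_nat m (\<lambda>e. length (?cs e))"
    by (simp_all add: polytime_clauses_def polytime_nats_def)
  show "polytime_nat m (\<lambda>e. base_size (x e) (n e) (T e))"
    unfolding base_size_def csp_gadget.core_size_def by (intro polytime_nat_intros nv k)
  show "polytime m (\<lambda>e. enc_input (run_input (x e) (n e) (T e) (K e)))" if N: "2 < N"
    and K: "polytime_nat m K"
  proof -
    have "csp_gadget.gadget_trips (?nv e) num_values (length (?cs e)) (K e)
        (slot_literal (x e) (n e) (T e)) =
      csp_gadget.gadget_trips (?nv e) num_values (length (?cs e)) (K e)
        (stored_literal (enc_nats (literal_nats (?W e) (?cs e))))" for e
      by (rule gadget_trips_cong) (simp add: stored_literal_eq[OF N])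
    then show ?thesis
      unfolding run_input_def csp_gadget.gadget_input_def csp_gadget.num_nodes_def
          csp_gadget.core_size_def
      by (simp only:)
        (intro polytime_trips_enc_input polytime_trips_gadget_trips polytime_nat_intros nv k K w)
  qed
qed

end


section \<open>From approximations to certificates\<close>

subsection \<open>Certificates of fixed length\<close>

definition unpad :: "bool list \<Rightarrow> bool list" where
  "unpad z = rev (tl (dropWhile Not (rev z)))"

lemma unpad_pad: "unpad (y @ True # replicate n False) = y"
  by (simp add: unpad_def dropWhile_append3)

lemma length_unpad: "length (unpad z) \<le> length z - 1"
  using length_dropWhile_le[of Not "rev z"] by (simp add: unpad_def)

lemma polytime_enc_pair: "polytime m f \<Longrightarrow> polytime m g \<Longrightarrow> polytime m (\<lambda>e. enc_pair (f e) (g e))"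
  unfolding enc_pair_def by (intro polytime_append polytime_enc_string)

lemma polytime_pred_comp1:
  "polytime_pred 1 (\<lambda>e. Q (arg 0 e)) \<Longrightarrow> polytime m f \<Longrightarrow> polytime_pred m (\<lambda>e. Q (f e))"
  unfolding polytime_pred_def by (rule polytime_comp1)

lemma NP_class_fixed_lengthE:
  assumes "L \<in> NP_class"
  obtains R and q :: "nat poly" where "polytime_pred 2 (\<lambda>e. R (arg 0 e) (arg 1 e))"
    "\<And>x. x \<in> L \<longleftrightarrow> (\<exists>z. length z = poly q (length x) \<and> R x z)"
proof -
  obtain V p where V: "V \<in> P_class"
    and L: "\<And>x. x \<in> L \<longleftrightarrow> (\<exists>y. length y \<le> poly p (length x) \<and> enc_pair x y \<in> V)"
    using assms unfolding NP_class_def by blast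
  have "polytime 2 (\<lambda>e. enc_pair (arg 0 e) (unpad (arg 1 e)))"
    unfolding unpad_def
    by (intro polytime_enc_pair polytime_rev polytime_tl polytime_dropWhile polytime_arg)
  with V have R: "polytime_pred 2 (\<lambda>e. enc_pair (arg 0 e) (unpad (arg 1 e)) \<in> V)"
    unfolding P_class_iff_polytime by (rule polytime_pred_comp1)
  have "x \<in> L \<longleftrightarrow> (\<exists>z. length z = poly (p + 1) (length x) \<and> enc_pair x (unpad z) \<in> V)" for x
  proof
    assume "x \<in> L"
    then obtain y where y: "length y \<le> poly p (length x)" "enc_pair x y \<in> V" using L by blast
    let ?z = "y @ True # replicate (poly p (length x) - length y) False"
    show "\<exists>z. length z = poly (p + 1) (length x) \<and> enc_pair x (unpad z) \<in> V"
      using y by (intro exI[of _ ?z]) (simp add: unpad_pad)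
  next
    assume "\<exists>z. length z = poly (p + 1) (length x) \<and> enc_pair x (unpad z) \<in> V"
    then obtain z where "length z = poly p (length x) + 1" "enc_pair x (unpad z) \<in> V" by auto
    then show "x \<in> L" using L length_unpad[of z] by (metis add_diff_cancel_right')
  qed
  with R show thesis by (rule that)
qed

lemma P_class_subset_NP_class: "P_class \<subseteq> NP_class"
proof
  fix L assume "L \<in> P_class"
  then have "{w. decode_string w \<in> L} \<in> P_class"
    unfolding P_class_iff_polytime mem_Collect_eq
    by (rule polytime_pred_comp1) (intro polytime_decode_string polytime_arg)
  moreover have "\<forall>x. x \<in> L \<longleftrightarrow>
      (\<exists>y. length y \<le> poly 0 (length x) \<and> enc_pair x y \<in> {w. decode_string w \<in> L})"
    by (simp add: enc_pair_def)
  ultimately show "L \<in> NP_class" unfolding NP_class_def by blast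
qed

lemma ex_machine_for_pred:
  assumes "polytime_pred 2 (\<lambda>e. R (arg 0 e) (arg 1 e))"
  obtains N Q S h c where "finite_stack_machine N Q S h" "2 < N"
    "\<And>x z. finite_stack_machine.accepts S h x z ((length x + length z + 2) ^ c) \<longleftrightarrow> R x z"
proof -
  have "registers 2 [0, 1] 2 3" by (simp add: registers_def)
  with assms obtain P T where T: "poly_bounded 2 T" and P: "\<And>\<sigma>. \<forall>k\<ge>3. \<sigma> k = [] \<Longrightarrow>
      exec_within P \<sigma> (T (map \<sigma> [0, 1])) 
        (\<sigma>(2 := [R (arg 0 (map \<sigma> [0, 1])) (arg 1 (map \<sigma> [0, 1]))] @ \<sigma> 2))"
    unfolding polytime_pred_def by (rule polytimeE) blast
  obtain c where c: "\<And>e. length e = 2 \<Longrightarrow> T e \<le> arg_size e ^ c" using T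
    unfolding poly_bounded_def by blast
  obtain Q S h where S: "finite_stack_machine (max 3 (stack_bound P)) Q S h" and
    run: "\<And>\<sigma> t \<sigma>'. exec_within P \<sigma> t \<sigma>' \<Longrightarrow> (sm_step S ^^ t) (0, \<sigma>) = (h, \<sigma>')"
    by (rule finite_stack_machine_of_prog[of P "max 3 (stack_bound P)"]) auto
  interpret finite_stack_machine "max 3 (stack_bound P)" Q S h by (rule S)
  have "accepts x z ((length x + length z + 2) ^ c) \<longleftrightarrow> R x z" for x z
  proof -
    let ?\<sigma> = "start x z"
    have "exec_within P ?\<sigma> (T [x, z]) (?\<sigma>(2 := [R x z]))"
      using P[of ?\<sigma>] by (simp add: start_def arg_def)
    then have "exec_within P ?\<sigma> ((length x + length z + 2) ^ c) (?\<sigma>(2 := [R x z]))"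
      by (rule exec_within_mono) (use c[of "[x, z]"] in \<open>simp add: arg_size_def\<close>)
    from run[OF this] show ?thesis by (simp add: accepts_def run_def)
  qed
  moreover have "2 < max 3 (stack_bound P)" by linarith
  ultimately show thesis using S by (intro that[where c = c]) simp_all
qed


subsection \<open>The gap\<close>

lemma reachability_gap:
  fixes C \<epsilon> \<rho> :: real and b K :: nat
  assumes \<epsilon>: "0 < \<epsilon>" "\<epsilon> < 1" and \<rho>: "0 < \<rho>" "\<rho> \<le> C * real (b + 2 * K) powr (1 - \<epsilon>)"
    and C: "0 < C" and b: "0 < b" "b \<le> K" and large: "21 * C * real b < real K powr \<epsilon>"
  shows "real (b * (b + 2 * K) + 2 * K * (b + 1)) < real (K * K) / \<rho>"
proof -
  have K: "0 < real K" using b by simp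
  have "b * (b + 2 * K) + 2 * K * (b + 1) = b * b + 4 * (K * b) + 2 * K"
    by (simp add: algebra_simps)
  also have "\<dots> \<le> K * b + 4 * (K * b) + 2 * (K * b)" using b by (intro add_mono mult_le_mono) auto
  finally have "real (b * (b + 2 * K) + 2 * K * (b + 1)) \<le> real (7 * (K * b))"
    unfolding of_nat_le_iff by simp
  then have small: "real (b * (b + 2 * K) + 2 * K * (b + 1)) \<le> 7 * (real K * real b)" by simp
  have "real (b + 2 * K) powr (1 - \<epsilon>) \<le> (3 * real K) powr (1 - \<epsilon>)"
    using b \<epsilon> by (intro powr_mono2) auto
  also have "\<dots> = 3 powr (1 - \<epsilon>) * real K powr (1 - \<epsilon>)" by (simp add: powr_mult)
  also have "\<dots> \<le> 3 powr 1 * real K powr (1 - \<epsilon>)" using \<epsilon> by (intro mult_right_mono powr_mono) auto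
  finally have "C * real (b + 2 * K) powr (1 - \<epsilon>) \<le> C * (3 powr 1 * real K powr (1 - \<epsilon>))"
    using C by (intro mult_left_mono) simp_all
  with \<rho>(2) have "\<rho> \<le> 3 * C * real K powr (1 - \<epsilon>)" by simp
  then have "7 * (real K * real b) * \<rho> \<le> 7 * (real K * real b) * (3 * C * real K powr (1 - \<epsilon>))"
    by (rule mult_left_mono) simp
  also have "\<dots> = 21 * C * real b * (real K * real K powr (1 - \<epsilon>))" by simp
  also have "\<dots> < real K powr \<epsilon> * (real K * real K powr (1 - \<epsilon>))"
    using large K by (intro mult_strict_right_mono) auto
  also have "\<dots> = real K * (real K powr \<epsilon> * real K powr (1 - \<epsilon>))" by simp
  also have "\<dots> = real (K * K)" using K by (simp flip: powr_add)
  finally have "7 * (real K * real b) < real (K * K) / \<rho>"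
    using \<rho>(1) by (simp add: pos_less_divide_eq)
  with small show ?thesis by simp
qed

lemma ex_reachability_gap:
  fixes \<epsilon> :: real
  assumes \<epsilon>: "0 < \<epsilon>" "\<epsilon> < 1" and r: "\<And>n. 0 < r n" "r \<in> O(\<lambda>n. real n powr (1 - \<epsilon>))"
  obtains c E :: nat where "\<And>b K. 0 < b \<Longrightarrow> K = (b + c) ^ E \<Longrightarrow>
    real (b * (b + 2 * K) + 2 * K * (b + 1)) < real (K * K) / r (b + 2 * K)"
proof -
  obtain C where C: "0 < C" "eventually (\<lambda>n. norm (r n) \<le> C * norm (real n powr (1 - \<epsilon>))) at_top"
    using r(2) by (elim landau_o.bigE)
  then obtain n0 where n0: "\<And>n. n0 \<le> n \<Longrightarrow> r n \<le> C * real n powr (1 - \<epsilon>)"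
    unfolding eventually_at_top_linorder using r(1) by (auto simp: less_imp_le)
  obtain k E :: nat where k: "21 * C < real k" and E: "2 / \<epsilon> < real E"
    using reals_Archimedean2 by metis
  have "real (b * (b + 2 * K) + 2 * K * (b + 1)) < real (K * K) / r (b + 2 * K)"
    if b: "0 < b" and K: "K = (b + (k + n0)) ^ E" for b K
  proof -
    let ?B = "b + (k + n0)"
    have "21 * C * real b < real ?B * real ?B" using k C(1) b by (intro mult_strict_mono) auto
    also have "\<dots> = real ?B powr 2" using b by (simp add: powr_numeral power2_eq_square)
    also have "\<dots> \<le> real ?B powr (real E * \<epsilon>)"
      using E \<epsilon> b by (intro powr_mono) (auto simp: field_simps)
    also have "\<dots> = real K powr \<epsilon>" unfolding K
      using b by (simp add: powr_powr[symmetric] powr_realpow)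
    finally have large: "21 * C * real b < real K powr \<epsilon>" .
    have "E \<noteq> 0" using E \<epsilon> by (cases E) (auto simp: field_simps)
    then have "?B \<le> K" unfolding K using b by (intro self_le_power) auto
    then show ?thesis using reachability_gap[OF \<epsilon> r(1) n0 C(1) b _ large] by simp
  qed
  then show thesis by (rule that)
qed


subsection \<open>Reading certificates off an approximation\<close>

lemma polytime_certificate:
  assumes ts: "polytime m (\<lambda>e. enc_list enc_rat (ts e))" and n: "polytime_nat m n"
    and len: "\<And>e. 3 * n e < length (ts e)"
  shows "polytime m (\<lambda>e. map (\<lambda>i. ts e ! Suc (3 * i) < ts e ! 0) [0..<n e])"
proof -
  let ?w = "\<lambda>e. enc_list enc_rat (ts e)"
  have "polytime m (\<lambda>e.
      concat (map (\<lambda>i. [enc_less (nth_rat (?w e) (Suc (3 * i))) (nth_rat (?w e) 0)]) [0..<n e]))"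
    by (intro polytime_for polytime_pred_enc_less[unfolded polytime_pred_def] polytime_nth_rat
          polytime_tl_args polytime_nat_intros ts n)
  moreover have "map (\<lambda>i. enc_less (nth_rat (?w e) (Suc (3 * i))) (nth_rat (?w e) 0)) [0..<n e] =
      map (\<lambda>i. ts e ! Suc (3 * i) < ts e ! 0) [0..<n e]" for e
  proof (intro map_cong refl)
    fix i assume "i \<in> set [0..<n e]"
    then have "Suc (3 * i) < length (ts e)" "0 < length (ts e)" using len[of e] by auto
    then show "enc_less (nth_rat (?w e) (Suc (3 * i))) (nth_rat (?w e) 0) =
        (ts e ! Suc (3 * i) < ts e ! 0)"
      by (simp add: nth_rat_enc_list enc_less_enc_rat)
  qed
  ultimately show ?thesis by (simp add: concat_map_singleton)
qed

lemma (in finite_stack_machine) certificate_of_approximation: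
  assumes N: "2 < N" and r: "\<And>n. 0 < r n"
    and gap: "real (base_size x n T * (base_size x n T + 2 * K) + 2 * K * (base_size x n T + 1))
      < real (K * K) / r (base_size x n T + 2 * K)"
    and approx: "1 / r (card (nodes (network_of (run_input x n T K)))) *
        real (max_reachability (network_of (run_input x n T K)))
      \<le> real (temporal_reachability (network_of (run_input x n T K)) (\<lambda>i. of_rat (ts ! i)))"
    and z: "length z = n" "accepts x z T"
  shows "accepts x (map (\<lambda>i. ts ! Suc (3 * i) < ts ! 0) [0..<n]) T"
proof -
  let ?G = "network_of (run_input x n T K)" and ?b = "base_size x n T"
  have "real (K * K) / r (?b + 2 * K) \<le> real (max_reachability ?G) / r (?b + 2 * K)"
    using max_reachability_accepts[OF N z] r
    by (intro divide_right_mono) (auto simp: less_imp_le simp del: of_nat_mult)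
  with gap approx have "real (?b * (?b + 2 * K) + 2 * K * (?b + 1))
      < real (temporal_reachability ?G (\<lambda>i. of_rat (ts ! i)))"
    by (simp add: run_input_network(2)[OF N])
  then have "accepts x (map (\<lambda>i. real_of_rat (ts ! Suc (3 * i)) < of_rat (ts ! 0)) [0..<n]) T"
    by (intro accepts_of_reachability[OF N]) (simp only: of_nat_less_iff)
  then show ?thesis by (simp add: of_rat_less)
qed

lemma (in finite_stack_machine) ex_polytime_certificate:
  fixes n T :: "bool list \<Rightarrow> nat"
  assumes N: "2 < N" and M: "poly_time_approximation r M" and r: "\<And>n. 0 < r n"
    and gap: "\<And>b K. 0 < b \<Longrightarrow> K = (b + c) ^ E \<Longrightarrow>
      real (b * (b + 2 * K) + 2 * K * (b + 1)) < real (K * K) / r (b + 2 * K)"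
    and n: "polytime_nat 1 (\<lambda>e. n (arg 0 e))" and T: "polytime_nat 1 (\<lambda>e. T (arg 0 e))"
  obtains cert where "polytime 1 (\<lambda>e. cert (arg 0 e))" "\<And>x. length (cert x) = n x"
    "\<And>x z. length z = n x \<Longrightarrow> accepts x z (T x) \<Longrightarrow> accepts x (cert x) (T x)"
proof -
  define K where "K x = (base_size x (n x) (T x) + c) ^ E" for x
  define I where "I x = run_input x (n x) (T x) (K x)" for x
  obtain p where M: "is_tm M" and "\<And>x. \<exists>ts :: rat list.
      length ts = length (trips (network_of (I x))) \<and>
      outputs_within M (poly p (length (enc_input (I x)))) (enc_input (I x)) (enc_list enc_rat ts) \<and>
      1 / r (card (nodes (network_of (I x)))) * real (max_reachability (network_of (I x)))
        \<le> real (temporal_reachability (network_of (I x)) (\<lambda>i. of_rat (ts ! i)))"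
    using M run_input_network(1)[OF N] unfolding poly_time_approximation_def I_def by metis
  then obtain ts :: "bool list \<Rightarrow> rat list"
    where len: "\<And>x. length (ts x) = length (trips (network_of (I x)))"
      and out: "\<And>x. outputs_within M (poly p (length (enc_input (I x)))) (enc_input (I x))
        (enc_list enc_rat (ts x))"
      and approx: "\<And>x. 1 / r (card (nodes (network_of (I x)))) *
          real (max_reachability (network_of (I x)))
        \<le> real (temporal_reachability (network_of (I x)) (\<lambda>i. of_rat (ts x ! i)))"
    by metis
  let ?cert = "\<lambda>x. map (\<lambda>i. ts x ! Suc (3 * i) < ts x ! 0) [0..<n x]"
  have K: "polytime_nat 1 (\<lambda>e. K (arg 0 e))"
    unfolding K_def by (intro polytime_nat_intros polytime_nat_base_size polytime_arg n T)
  have "polytime 1 (\<lambda>e. enc_list enc_rat (ts (arg 0 e)))"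
    by (rule polytime_turing_machine[OF M polytime_run_input[OF polytime_arg n T N K]
      out[unfolded I_def]])
  then have poly: "polytime 1 (\<lambda>e. ?cert (arg 0 e))"
    by (rule polytime_certificate[OF _ n]) (simp add: len I_def run_input_network(3)[OF N])
  have "accepts x (?cert x) (T x)" if "length z = n x" "accepts x z (T x)" for x z
    by (rule certificate_of_approximation[OF N r gap[OF _ K_def] approx[unfolded I_def] that])
      (simp add: base_size_def csp_gadget.core_size_def)
  with poly show thesis by (intro that[of ?cert]) simp_all
qed

lemma poly_time_approximation_imp_NP_subset_P:
  assumes M: "poly_time_approximation r M" and r: "\<And>n. 0 < r n"
    and gap: "\<And>b K. 0 < b \<Longrightarrow> K = (b + c) ^ E \<Longrightarrow>
      real (b * (b + 2 * K) + 2 * K * (b + 1)) < real (K * K) / r (b + 2 * K)"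
  shows "NP_class \<subseteq> P_class"
proof
  fix L assume "L \<in> NP_class"
  then obtain R and q :: "nat poly" where R: "polytime_pred 2 (\<lambda>e. R (arg 0 e) (arg 1 e))"
    and L: "\<And>x. x \<in> L \<longleftrightarrow> (\<exists>z. length z = poly q (length x) \<and> R x z)"
    by (rule NP_class_fixed_lengthE) blast
  obtain N Q S h k where "finite_stack_machine N Q S h" and N: "2 < N" and
    accepts: "\<And>x z. finite_stack_machine.accepts S h x z ((length x + length z + 2) ^ k) \<longleftrightarrow> R x z"
    using ex_machine_for_pred[OF R] by metis
  then interpret finite_stack_machine N Q S h by simp
  define n T where "n x = poly q (length x)" and "T x = (length x + n x + 2) ^ k"
    for x :: "bool list"
  have "polytime_nat 1 (\<lambda>e. n (arg 0 e))" "polytime_nat 1 (\<lambda>e. T (arg 0 e))"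
    unfolding T_def n_def by (intro polytime_nat_intros)+
  from ex_polytime_certificate[OF N M r gap this]
  obtain cert where cert: "polytime 1 (\<lambda>e. cert (arg 0 e))" and len: "\<And>x. length (cert x) = n x"
    and acc: "\<And>x z. length z = n x \<Longrightarrow> accepts x z (T x) \<Longrightarrow> accepts x (cert x) (T x)"
    by blast
  have "x \<in> L \<longleftrightarrow> R x (cert x)" for x
  proof
    assume "x \<in> L"
    then obtain z where "length z = n x" "R x z" using L by (auto simp: n_def)
    then have "accepts x (cert x) (T x)" using accepts[of x z] by (intro acc) (simp_all add: T_def)
    then show "R x (cert x)" using accepts[of x "cert x"] by (simp add: T_def len)
  next
    assume "R x (cert x)"
    then show "x \<in> L" unfolding L by (intro exI[of _ "cert x"]) (simp add: len n_def)
  qed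
  moreover have "polytime_pred 1 (\<lambda>e. R (arg 0 e) (cert (arg 0 e)))"
    unfolding polytime_pred_def
    by (rule polytime_comp2[OF R[unfolded polytime_pred_def] polytime_arg cert])
  ultimately show "L \<in> P_class" by (simp add: P_class_iff_polytime)
qed

theorem theorem2:
  fixes \<epsilon> :: real and r :: "nat \<Rightarrow> real"
  assumes "P_class \<noteq> NP_class"
    and "0 < \<epsilon>" and "\<epsilon> < 1"
    and "\<And>n. 0 < r n"
    and "mono r"
    and "r \<in> O(\<lambda>n. real n powr (1 - \<epsilon>))"
  shows "\<not> (\<exists>M. poly_time_approximation r M)"
proof
  assume "\<exists>M. poly_time_approximation r M"
  then obtain M where M: "poly_time_approximation r M" by blast
  obtain c E where "\<And>b K. 0 < b \<Longrightarrow> K = (b + c) ^ E \<Longrightarrow>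
      real (b * (b + 2 * K) + 2 * K * (b + 1)) < real (K * K) / r (b + 2 * K)"
    using ex_reachability_gap[OF assms(2-4,6)] by blast
  with M assms(4) have "NP_class \<subseteq> P_class" by (rule poly_time_approximation_imp_NP_subset_P)
  then show False using P_class_subset_NP_class assms(1) by blast
qed

end
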